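(* Let $Q$ be a smooth $n$-manifold, $H:T^*Q\to\mathbb{R}$ a smooth function and $([W_H],J):T^*\mathcal{E}\otimes T^*Q\to T^*Q$ its evolution micromorphism. Let $U\subset\mathbb{R}^n$ be the domain of a coordinate patch of $Q$, giving an admissible local chart $((t,E),(p,q),(P,Q))\in T^*\mathcal{E}\times T^*U\times T^*U$. Then there is a unique local generating function (a function germ around $\{t=0,p=0\}$) of the form $$S(t,p,Q)=\langle p,Q\rangle+tH(0,Q)+f(t,p,Q),$$ where $f$ and its derivatives $\partial_tf,\partial_pf$ vanish at $t=0,p=0$, such that $$W_H^U=\Big\{\big((t,\partial_tS(t,p,Q)),\,(p,\partial_pS(t,p,Q)),\,(\partial_QS(t,p,Q),Q)\big)\Big\},$$ with $(t,p,Q)$ ranging over a suitable neighborhood of $\{t=0,p=0\}$, is a representative of the restriction of the evolution micromorphism to the chart. This $S$ is a solution of the Hamilton-Jacobi equation $$\partial_tS(t,p,Q)=H(\partial_QS(t,p,Q),Q)$$ with initial condition $S(0,p,Q)=\langle p,Q\rangle$.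
   Context: $\mathcal{E}=\mathbb{R}$; points of $T^*\mathcal{E}$ are $(t,E)$, with base point $E$ (energy) and fiber coordinate $t$ (time); points of $T^*Q$ are written $(p,q)$, with $p$ the covector. $\overline{M}$ denotes $M$ with the opposite symplectic form. Sign convention: with $\omega=dp\wedge dq$, the hamiltonian vector field satisfies $\iota_{X_H}\omega=dH$ (i.e. $\dot p=\partial_qH$, $\dot q=-\partial_pH$), and $\Psi_t$ is its flow. The evolution submanifold is $W_H=\{((t,H(\Psi_t(z))),z,\Psi_t(z)):t\in I_z,z\in T^*Q\}\subset\overline{T^*\mathcal{E}}\times\overline{T^*Q}\times T^*Q$, $I_z$ being the maximal interval of existence of $\Psi_t(z)$. The evolution micromorphism $([W_H],J)$ is the germ of the lagrangian submanifold $W_H$ around $\operatorname{gr}J=\{(J(q),q)\}$, viewed inside the zero section, where $J:Q\to\mathcal{E}\times Q$, $J(q)=(H(0,q),q)$. Its restriction to the chart is obtained by intersecting with $T^*\mathcal{E}\times T^*Q|_{\tilde U}\times T^*Q|_{\tilde U}$, where $\tilde U\subset Q$ is the image of the coordinate patch, and transporting to $T^*\mathcal{E}\times T^*U\times T^*U$ by the cotangent maps of the patch; it is a germ around the graph of $J$ in coordinates, and in the claim $H$ and $J$ are written in these coordinates. Two representatives are identified if they agree near $\operatorname{gr}J$. In the formulas $Q$ also denotes the coordinate in the last factor $T^*U$. *)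

theory Defs
  imports "HOL-Analysis.Analysis"
begin

section \<open>Smooth functions on open subsets of normed spaces\<close>

primrec Ck_on :: "nat \<Rightarrow> 'a::real_normed_vector set \<Rightarrow> ('a \<Rightarrow> 'b::real_normed_vector) \<Rightarrow> bool" where
  "Ck_on 0 X f \<longleftrightarrow> continuous_on X f"
| "Ck_on (Suc k) X f \<longleftrightarrow>
     (\<forall>x\<in>X. f differentiable (at x)) \<and> (\<forall>v. Ck_on k X (\<lambda>x. frechet_derivative f (at x) v))"

definition smooth_on :: "'a::real_normed_vector set \<Rightarrow> ('a \<Rightarrow> 'b::real_normed_vector) \<Rightarrow> bool" where
  "smooth_on X f \<longleftrightarrow> (\<forall>k. Ck_on k X f)"

definition gradient :: "(real^'n \<Rightarrow> real) \<Rightarrow> real^'n \<Rightarrow> real^'n::finite" where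
  "gradient f x = (\<chi> i. frechet_derivative f (at x) (axis i 1))"


section \<open>Smooth manifolds\<close>

text \<open>The manifold is a whole type \<open>'m\<close>, Hausdorff and second countable, with a maximal atlas.
  A chart is a pair of its domain and a coordinate map, whose values outside the domain are
  irrelevant; the open set \<open>patch_domain c\<close> is the subset of Euclidean space on which the inverse
  coordinate patch is defined.\<close>

type_synonym ('m, 'n) chart = "'m set \<times> ('m \<Rightarrow> real^'n)"

definition patch_domain :: "('m, 'n::finite) chart \<Rightarrow> (real^'n) set" where
  "patch_domain c = snd c ` fst c"

definition patch :: "('m, 'n::finite) chart \<Rightarrow> real^'n \<Rightarrow> 'm" where
  "patch c = inv_into (fst c) (snd c)"

definition is_chart :: "('m::topological_space, 'n::finite) chart \<Rightarrow> bool" where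
  "is_chart c \<longleftrightarrow> open (fst c) \<and> open (patch_domain c) \<and>
     homeomorphism (fst c) (patch_domain c) (snd c) (patch c)"

definition transition :: "('m, 'n::finite) chart \<Rightarrow> ('m, 'n) chart \<Rightarrow> real^'n \<Rightarrow> real^'n" where
  "transition c d = snd d \<circ> patch c"

definition compatible :: "('m, 'n::finite) chart \<Rightarrow> ('m, 'n) chart \<Rightarrow> bool" where
  "compatible c d \<longleftrightarrow>
     smooth_on (snd c ` (fst c \<inter> fst d)) (transition c d) \<and>
     smooth_on (snd d ` (fst c \<inter> fst d)) (transition d c)"

definition smooth_structure ::
  "('m::{t2_space, second_countable_topology}, 'n::finite) chart set \<Rightarrow> bool" where
  "smooth_structure A \<longleftrightarrow>
     (\<forall>c\<in>A. is_chart c) \<and> (\<Union>c\<in>A. fst c) = UNIV \<and> (\<forall>c\<in>A. \<forall>d\<in>A. compatible c d) \<and>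
     (\<forall>c. is_chart c \<and> (\<forall>d\<in>A. compatible c d) \<longrightarrow> c \<in> A)"


section \<open>The cotangent bundle\<close>

text \<open>A covector at \<open>q\<close> is given by its components in every chart around \<open>q\<close>, which are related
  by the transposed derivatives of the transition maps. The components in all other charts are set
  to zero, so that a covector is represented by exactly one value.\<close>

type_synonym ('m, 'n) covector = "'m \<times> (('m, 'n) chart \<Rightarrow> real^'n)"

definition cotangent_bundle :: "('m, 'n::finite) chart set \<Rightarrow> ('m, 'n) covector set" where
  "cotangent_bundle A = {(q, \<xi>).
     (\<forall>c. \<not> (c \<in> A \<and> q \<in> fst c) \<longrightarrow> \<xi> c = 0) \<and>
     (\<forall>c\<in>A. \<forall>d\<in>A. q \<in> fst c \<inter> fst d \<longrightarrow>
        (\<forall>v. \<xi> c \<bullet> v = \<xi> d \<bullet> frechet_derivative (transition c d) (at (snd c q)) v))}"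

definition zero_covector :: "'m \<Rightarrow> ('m, 'n::finite) covector" where
  "zero_covector q = (q, \<lambda>_. 0)"

definition cotangent_over ::
  "('m, 'n::finite) chart set \<Rightarrow> ('m, 'n) chart \<Rightarrow> ('m, 'n) covector set" where
  "cotangent_over A c = {z \<in> cotangent_bundle A. fst z \<in> fst c}"

text \<open>The cotangent chart, with values \<open>(p, q)\<close> (covector first), and its inverse.\<close>

definition cot_chart :: "('m, 'n::finite) chart \<Rightarrow> ('m, 'n) covector \<Rightarrow> (real^'n) \<times> (real^'n)" where
  "cot_chart c z = (snd z c, snd c (fst z))"

definition cot_patch ::
  "('m, 'n::finite) chart set \<Rightarrow> ('m, 'n) chart \<Rightarrow> (real^'n) \<times> (real^'n) \<Rightarrow> ('m, 'n) covector" where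
  "cot_patch A c = inv_into (cotangent_over A c) (cot_chart c)"

definition cotangent_topology ::
  "('m, 'n::finite) chart set \<Rightarrow> ('m, 'n) covector topology" where
  "cotangent_topology A = topology (\<lambda>W. W \<subseteq> cotangent_bundle A \<and>
     (\<forall>c\<in>A. open (cot_chart c ` (W \<inter> cotangent_over A c))))"

lemma inj_on_cot_chart:
  assumes "smooth_structure A" "c \<in> A"
  shows "inj_on (cot_chart c) (cotangent_over A c)"
proof (rule inj_onI)
  fix z z'
  assume z: "z \<in> cotangent_over A c" and z': "z' \<in> cotangent_over A c"
    and eq: "cot_chart c z = cot_chart c z'"
  obtain q \<xi> where zz: "z = (q, \<xi>)" by (cases z)
  obtain q' \<xi>' where zz': "z' = (q', \<xi>')" by (cases z')
  have q: "q \<in> fst c" "q' \<in> fst c" and c: "\<xi> c = \<xi>' c" and cq: "snd c q = snd c q'"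
    using z z' eq by (simp_all add: zz zz' cot_chart_def cotangent_over_def)
  have "is_chart c"
    using assms by (simp add: smooth_structure_def)
  then have inv: "patch c (snd c x) = x" if "x \<in> fst c" for x
    using that by (simp add: is_chart_def homeomorphism_def)
  have qq: "q' = q"
    using inv[OF q(1)] inv[OF q(2)] cq by metis
  have B: "(q, \<xi>) \<in> cotangent_bundle A" "(q, \<xi>') \<in> cotangent_bundle A"
    using z z' by (simp_all only: zz zz' qq cotangent_over_def mem_Collect_eq)
  have zero: "\<eta> d = 0" if "(q, \<eta>) \<in> cotangent_bundle A" "\<not> (d \<in> A \<and> q \<in> fst d)" for \<eta> d
    using that unfolding cotangent_bundle_def mem_Collect_eq prod.case by meson
  have trans: "\<eta> d \<bullet> v = \<eta> c \<bullet> frechet_derivative (transition d c) (at (snd d q)) v"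
    if \<eta>: "(q, \<eta>) \<in> cotangent_bundle A" and d: "d \<in> A" "q \<in> fst d" for \<eta> d v
  proof -
    have "\<forall>c\<in>A. \<forall>d\<in>A. q \<in> fst c \<inter> fst d \<longrightarrow>
        (\<forall>v. \<eta> c \<bullet> v = \<eta> d \<bullet> frechet_derivative (transition c d) (at (snd c q)) v)"
      using \<eta> unfolding cotangent_bundle_def mem_Collect_eq prod.case by (rule conjunct2)
    note * = this[THEN bspec, OF d(1), THEN bspec, OF assms(2)]
    show ?thesis
      by (rule spec[OF mp[OF * IntI[OF d(2) q(1)]]])
  qed
  have "\<xi> d = \<xi>' d" for d
  proof (cases "d \<in> A \<and> q \<in> fst d")
    case True
    then have d: "d \<in> A" "q \<in> fst d" by blast+
    have "\<forall>v. \<xi> d \<bullet> v = \<xi>' d \<bullet> v"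
      unfolding trans[OF B(1) d] trans[OF B(2) d] c by (intro allI refl)
    then show ?thesis
      by (simp only: vector_eq_rdot)
  next
    case False
    show ?thesis
      unfolding zero[OF B(1) False] zero[OF B(2) False] by (rule refl)
  qed
  then have "\<xi> = \<xi>'" ..
  then show "z = z'"
    by (simp only: zz zz' qq)
qed

lemma openin_cotangent_topology:
  assumes "smooth_structure A"
  shows "openin (cotangent_topology A) W \<longleftrightarrow> W \<subseteq> cotangent_bundle A \<and>
     (\<forall>c\<in>A. open (cot_chart c ` (W \<inter> cotangent_over A c)))"
proof -
  let ?P = "\<lambda>W. W \<subseteq> cotangent_bundle A \<and> (\<forall>c\<in>A. open (cot_chart c ` (W \<inter> cotangent_over A c)))"
  have "istopology ?P"
    unfolding istopology_def
  proof (intro conjI allI impI)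
    fix V W assume V: "?P V" and W: "?P W"
    show "V \<inter> W \<subseteq> cotangent_bundle A" using V by auto
    show "\<forall>c\<in>A. open (cot_chart c ` (V \<inter> W \<inter> cotangent_over A c))"
    proof
      fix c assume c: "c \<in> A"
      have "cot_chart c ` (V \<inter> W \<inter> cotangent_over A c) =
          cot_chart c ` ((V \<inter> cotangent_over A c) \<inter> (W \<inter> cotangent_over A c))"
        by (simp add: Int_ac)
      also have "\<dots> = cot_chart c ` (V \<inter> cotangent_over A c) \<inter> cot_chart c ` (W \<inter> cotangent_over A c)"
        by (rule inj_on_image_Int[OF inj_on_cot_chart[OF assms c]]) auto
      finally have "cot_chart c ` (V \<inter> W \<inter> cotangent_over A c) =
          cot_chart c ` (V \<inter> cotangent_over A c) \<inter> cot_chart c ` (W \<inter> cotangent_over A c)" .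
      then show "open (cot_chart c ` (V \<inter> W \<inter> cotangent_over A c))"
        using V W c by (simp add: open_Int)
    qed
  next
    fix \<K> assume K: "\<forall>K\<in>\<K>. ?P K"
    show "\<Union>\<K> \<subseteq> cotangent_bundle A" using K by (meson Sup_least)
    show "\<forall>c\<in>A. open (cot_chart c ` (\<Union>\<K> \<inter> cotangent_over A c))"
    proof
      fix c assume c: "c \<in> A"
      have "open (\<Union>K\<in>\<K>. cot_chart c ` (K \<inter> cotangent_over A c))"
      proof (rule open_UN, rule ballI)
        fix K assume "K \<in> \<K>"
        with K have "?P K" by (rule bspec)
        then show "open (cot_chart c ` (K \<inter> cotangent_over A c))"
          using c by (rule bspec[OF conjunct2])
      qed
      then show "open (cot_chart c ` (\<Union>\<K> \<inter> cotangent_over A c))"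
        unfolding Int_Union2 image_UN .
    qed
  qed
  then show ?thesis
    unfolding cotangent_topology_def by (simp add: topology_inverse')
qed

definition in_chart ::
  "('m, 'n::finite) chart set \<Rightarrow> ('m, 'n) chart \<Rightarrow> (('m, 'n) covector \<Rightarrow> real) \<Rightarrow>
     (real^'n) \<times> (real^'n) \<Rightarrow> real" where
  "in_chart A c H = H \<circ> cot_patch A c"

definition smooth_hamiltonian ::
  "('m, 'n::finite) chart set \<Rightarrow> (('m, 'n) covector \<Rightarrow> real) \<Rightarrow> bool" where
  "smooth_hamiltonian A H \<longleftrightarrow> (\<forall>c\<in>A. smooth_on (UNIV \<times> patch_domain c) (in_chart A c H))"


section \<open>Hamiltonian flow\<close>

text \<open>The canonical form \<open>dp \<and> dq\<close> on pairs \<open>(p, q)\<close>. With \<open>\<iota>\<^sub>X \<omega> = dH\<close> this gives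
  \<open>p' = \<partial>\<^sub>q H\<close> and \<open>q' = - \<partial>\<^sub>p H\<close>.\<close>

definition canonical_form :: "(real^'n) \<times> (real^'n) \<Rightarrow> (real^'n) \<times> (real^'n::finite) \<Rightarrow> real" where
  "canonical_form v w = fst v \<bullet> snd w - fst w \<bullet> snd v"

definition hamiltonian_vector ::
  "((real^'n) \<times> (real^'n::finite) \<Rightarrow> real) \<Rightarrow> (real^'n) \<times> (real^'n) \<Rightarrow> (real^'n) \<times> (real^'n) \<Rightarrow> bool" where
  "hamiltonian_vector h z v \<longleftrightarrow> (\<forall>w. canonical_form v w = frechet_derivative h (at z) w)"

definition integral_curve ::
  "('m, 'n::finite) chart set \<Rightarrow> (('m, 'n) covector \<Rightarrow> real) \<Rightarrow> real set \<Rightarrow>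
     (real \<Rightarrow> ('m, 'n) covector) \<Rightarrow> bool" where
  "integral_curve A H I \<gamma> \<longleftrightarrow> open I \<and> is_interval I \<and>
     continuous_map (top_of_set I) (cotangent_topology A) \<gamma> \<and>
     (\<forall>t\<in>I. \<forall>c\<in>A. fst (\<gamma> t) \<in> fst c \<longrightarrow>
        (\<exists>v. hamiltonian_vector (in_chart A c H) (cot_chart c (\<gamma> t)) v \<and>
             ((\<lambda>s. cot_chart c (\<gamma> s)) has_vector_derivative v) (at t)))"

definition existence_interval ::
  "('m, 'n::finite) chart set \<Rightarrow> (('m, 'n) covector \<Rightarrow> real) \<Rightarrow> ('m, 'n) covector \<Rightarrow> real set" where
  "existence_interval A H z = \<Union>{I. 0 \<in> I \<and> (\<exists>\<gamma>. integral_curve A H I \<gamma> \<and> \<gamma> 0 = z)}"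

definition hamiltonian_flow ::
  "('m, 'n::finite) chart set \<Rightarrow> (('m, 'n) covector \<Rightarrow> real) \<Rightarrow> real \<Rightarrow> ('m, 'n) covector \<Rightarrow>
     ('m, 'n) covector" where
  "hamiltonian_flow A H t z =
     (THE z'. \<exists>I \<gamma>. integral_curve A H I \<gamma> \<and> 0 \<in> I \<and> \<gamma> 0 = z \<and> t \<in> I \<and> \<gamma> t = z')"


section \<open>Germs and the evolution micromorphism\<close>

text \<open>The germ of a subset \<open>W\<close> around \<open>K\<close> is the set of its representatives.\<close>

definition set_germ :: "'a topology \<Rightarrow> 'a set \<Rightarrow> 'a set \<Rightarrow> 'a set set" where
  "set_germ X K W = {W'. W' \<subseteq> topspace X \<and> (\<exists>N. openin X N \<and> K \<subseteq> N \<and> W' \<inter> N = W \<inter> N)}"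

definition function_germ :: "'a::topological_space set \<Rightarrow> ('a \<Rightarrow> 'b) \<Rightarrow> ('a \<Rightarrow> 'b) set" where
  "function_germ K S = {S'. \<exists>N. open N \<and> K \<subseteq> N \<and> (\<forall>x\<in>N. S' x = S x)}"

text \<open>Points of \<open>T\<^sup>*\<E> \<times> T\<^sup>*Q \<times> T\<^sup>*Q\<close> are \<open>((t, E), z, z')\<close>.\<close>

type_synonym ('m, 'n) evolution_point =
  "(real \<times> real) \<times> ('m, 'n) covector \<times> ('m, 'n) covector"

type_synonym 'n evolution_coords =
  "(real \<times> real) \<times> ((real^'n) \<times> (real^'n)) \<times> ((real^'n) \<times> (real^'n))"

definition evolution_submanifold ::
  "('m, 'n::finite) chart set \<Rightarrow> (('m, 'n) covector \<Rightarrow> real) \<Rightarrow> ('m, 'n) evolution_point set" where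
  "evolution_submanifold A H =
     {((t, H (hamiltonian_flow A H t z)), z, hamiltonian_flow A H t z) | t z.
        z \<in> cotangent_bundle A \<and> t \<in> existence_interval A H z}"

definition evolution_core :: "(('m, 'n::finite) covector \<Rightarrow> real) \<Rightarrow> 'm \<Rightarrow> real \<times> 'm" where
  "evolution_core H q = (H (zero_covector q), q)"

text \<open>The graph of \<open>J\<close>, viewed inside the zero section.\<close>

definition core_graph :: "('m \<Rightarrow> real \<times> 'm) \<Rightarrow> ('m, 'n::finite) evolution_point set" where
  "core_graph J = {((0, fst (J q)), zero_covector (snd (J q)), zero_covector q) | q. True}"

definition evolution_micromorphism ::
  "('m, 'n::finite) chart set \<Rightarrow> (('m, 'n) covector \<Rightarrow> real) \<Rightarrow>
     ('m, 'n) evolution_point set set \<times> ('m \<Rightarrow> real \<times> 'm)" where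
  "evolution_micromorphism A H =
     (set_germ (prod_topology euclidean (prod_topology (cotangent_topology A) (cotangent_topology A)))
        (core_graph (evolution_core H)) (evolution_submanifold A H),
      evolution_core H)"


section \<open>Restriction to a chart\<close>

definition restrict_set ::
  "('m, 'n::finite) chart set \<Rightarrow> ('m, 'n) chart \<Rightarrow> ('m, 'n) evolution_point set \<Rightarrow>
     'n evolution_coords set" where
  "restrict_set A c W = (\<lambda>(te, z, z'). (te, cot_chart c z, cot_chart c z')) `
     (W \<inter> UNIV \<times> cotangent_over A c \<times> cotangent_over A c)"

definition core_in_chart ::
  "('m, 'n::finite) chart \<Rightarrow> ('m \<Rightarrow> real \<times> 'm) \<Rightarrow> real^'n \<Rightarrow> real \<times> (real^'n)" where
  "core_in_chart c J x = (fst (J (patch c x)), snd c (snd (J (patch c x))))"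

definition core_graph_in_chart ::
  "(real^'n) set \<Rightarrow> (real^'n \<Rightarrow> real \<times> (real^'n)) \<Rightarrow> 'n::finite evolution_coords set" where
  "core_graph_in_chart U J = {((0, fst (J x)), (0, snd (J x)), (0, x)) | x. x \<in> U}"

definition restrict_micromorphism ::
  "('m, 'n::finite) chart set \<Rightarrow> ('m, 'n) chart \<Rightarrow>
     ('m, 'n) evolution_point set set \<times> ('m \<Rightarrow> real \<times> 'm) \<Rightarrow>
     'n evolution_coords set set \<times> (real^'n \<Rightarrow> real \<times> (real^'n))" where
  "restrict_micromorphism A c M =
     (\<Union>W\<in>fst M. set_germ
        (top_of_set (UNIV \<times> (UNIV \<times> patch_domain c) \<times> (UNIV \<times> patch_domain c)))
        (core_graph_in_chart (patch_domain c) (core_in_chart c (snd M)))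
        (restrict_set A c W),
      core_in_chart c (snd M))"


section \<open>Generating functions\<close>

text \<open>Arguments are \<open>(t, p, Q)\<close>. Covectors on Euclidean space are identified with vectors through
  the inner product.\<close>

definition d_t :: "(real \<times> (real^'n) \<times> (real^'n) \<Rightarrow> real) \<Rightarrow> real \<Rightarrow> real^'n \<Rightarrow> real^'n::finite \<Rightarrow> real" where
  "d_t S t p Q = deriv (\<lambda>s. S (s, p, Q)) t"

definition d_p :: "(real \<times> (real^'n) \<times> (real^'n) \<Rightarrow> real) \<Rightarrow> real \<Rightarrow> real^'n \<Rightarrow> real^'n::finite \<Rightarrow> real^'n" where
  "d_p S t p Q = gradient (\<lambda>p'. S (t, p', Q)) p"

definition d_Q :: "(real \<times> (real^'n) \<times> (real^'n) \<Rightarrow> real) \<Rightarrow> real \<Rightarrow> real^'n \<Rightarrow> real^'n::finite \<Rightarrow> real^'n" where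
  "d_Q S t p Q = gradient (\<lambda>Q'. S (t, p, Q')) Q"

definition zero_locus :: "(real^'n) set \<Rightarrow> (real \<times> (real^'n) \<times> (real^'n::finite)) set" where
  "zero_locus U = {0} \<times> {0} \<times> U"

definition generated_set ::
  "(real \<times> (real^'n) \<times> (real^'n::finite)) set \<Rightarrow> (real \<times> (real^'n) \<times> (real^'n) \<Rightarrow> real) \<Rightarrow>
     'n evolution_coords set" where
  "generated_set N S = {((t, d_t S t p Q), (p, d_p S t p Q), (d_Q S t p Q, Q)) | t p Q. (t, p, Q) \<in> N}"

definition local_generating_function ::
  "('m, 'n::finite) chart set \<Rightarrow> (('m, 'n) covector \<Rightarrow> real) \<Rightarrow> ('m, 'n) chart \<Rightarrow>
     (real \<times> (real^'n) \<times> (real^'n) \<Rightarrow> real) \<Rightarrow> bool" where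
  "local_generating_function A H c S \<longleftrightarrow>
     (\<exists>N f. open N \<and> zero_locus (patch_domain c) \<subseteq> N \<and> N \<subseteq> UNIV \<times> UNIV \<times> patch_domain c \<and>
        smooth_on N S \<and>
        (\<forall>(t, p, Q)\<in>N. S (t, p, Q) = p \<bullet> Q + t * in_chart A c H (0, Q) + f (t, p, Q)) \<and>
        (\<forall>Q\<in>patch_domain c. f (0, 0, Q) = 0 \<and> d_t f 0 0 Q = 0 \<and> d_p f 0 0 Q = 0) \<and>
        generated_set N S \<in> fst (restrict_micromorphism A c (evolution_micromorphism A H)))"

text \<open>Equations between function germs around \<open>{t = 0, p = 0}\<close> hold on some neighborhood of it.\<close>

definition solves_hamilton_jacobi ::
  "(real^'n) set \<Rightarrow> ((real^'n) \<times> (real^'n::finite) \<Rightarrow> real) \<Rightarrow>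
     (real \<times> (real^'n) \<times> (real^'n) \<Rightarrow> real) \<Rightarrow> bool" where
  "solves_hamilton_jacobi U h S \<longleftrightarrow>
     (\<exists>N. open N \<and> zero_locus U \<subseteq> N \<and> N \<subseteq> UNIV \<times> UNIV \<times> U \<and>
        (\<forall>(t, p, Q)\<in>N. d_t S t p Q = h (d_Q S t p Q, Q)) \<and>
        (\<forall>p Q. (0, p, Q) \<in> N \<longrightarrow> S (0, p, Q) = p \<bullet> Q))"

end

theory Submission
  imports Defs
begin

text \<open>The flow of a smooth vector field is smooth, by induction on the order of differentiability: the
  directional derivatives of the flow solve the variational equation. In a chart write the
  hamiltonian flow as \<open>(p, q) \<mapsto> (P, Q)\<close> and put
  \<open>a (t, p, q) = p \<bullet> q + \<integral>\<^bsub>0\<^esub>\<^bsup>t\<^esup> (H + P \<bullet> Q') ds\<close>. Hamilton's equations give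
  \<open>da = H dt + q dp + P dQ\<close>. Since \<open>Q = q\<close> at \<open>t = 0\<close>, the map \<open>(t, p, q) \<mapsto> (t, p, Q)\<close> is a
  diffeomorphism near \<open>{t = 0, p = 0}\<close>; expressing \<open>a\<close> in the coordinates \<open>(t, p, Q)\<close> gives \<open>S\<close> with
  \<open>\<partial>\<^sub>t S = H (P, Q)\<close>, \<open>\<partial>\<^sub>p S = q\<close> and \<open>\<partial>\<^sub>Q S = P\<close>. Conversely, the graph of the differential of any
  local generating function lies near the core in the graph of the flow, so that its differential
  is that of \<open>S\<close>.\<close>

section \<open>Calculus of the classes Ck\<close>

text \<open>The patch domain is not compact, so nothing is uniform along {t = 0, p = 0}: existence
  times, boxes and local inverses shrink from point to point. Flow and action are therefore given by
  one formula on the whole chart, so that what holds near each point holds on the union of the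
  neighbourhoods. Injectivity of the mixed coordinate map is the one property that does not pass to
  unions; it is obtained from boxes whose size controls how far the last coordinate can move. The
  action starts at p \<bullet> q because its differential q dp + p dq already has the form q dp + P
  dQ at t = 0. The conditions on f play two roles. They put the graph of dS through the core over
  the zero locus, so that by continuity nearby points of the graph fall into any given neighbourhood
  of the core, and they make S vanish on the zero locus, which removes the additive constant left by
  comparing differentials. The comparison takes place on small convex boxes and then holds on their
  union. The Hamilton-Jacobi equation needs no separate argument: it is the energy component of
  lying in the evolution submanifold.\<close>

abbreviation fderiv :: "('a::real_normed_vector \<Rightarrow> 'b::real_normed_vector) \<Rightarrow> 'a \<Rightarrow> 'a \<Rightarrow> 'b" where
  "fderiv f x \<equiv> frechet_derivative f (at x)"

text \<open>Derivatives at a point of an open set see only nearby values, so continuing a function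
  differently outside does not change its class. Later proofs use this to replace a map by an
  explicit formula.\<close>

lemma Ck_on_cong:
  assumes "open X" "\<And>x. x \<in> X \<Longrightarrow> f x = g x"
  shows "Ck_on k X f \<longleftrightarrow> Ck_on k X g"
  using assms(2)
proof (induction k arbitrary: f g)
  case 0
  then show ?case by (simp cong: continuous_on_cong)
next
  case (Suc k)
  have der: "(f has_derivative D) (at x) \<longleftrightarrow> (g has_derivative D) (at x)" if "x \<in> X" for x D
    using Suc.prems assms(1) that
    by (metis has_derivative_transform_within_open)
  \<comment> \<open>\<open>frechet_derivative\<close> is a choice among all derivatives; f and g
    have the same ones, so the choices coincide even where none exists.\<close>
  have fd: "fderiv f x = fderiv g x" if "x \<in> X" for x
    unfolding frechet_derivative_def der[OF that] ..
  have "Ck_on k X (\<lambda>x. fderiv f x v) = Ck_on k X (\<lambda>x. fderiv g x v)" for v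
    by (rule Suc.IH) (simp add: fd)
  then show ?case
    using der by (auto simp: differentiable_def)
qed

lemma Ck_on_subset: "Ck_on k X f \<Longrightarrow> Y \<subseteq> X \<Longrightarrow> Ck_on k Y f"
  by (induction k arbitrary: f) (auto intro: continuous_on_subset)

lemma Ck_on_SucD: "Ck_on (Suc k) X f \<Longrightarrow> Ck_on k X f"
proof (induction k arbitrary: f)
  case 0
  then show ?case
    by (auto intro!: continuous_at_imp_continuous_on differentiable_imp_continuous_within)
qed auto

lemma Ck_on_mono: "Ck_on m X f \<Longrightarrow> k \<le> m \<Longrightarrow> Ck_on k X f"
  by (induction m) (auto simp del: Ck_on.simps simp: le_Suc_eq dest: Ck_on_SucD)

lemma Ck_on_imp_continuous_on: "Ck_on k X f \<Longrightarrow> continuous_on X f"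
  using Ck_on_mono[of k X f 0] by simp

lemma Ck_on_has_derivative:
  "Ck_on (Suc k) X f \<Longrightarrow> x \<in> X \<Longrightarrow> (f has_derivative fderiv f x) (at x)"
  by (simp add: frechet_derivative_works)

text \<open>The recursive definition speaks of a chosen derivative; with an explicit formula for it,
  only the order of that formula remains to be examined.\<close>

lemma Ck_on_SucI:
  assumes "open X" "\<And>x. x \<in> X \<Longrightarrow> (f has_derivative F x) (at x)" "\<And>v. Ck_on k X (\<lambda>x. F x v)"
  shows "Ck_on (Suc k) X f"
proof -
  have "Ck_on k X (\<lambda>x. fderiv f x v)" for v
    using assms(3)[of v] Ck_on_cong[OF assms(1), of "\<lambda>x. fderiv f x v" "\<lambda>x. F x v"]
    by (metis assms(2) frechet_derivative_at)
  then show ?thesis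
    using assms(2) by (auto simp: differentiable_def)
qed

text \<open>Regularity passes to unions of open sets, which is what allows flow domains to be
  united.\<close>

lemma Ck_on_localI:
  assumes "\<And>x. x \<in> X \<Longrightarrow> \<exists>Y. open Y \<and> x \<in> Y \<and> Ck_on k Y f"
  shows "Ck_on k X f"
  using assms
proof (induction k arbitrary: f)
  case 0
  then show ?case
    by (metis Ck_on.simps(1) continuous_at_imp_continuous_on continuous_on_eq_continuous_at)
next
  case (Suc k)
  have "Ck_on k X (\<lambda>x. fderiv f x v)" for v
    by (rule Suc.IH) (use Suc.prems in fastforce)
  then show ?case using Suc.prems by fastforce
qed

lemma Ck_on_const [simp]: "Ck_on k X (\<lambda>x. a)"
  by (induction k arbitrary: a) auto

lemma Ck_on_compose_bounded_linear:
  assumes "bounded_linear L" "open X" "Ck_on k X f"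
  shows "Ck_on k X (\<lambda>x. L (f x))"
  using assms(3)
proof (induction k arbitrary: f)
  case 0
  then show ?case
    using bounded_linear.continuous_on[OF assms(1)] by auto
next
  case (Suc k)
  show ?case
  proof (rule Ck_on_SucI[OF assms(2)])
    show "((\<lambda>x. L (f x)) has_derivative (\<lambda>v. L (fderiv f x v))) (at x)" if "x \<in> X" for x
      using bounded_linear.has_derivative[OF assms(1) Ck_on_has_derivative[OF Suc.prems that]] .
    show "Ck_on k X (\<lambda>x. L (fderiv f x v))" for v
      using Suc by auto
  qed
qed

lemma Ck_on_ident [simp]: "Ck_on k X (\<lambda>x. x)"
proof (cases k)
  case (Suc m)
  then show ?thesis by simp
qed simp

lemma Ck_on_bounded_linear: "bounded_linear L \<Longrightarrow> Ck_on k X L"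
  by (rule Ck_on_subset[OF Ck_on_compose_bounded_linear[OF _ open_UNIV Ck_on_ident]]) auto

lemma Ck_on_add:
  assumes "open X" "Ck_on k X f" "Ck_on k X g"
  shows "Ck_on k X (\<lambda>x. f x + g x)"
  using assms(2,3)
proof (induction k arbitrary: f g)
  case (Suc k)
  show ?case
  proof (rule Ck_on_SucI[OF assms(1)])
    show "((\<lambda>x. f x + g x) has_derivative
        (\<lambda>v. fderiv f x v + fderiv g x v)) (at x)" if "x \<in> X" for x
      using Suc.prems that by (intro has_derivative_add Ck_on_has_derivative)
    show "Ck_on k X (\<lambda>x. fderiv f x v + fderiv g x v)" for v
      using Suc by auto
  qed
qed (auto intro: continuous_on_add)

lemma Ck_on_bilinear:
  assumes "bounded_bilinear B" "open X" "Ck_on k X f" "Ck_on k X g"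
  shows "Ck_on k X (\<lambda>x. B (f x) (g x))"
  using assms(3,4)
proof (induction k arbitrary: f g)
  case 0
  then show ?case
    using bounded_bilinear.continuous_on[OF assms(1)] by auto
next
  case (Suc k)
  show ?case
  proof (rule Ck_on_SucI[OF assms(2)])
    show "((\<lambda>x. B (f x) (g x)) has_derivative
        (\<lambda>v. B (f x) (fderiv g x v) + B (fderiv f x v) (g x))) (at x)"
      if "x \<in> X" for x
      using Suc.prems that by (intro bounded_bilinear.FDERIV[OF assms(1)] Ck_on_has_derivative)
    show "Ck_on k X (\<lambda>x. B (f x) (fderiv g x v) + B (fderiv f x v) (g x))" for v
    proof (rule Ck_on_add[OF assms(2)])
      show "Ck_on k X (\<lambda>x. B (f x) (fderiv g x v))"
        using Suc.IH[OF Ck_on_SucD[OF Suc.prems(1)]] Suc.prems(2) by simp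
      show "Ck_on k X (\<lambda>x. B (fderiv f x v) (g x))"
        using Suc.IH[OF _ Ck_on_SucD[OF Suc.prems(2)]] Suc.prems(1) by simp
    qed
  qed
qed

lemmas Ck_on_scaleR = Ck_on_bilinear[OF bounded_bilinear_scaleR]
lemmas Ck_on_inner = Ck_on_bilinear[OF bounded_bilinear_inner]
lemmas Ck_on_mult = Ck_on_bilinear[OF bounded_bilinear_mult]

lemma Ck_on_minus: "open X \<Longrightarrow> Ck_on k X f \<Longrightarrow> Ck_on k X (\<lambda>x. - f x)"
  by (rule Ck_on_compose_bounded_linear[OF bounded_linear_minus[OF bounded_linear_ident]])

lemma Ck_on_diff:
  assumes "open X" "Ck_on k X f" "Ck_on k X g"
  shows "Ck_on k X (\<lambda>x. f x - g x)"
  using Ck_on_add[OF assms(1,2) Ck_on_minus[OF assms(1,3)]] by simp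

lemma Ck_on_sum:
  assumes "open X" "\<And>i. i \<in> I \<Longrightarrow> Ck_on k X (f i)"
  shows "Ck_on k X (\<lambda>x. \<Sum>i\<in>I. f i x)"
  using assms(2)
  by (induction I rule: infinite_finite_induct) (auto intro: Ck_on_add assms(1))

lemma Ck_on_prod:
  fixes f :: "'i \<Rightarrow> 'a::real_normed_vector \<Rightarrow> real"
  assumes "open X" "\<And>i. i \<in> I \<Longrightarrow> Ck_on k X (f i)"
  shows "Ck_on k X (\<lambda>x. \<Prod>i\<in>I. f i x)"
  using assms(2)
  by (induction I rule: infinite_finite_induct) (auto intro: Ck_on_mult assms(1))

lemma Ck_on_fst: "open X \<Longrightarrow> Ck_on k X f \<Longrightarrow> Ck_on k X (\<lambda>x. fst (f x))"
  by (rule Ck_on_compose_bounded_linear[OF bounded_linear_fst])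

lemma Ck_on_snd: "open X \<Longrightarrow> Ck_on k X f \<Longrightarrow> Ck_on k X (\<lambda>x. snd (f x))"
  by (rule Ck_on_compose_bounded_linear[OF bounded_linear_snd])

lemma Ck_on_Pair:
  assumes "open X" "Ck_on k X f" "Ck_on k X g"
  shows "Ck_on k X (\<lambda>x. (f x, g x))"
proof -
  have "Ck_on k X (\<lambda>x. (f x, 0) + (0, g x))"
    by (intro Ck_on_add assms
        Ck_on_compose_bounded_linear[OF bounded_linear_Pair[OF bounded_linear_ident bounded_linear_zero]]
        Ck_on_compose_bounded_linear[OF bounded_linear_Pair[OF bounded_linear_zero bounded_linear_ident]])
  then show ?thesis by simp
qed

section \<open>Directions that vary with the point, and composition\<close>

lemma linear_eq_sum_Basis:
  fixes F :: "'a::euclidean_space \<Rightarrow> 'b::real_vector"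
  assumes "linear F"
  shows "F w = (\<Sum>b\<in>Basis. (w \<bullet> b) *\<^sub>R F b)"
proof -
  have "F w = F (\<Sum>b\<in>Basis. (w \<bullet> b) *\<^sub>R b)"
    by (simp add: euclidean_representation)
  also have "\<dots> = (\<Sum>b\<in>Basis. (w \<bullet> b) *\<^sub>R F b)"
    by (simp add: linear_sum[OF assms] linear_cmul[OF assms])
  finally show ?thesis .
qed

text \<open>The classes control derivatives in fixed directions only. In the chain rule the
  direction moves with the point; expanding it in a basis reduces that case to sums of
  products.\<close>

lemma Ck_on_apply_linear:
  fixes w :: "'a::real_normed_vector \<Rightarrow> 'b::euclidean_space"
  assumes "open X" "\<And>x. x \<in> X \<Longrightarrow> linear (F x)" "\<And>b. b \<in> Basis \<Longrightarrow> Ck_on k X (\<lambda>x. F x b)" "Ck_on k X w"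
  shows "Ck_on k X (\<lambda>x. F x (w x))"
proof -
  have "Ck_on k X (\<lambda>x. \<Sum>b\<in>Basis. (w x \<bullet> b) *\<^sub>R F x b)"
    by (intro Ck_on_sum Ck_on_scaleR Ck_on_inner assms Ck_on_const)
  then show ?thesis
    using assms(1,2) by (subst Ck_on_cong[OF assms(1)]) (auto intro: linear_eq_sum_Basis)
qed

lemma Ck_on_compose:
  fixes f :: "'a::real_normed_vector \<Rightarrow> 'b::euclidean_space"
  assumes "open X" "Ck_on k Y g" "Ck_on k X f" "\<And>x. x \<in> X \<Longrightarrow> f x \<in> Y"
  shows "Ck_on k X (\<lambda>x. g (f x))"
  using assms(2,3)
proof (induction k arbitrary: g)
  case 0
  then show ?case using assms(4) by (auto intro: continuous_on_compose2)
next
  case (Suc k)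
  show ?case
  proof (rule Ck_on_SucI[OF assms(1)])
    show "((\<lambda>x. g (f x)) has_derivative
        (\<lambda>v. fderiv g (f x) (fderiv f x v))) (at x)" if "x \<in> X" for x
      using diff_chain_at[OF Ck_on_has_derivative[OF Suc.prems(2) that]
          Ck_on_has_derivative[OF Suc.prems(1) assms(4)[OF that]]]
      by (simp add: o_def)
    show "Ck_on k X (\<lambda>x. fderiv g (f x) (fderiv f x v))" for v
    proof (rule Ck_on_apply_linear[OF assms(1)])
      show "linear (fderiv g (f x))" if "x \<in> X" for x
        using Suc.prems(1) assms(4)[OF that] by (auto intro: linear_frechet_derivative)
      show "Ck_on k X (\<lambda>x. fderiv g (f x) b)" for b
        by (rule Suc.IH) (use Suc.prems Ck_on_SucD in auto)
    qed (use Suc.prems in auto)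
  qed
qed

lemma Ck_on_frechet_derivative_apply:
  fixes g :: "'a::real_normed_vector \<Rightarrow> 'b::euclidean_space"
  assumes "open X" "Ck_on (Suc k) Y G" "Ck_on k X g" "\<And>x. x \<in> X \<Longrightarrow> g x \<in> Y" "Ck_on k X w"
  shows "Ck_on k X (\<lambda>x. fderiv G (g x) (w x))"
proof (rule Ck_on_apply_linear[OF assms(1) _ _ assms(5)])
  show "linear (fderiv G (g x))" if "x \<in> X" for x
    using assms that by (auto intro: linear_frechet_derivative)
  show "Ck_on k X (\<lambda>x. fderiv G (g x) b)" for b
    by (rule Ck_on_compose[OF assms(1) _ assms(3,4)]) (use assms in auto)
qed

section \<open>Reciprocals, determinants and linear systems\<close>

lemma Ck_on_inverse:
  fixes f :: "'a::real_normed_vector \<Rightarrow> real"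
  assumes "open X" "Ck_on k X f" "\<And>x. x \<in> X \<Longrightarrow> f x \<noteq> 0"
  shows "Ck_on k X (\<lambda>x. inverse (f x))"
  using assms(2)
proof (induction k)
  case 0
  then show ?case using assms(3) by (auto intro: continuous_on_inverse)
next
  case (Suc k)
  show ?case
  proof (rule Ck_on_SucI[OF assms(1)])
    show "((\<lambda>x. inverse (f x)) has_derivative
        (\<lambda>v. - (inverse (f x) * fderiv f x v * inverse (f x)))) (at x)" if "x \<in> X" for x
      by (rule Deriv.has_derivative_inverse[OF assms(3)[OF that] Ck_on_has_derivative[OF Suc.prems that]])
    \<comment> \<open>The derivative contains the reciprocal itself, but only at the order already
      granted by the induction hypothesis.\<close>
    show "Ck_on k X (\<lambda>x. - (inverse (f x) * fderiv f x v * inverse (f x)))" for v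
      using Suc.IH[OF Ck_on_SucD[OF Suc.prems]] Suc.prems
      by (intro Ck_on_minus Ck_on_mult assms(1)) auto
  qed
qed

lemma Ck_on_vec:
  fixes f :: "'a::real_normed_vector \<Rightarrow> 'i::finite \<Rightarrow> real"
  assumes "open X" "\<And>i. Ck_on k X (\<lambda>x. f x i)"
  shows "Ck_on k X (\<lambda>x. \<chi> i. f x i)"
proof -
  have "Ck_on k X (\<lambda>x. \<Sum>i\<in>UNIV. f x i *\<^sub>R axis i (1::real))"
    by (intro Ck_on_sum Ck_on_scaleR assms Ck_on_const)
  moreover have "(\<lambda>x. \<Sum>i\<in>UNIV. f x i *\<^sub>R axis i (1::real)) = (\<lambda>x. \<chi> i. f x i)"
    by (simp add: fun_eq_iff vec_eq_iff axis_def if_distrib cong: if_cong)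
  ultimately show ?thesis by (simp only:)
qed

lemma Ck_on_nth: "open X \<Longrightarrow> Ck_on k X f \<Longrightarrow> Ck_on k X (\<lambda>x. f x $ i)"
  by (rule Ck_on_compose_bounded_linear[OF bounded_linear_vec_nth])

lemma Ck_on_det:
  fixes M :: "'a::real_normed_vector \<Rightarrow> real^'n^'n"
  assumes "open X" "\<And>i j. Ck_on k X (\<lambda>x. M x $ i $ j)"
  shows "Ck_on k X (\<lambda>x. det (M x))"
  unfolding det_def by (intro Ck_on_sum Ck_on_mult Ck_on_prod assms Ck_on_const)

text \<open>Cramer's rule writes the solution as a quotient of determinants, which are polynomials
  in the entries of M and b.\<close>

lemma Ck_on_linear_solve:
  fixes M :: "'a::real_normed_vector \<Rightarrow> real^'n^'n"
  assumes "open X" "\<And>i j. Ck_on k X (\<lambda>x. M x $ i $ j)" "Ck_on k X b"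
    and "\<And>x. x \<in> X \<Longrightarrow> det (M x) \<noteq> 0" "\<And>x. x \<in> X \<Longrightarrow> M x *v w x = b x"
  shows "Ck_on k X w"
proof -
  have "Ck_on k X (\<lambda>x. \<chi> l. det (\<chi> i j. if j = l then b x $ i else M x $ i $ j) * inverse (det (M x)))"
  proof (intro Ck_on_vec Ck_on_mult Ck_on_inverse Ck_on_det assms)
    show "Ck_on k X (\<lambda>x. (\<chi> i j. if j = l then b x $ i else M x $ i $ j) $ i $ j)" for l i j
      using assms(2) Ck_on_nth[OF assms(1,3)] by (cases "j = l") auto
  qed
  moreover have "w x = (\<chi> l. det (\<chi> i j. if j = l then b x $ i else M x $ i $ j) * inverse (det (M x)))"
    if "x \<in> X" for x
    using cramer[OF assms(4)[OF that], of "w x" "b x"] assms(5)[OF that] by (simp add: divide_inverse)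
  ultimately show ?thesis
    by (subst Ck_on_cong[OF assms(1)])
qed

text \<open>In finite dimension, continuity in each basis direction is continuity in operator norm.
  This yields bounds on compact sets and the form of the derivative that the inverse function
  theorem expects.\<close>

lemma continuous_on_Blinfun_frechet_derivative:
  fixes f :: "'a::euclidean_space \<Rightarrow> 'b::real_normed_vector"
  assumes "Ck_on (Suc 0) X f"
  shows "continuous_on X (\<lambda>x. Blinfun (fderiv f x))"
    and "x \<in> X \<Longrightarrow> blinfun_apply (Blinfun (fderiv f x)) = fderiv f x"
proof -
  show eq: "blinfun_apply (Blinfun (fderiv f x)) = fderiv f x" if "x \<in> X" for x
    using Ck_on_has_derivative[OF assms that]
    by (intro bounded_linear_Blinfun_apply) (rule has_derivative_bounded_linear)
  show "continuous_on X (\<lambda>x. Blinfun (fderiv f x))"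
  proof (rule continuous_on_blinfun_componentwise)
    fix i :: 'a
    have "continuous_on X (\<lambda>x. fderiv f x i)"
      using assms by simp
    then show "continuous_on X (\<lambda>x. blinfun_apply (Blinfun (fderiv f x)) i)"
      by (rule continuous_on_cong[THEN iffD1, rotated -1]) (simp_all add: eq)
  qed
qed

section \<open>Ordinary differential equations with parameters\<close>

text \<open>Integrals from \<open>0\<close> to \<open>t\<close> are written as \<open>t\<close> times an integral over the unit interval: this covers
  both signs of \<open>t\<close> and makes continuity in \<open>t\<close> and in parameters immediate.\<close>

lemma scaled_integral_eq_diff:
  fixes K :: "real \<Rightarrow> 'y::banach"
  assumes K: "\<And>s. s \<in> {-T..T} \<Longrightarrow> (K has_vector_derivative k s) (at s within {-T..T})"
    and t: "\<bar>t\<bar> \<le> T"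
  shows "t *\<^sub>R integral {0..1} (\<lambda>\<theta>. k (\<theta> * t)) = K t - K 0"
proof -
  have img: "\<theta> * t \<in> {-T..T}" if "\<theta> \<in> {0..1}" for \<theta>
  proof -
    have "\<bar>\<theta> * t\<bar> \<le> 1 * \<bar>t\<bar>"
      unfolding abs_mult using that by (intro mult_right_mono) auto
    then show ?thesis using t unfolding atLeastAtMost_iff by linarith
  qed
  have "((\<lambda>\<theta>. t *\<^sub>R k (\<theta> * t)) has_integral (K (1 * t) - K (0 * t))) {0..1}"
  proof (rule fundamental_theorem_of_calculus)
    fix \<theta> :: real assume \<theta>: "\<theta> \<in> {0..1}"
    have 1: "((\<lambda>\<theta>. \<theta> * t) has_vector_derivative t) (at \<theta> within {0..1})"
      by (auto intro!: derivative_eq_intros simp: has_real_derivative_iff_has_vector_derivative[symmetric])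
    have 2: "(K has_vector_derivative k (\<theta> * t)) (at (\<theta> * t) within (\<lambda>\<theta>. \<theta> * t) ` {0..1})"
      by (rule has_vector_derivative_within_subset[OF K[OF img[OF \<theta>]]]) (use img in auto)
    show "((\<lambda>\<theta>. K (\<theta> * t)) has_vector_derivative t *\<^sub>R k (\<theta> * t)) (at \<theta> within {0..1})"
      using vector_diff_chain_within[OF 1 2] by (simp add: o_def)
  qed simp
  then show ?thesis
    by (simp add: integral_unique flip: integral_cmul)
qed

lemma has_vector_derivative_scaled_integral:
  fixes k :: "real \<Rightarrow> 'y::banach"
  assumes k: "continuous_on {-T..T} k" and t: "\<bar>t\<bar> < T"
  shows "((\<lambda>s. s *\<^sub>R integral {0..1} (\<lambda>\<theta>. k (\<theta> * s))) has_vector_derivative k t) (at t)"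
proof -
  obtain K where K: "\<And>s. s \<in> {-T..T} \<Longrightarrow> (K has_vector_derivative k s) (at s within {-T..T})"
    using antiderivative_continuous[OF k] by blast
  have "(K has_vector_derivative k t) (at t within {-T<..<T})"
    by (rule has_vector_derivative_within_subset[OF K]) (use t in auto)
  moreover have "at t within {-T<..<T} = at t"
    by (rule at_within_open) (use t in auto)
  ultimately have "(K has_vector_derivative k t) (at t)"
    by (simp only:)
  then have "((\<lambda>s. K s - K 0) has_vector_derivative k t) (at t)"
    by (auto intro!: derivative_eq_intros)
  then show ?thesis
  proof (rule has_vector_derivative_transform_within_open[where S = "{-T<..<T}"])
    show "K s - K 0 = s *\<^sub>R integral {0..1} (\<lambda>\<theta>. k (\<theta> * s))" if "s \<in> {-T<..<T}" for s
      using scaled_integral_eq_diff[OF K, of s] that by auto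
  qed (use t in auto)
qed

text \<open>Picard iteration on bounded continuous functions of (t, x) jointly, so that the fixed
  point is continuous in the parameter without a separate argument.\<close>

lemma ode_parametrized_solution:
  fixes G :: "real \<times> 'p::euclidean_space \<times> 'y::banach \<Rightarrow> 'y"
  assumes G: "continuous_on UNIV G"
    and M: "\<And>s x. norm (G (s, x, 0)) \<le> M"
    and L: "\<And>s x y y'. norm (G (s, x, y) - G (s, x, y')) \<le> L * norm (y - y')"
    and T: "0 < T" "0 \<le> L" "L * T \<le> 1/2"
  obtains u where "continuous_on UNIV u" "\<And>x. u (0, x) = 0"
    "\<And>t x. \<bar>t\<bar> < T \<Longrightarrow> ((\<lambda>s. u (s, x)) has_vector_derivative G (t, x, u (t, x))) (at t)"
proof -
  \<comment> \<open>Clamping time to [-T, T] lets the integral operator act on bounded continuous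
    functions on the whole space, which form a complete space.\<close>
  define c where "c t = max (- T) (min T t)" for t
  have c: "continuous_on UNIV c" unfolding c_def by (intro continuous_intros)
  have cT: "\<bar>c t\<bar> \<le> T" for t using T by (auto simp: c_def)
  define I where "I u = (\<lambda>(t, x). integral (cbox 0 1) (\<lambda>\<theta>. G (\<theta> * c t, x, u (\<theta> * c t, x))))"
    for u :: "real \<times> 'p \<Rightarrow> 'y"
  define F where "F u = (\<lambda>(t, x). c t *\<^sub>R I u (t, x))" for u
  have contGu: "continuous_on UNIV (\<lambda>(z, \<theta>). G (\<theta> * c (fst z), snd z, u (\<theta> * c (fst z), snd z)))"
    if u: "continuous_on UNIV u" for u
    unfolding case_prod_beta
    by (intro continuous_on_compose2[OF G] continuous_intros continuous_on_compose2[OF c]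
        continuous_on_compose2[OF u]) auto
  have contG1: "continuous_on {0..1} (\<lambda>\<theta>. G (\<theta> * c t, x, u (\<theta> * c t, x)))"
    if u: "continuous_on UNIV u" for u t x
    by (intro continuous_on_compose2[OF G] continuous_intros continuous_on_compose2[OF u]) auto
  have contI: "continuous_on UNIV (I u)" if u: "continuous_on UNIV u" for u
    unfolding I_def case_prod_beta
    by (rule integral_continuous_on_param, rule continuous_on_subset[OF contGu[OF u]]) auto
  have contF: "continuous_on UNIV (F u)" if u: "continuous_on UNIV u" for u
    unfolding F_def case_prod_beta
    by (intro continuous_intros continuous_on_compose2[OF c] continuous_on_compose2[OF contI[OF u]]) auto
  have Fb: "F u \<in> bcontfun" if u: "u \<in> bcontfun" for u
  proof -
    have uc: "continuous_on UNIV u" and "bounded (range u)" using u by (auto simp: bcontfun_def)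
    then obtain b where b: "\<And>z. norm (u z) \<le> b" by (auto simp: bounded_iff)
    have "norm (I u (t, x)) \<le> (M + L * b) * (1 - 0)" for t x
      unfolding I_def prod.case box_real
    proof (rule integral_bound[OF _ contG1[OF uc]])
      fix \<theta>
      have "norm (G (\<theta> * c t, x, u (\<theta> * c t, x))) \<le> norm (G (\<theta> * c t, x, 0)) + L * norm (u (\<theta> * c t, x) - 0)"
        using L[of "\<theta> * c t" x "u (\<theta> * c t, x)" 0] by (smt (verit) norm_triangle_sub)
      also have "\<dots> \<le> M + L * b"
        using M b T(2) by (intro add_mono mult_left_mono) auto
      finally show "norm (G (\<theta> * c t, x, u (\<theta> * c t, x))) \<le> M + L * b" .
    qed simp
    then have "norm (I u z) \<le> M + L * b" for z
      by (cases z) simp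
    then have "norm (F u z) \<le> T * (M + L * b)" for z
      unfolding F_def case_prod_beta norm_scaleR using cT T(1)
      by (intro mult_mono) auto
    then show ?thesis
      by (rule bcontfun_normI[OF contF[OF uc]])
  qed
  \<comment> \<open>The integral is Lipschitz in u with constant L and the factor \<open>c t\<close>
    is at most T in absolute value; L * T \<le> 1/2 gives the contraction constant.\<close>
  have Fdist: "dist (F u z) (F v z) \<le> (1/2) * d"
    if u: "continuous_on UNIV u" and v: "continuous_on UNIV v" and d: "\<And>z. dist (u z) (v z) \<le> d" for u v z d
  proof -
    obtain t x where z: "z = (t, x)" by fastforce
    have d0: "0 \<le> d" using d[of z] by (meson dist_self dual_order.trans zero_le_dist)
    have *: "I u (t, x) - I v (t, x) = integral {0..1} (\<lambda>\<theta>. G (\<theta> * c t, x, u (\<theta> * c t, x)) - G (\<theta> * c t, x, v (\<theta> * c t, x)))"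
      unfolding I_def prod.case box_real
      by (subst integral_diff) (auto intro: integrable_continuous_real contG1[OF u] contG1[OF v])
    have "norm (I u (t, x) - I v (t, x)) \<le> (L * d) * (1 - 0)"
      unfolding *
    proof (rule integral_bound)
      show "norm (G (\<theta> * c t, x, u (\<theta> * c t, x)) - G (\<theta> * c t, x, v (\<theta> * c t, x))) \<le> L * d" for \<theta>
        using L[of "\<theta> * c t" x] d[of "(\<theta> * c t, x)"] T(2) unfolding dist_norm
        by (meson mult_left_mono order_trans)
    qed (auto intro: continuous_on_diff contG1[OF u] contG1[OF v])
    then have "norm (F u z - F v z) \<le> T * (L * d)"
      unfolding F_def z prod.case scaleR_diff_right[symmetric] norm_scaleR
      using cT T by (intro mult_mono) auto
    also have "\<dots> \<le> (1/2) * d"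
      using mult_right_mono[OF T(3) d0] by (simp add: ac_simps)
    finally show ?thesis by (simp add: dist_norm)
  qed
  define \<Phi> where "\<Phi> u = Bcontfun (F (apply_bcontfun u))" for u :: "(real \<times> 'p) \<Rightarrow>\<^sub>C 'y"
  have \<Phi>: "apply_bcontfun (\<Phi> u) = F (apply_bcontfun u)" for u
    unfolding \<Phi>_def by (rule Bcontfun_inverse) (rule Fb[OF apply_bcontfun])
  have "\<exists>!u. \<Phi> u = u"
  proof (rule banach_fix_type[of "1/2"], safe)
    fix u v
    show "dist (\<Phi> u) (\<Phi> v) \<le> 1 / 2 * dist u v"
    proof (rule dist_bound)
      fix z
      show "dist (apply_bcontfun (\<Phi> u) z) (apply_bcontfun (\<Phi> v) z) \<le> 1 / 2 * dist u v"
        unfolding \<Phi> by (rule Fdist) (auto intro: dist_bounded)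
    qed
  qed auto
  then obtain v where v: "\<Phi> v = v" by blast
  define u where "u = apply_bcontfun v"
  have Fu: "F u = u" using \<Phi>[of v] unfolding v u_def by simp
  have uc: "continuous_on UNIV u" by (simp add: u_def)
  show thesis
  proof (rule that[of u])
    show "continuous_on UNIV u" by fact
    show "u (0, x) = 0" for x
      using fun_cong[OF Fu, of "(0, x)"] T by (simp add: F_def c_def)
    fix t :: real and x :: 'p assume t: "\<bar>t\<bar> < T"
    have *: "((\<lambda>s. s *\<^sub>R integral {0..1} (\<lambda>\<theta>. (\<lambda>r. G (r, x, u (r, x))) (\<theta> * s))) has_vector_derivative
        (\<lambda>r. G (r, x, u (r, x))) t) (at t)"
      by (rule has_vector_derivative_scaled_integral[OF _ t])
        (intro continuous_on_compose2[OF G] continuous_on_compose2[OF uc] continuous_intros; simp)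
    show "((\<lambda>s. u (s, x)) has_vector_derivative G (t, x, u (t, x))) (at t)"
    proof (rule has_vector_derivative_transform_within_open[where S = "{-T<..<T}"])
      show "((\<lambda>s. s *\<^sub>R integral {0..1} (\<lambda>\<theta>. G (\<theta> * s, x, u (\<theta> * s, x)))) has_vector_derivative
        G (t, x, u (t, x))) (at t)" using * by simp
      show "s *\<^sub>R integral {0..1} (\<lambda>\<theta>. G (\<theta> * s, x, u (\<theta> * s, x))) = u (s, x)" if "s \<in> {-T<..<T}" for s
      proof -
        have "c s = s" using that by (auto simp: c_def)
        then show ?thesis
          using fun_cong[OF Fu, of "(s, x)"] by (simp add: F_def I_def)
      qed
    qed (use t in auto)
  qed
qed

section \<open>Growth bounds and uniqueness of solutions\<close>

lemma norm_diff_le_of_vector_derivative: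
  fixes f :: "real \<Rightarrow> 'y::real_normed_vector"
  assumes "\<And>s. s \<in> closed_segment a b \<Longrightarrow> (f has_vector_derivative f' s) (at s)"
    and "\<And>s. s \<in> closed_segment a b \<Longrightarrow> norm (f' s) \<le> B"
  shows "norm (f b - f a) \<le> B * \<bar>b - a\<bar>"
proof -
  have "norm (f b - f a) \<le> B * norm (b - a)"
  proof (rule differentiable_bound[of "closed_segment a b" f "\<lambda>s h. h *\<^sub>R f' s"])
    show "(f has_derivative (\<lambda>h. h *\<^sub>R f' s)) (at s within closed_segment a b)" if "s \<in> closed_segment a b" for s
      using assms(1)[OF that] by (simp add: has_vector_derivative_def has_derivative_at_withinI)
    show "onorm (\<lambda>h. h *\<^sub>R f' s) \<le> B" if "s \<in> closed_segment a b" for s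
      using assms(2)[OF that]
      by (intro onorm_le) (metis abs_ge_zero mult.commute mult_right_mono norm_scaleR real_norm_def)
  qed auto
  then show ?thesis by simp
qed

text \<open>Takes the place of Gronwall's inequality: at a point m where the norm is maximal on a
  compact interval around a, the mean value bound gives norm (\<delta> m) \<le> norm (\<delta> m) /
  2.\<close>

lemma ode_zero_solution_unique:
  fixes \<delta> :: "real \<Rightarrow> 'y::real_normed_vector"
  assumes \<delta>: "\<And>t. \<bar>t - a\<bar> < T \<Longrightarrow> (\<delta> has_vector_derivative \<delta>' t) (at t)"
    and L: "\<And>t. \<bar>t - a\<bar> < T \<Longrightarrow> norm (\<delta>' t) \<le> L * norm (\<delta> t)"
    and "\<delta> a = 0" "0 \<le> L" "L * T \<le> 1/2" "\<bar>t - a\<bar> < T"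
  shows "\<delta> t = 0"
proof -
  define J where "J = {a - \<bar>t - a\<bar>..a + \<bar>t - a\<bar>}"
  have J: "\<bar>s - a\<bar> < T" if "s \<in> J" for s
    using that assms(6) by (auto simp: J_def)
  have "continuous_on J (\<lambda>s. norm (\<delta> s))"
    by (intro continuous_on_norm continuous_at_imp_continuous_on ballI
        has_vector_derivative_continuous[OF \<delta>] J)
  moreover have "compact J" "J \<noteq> {}" by (auto simp: J_def)
  ultimately obtain m where m: "m \<in> J" "\<And>s. s \<in> J \<Longrightarrow> norm (\<delta> s) \<le> norm (\<delta> m)"
    by (meson continuous_attains_sup)
  have sub: "closed_segment a m \<subseteq> J"
    by (rule closed_segment_subset) (use m in \<open>auto simp: J_def\<close>)
  have "norm (\<delta> m - \<delta> a) \<le> (L * norm (\<delta> m)) * \<bar>m - a\<bar>"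
  proof (rule norm_diff_le_of_vector_derivative[of a m \<delta> \<delta>'])
    fix s assume "s \<in> closed_segment a m"
    then have s: "s \<in> J" using sub by auto
    show "(\<delta> has_vector_derivative \<delta>' s) (at s)" by (rule \<delta>[OF J[OF s]])
    show "norm (\<delta>' s) \<le> L * norm (\<delta> m)"
      using L[OF J[OF s]] mult_left_mono[OF m(2)[OF s] assms(4)] by simp
  qed
  also have "\<dots> \<le> (L * norm (\<delta> m)) * T"
    using J[OF m(1)] assms(4) by (intro mult_left_mono) auto
  also have "\<dots> \<le> 1/2 * norm (\<delta> m)"
    using mult_right_mono[OF assms(5), of "norm (\<delta> m)"] by (simp add: ac_simps)
  finally have "norm (\<delta> m) = 0" using assms(3) by simp
  moreover have "t \<in> J"
    using abs_ge_self[of "t - a"] abs_ge_minus_self[of "t - a"] unfolding J_def atLeastAtMost_iff by linarith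
  ultimately show ?thesis using m(2)[of t] by simp
qed

text \<open>M (z, z') is the average of the derivative of G over the segment from z to z'. The last
  clause carries a bound on the derivative in one direction over to M; for fibre directions it
  provides the Lipschitz constant of the linear equation for differences of solutions.\<close>

lemma mean_value_blinfun:
  fixes G :: "'a::euclidean_space \<Rightarrow> 'b::banach"
  assumes \<Omega>: "convex \<Omega>" and G: "Ck_on (Suc 0) \<Omega> G"
  obtains M :: "'a \<times> 'a \<Rightarrow> 'a \<Rightarrow>\<^sub>L 'b" where "continuous_on (\<Omega> \<times> \<Omega>) M"
    "\<And>z z'. z \<in> \<Omega> \<Longrightarrow> z' \<in> \<Omega> \<Longrightarrow> M (z, z') (z' - z) = G z' - G z"
    "\<And>z. z \<in> \<Omega> \<Longrightarrow> blinfun_apply (M (z, z)) = fderiv G z"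
    "\<And>z z' w b. z \<in> \<Omega> \<Longrightarrow> z' \<in> \<Omega> \<Longrightarrow> (\<And>\<zeta>. \<zeta> \<in> \<Omega> \<Longrightarrow> norm (fderiv G \<zeta> w) \<le> b) \<Longrightarrow>
      norm (M (z, z') w) \<le> b"
proof -
  define D where "D z = Blinfun (fderiv G z)" for z
  have D: "continuous_on \<Omega> D"
    unfolding D_def by (rule continuous_on_Blinfun_frechet_derivative[OF G])
  have DG: "blinfun_apply (D z) = fderiv G z" if "z \<in> \<Omega>" for z
    unfolding D_def by (rule continuous_on_Blinfun_frechet_derivative(2)[OF G that])
  define M where "M = (\<lambda>z. integral (cbox 0 1) (\<lambda>\<theta>::real. D (fst z + \<theta> *\<^sub>R (snd z - fst z))))"
  have seg: "z + \<theta> *\<^sub>R (z' - z) \<in> \<Omega>" if "z \<in> \<Omega>" "z' \<in> \<Omega>" "\<theta> \<in> {0..1}" for z z' and \<theta> :: real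
  proof -
    have "(1 - \<theta>) *\<^sub>R z + \<theta> *\<^sub>R z' \<in> \<Omega>"
      using that by (intro convexD[OF \<Omega>]) auto
    then show ?thesis by (simp add: algebra_simps)
  qed
  have contD: "continuous_on {0..1} (\<lambda>\<theta>::real. D (z + \<theta> *\<^sub>R (z' - z)))" if "z \<in> \<Omega>" "z' \<in> \<Omega>" for z z'
    by (intro continuous_on_compose2[OF D] continuous_intros) (use seg that in auto)
  have Mapp: "M (z, z') w = integral {0..1} (\<lambda>\<theta>::real. D (z + \<theta> *\<^sub>R (z' - z)) w)" if "z \<in> \<Omega>" "z' \<in> \<Omega>" for z z' w
    using integral_linear[OF integrable_continuous_real[OF contD[OF that]]
        blinfun.bounded_linear_left, of w]
    by (simp add: M_def o_def)
  show thesis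
  proof (rule that[of M])
    show "continuous_on (\<Omega> \<times> \<Omega>) M"
      unfolding M_def
    proof (rule integral_continuous_on_param)
      show "continuous_on ((\<Omega> \<times> \<Omega>) \<times> cbox 0 1) (\<lambda>(z, \<theta>::real). D (fst z + \<theta> *\<^sub>R (snd z - fst z)))"
        unfolding case_prod_beta
        by (intro continuous_on_compose2[OF D] continuous_intros) (use seg in auto)
    qed
    fix z assume z: "z \<in> \<Omega>"
    show "blinfun_apply (M (z, z)) = fderiv G z"
      by (rule ext) (simp add: Mapp z DG)
    fix z' assume z': "z' \<in> \<Omega>"
    show "M (z, z') (z' - z) = G z' - G z"
    proof -
      have "((\<lambda>\<theta>::real. D (z + \<theta> *\<^sub>R (z' - z)) (z' - z)) has_integral
          (G (z + 1 *\<^sub>R (z' - z)) - G (z + 0 *\<^sub>R (z' - z)))) {0..1}"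
      proof (rule fundamental_theorem_of_calculus)
        fix \<theta> :: real assume \<theta>: "\<theta> \<in> {0..1}"
        have "((\<lambda>\<theta>. z + \<theta> *\<^sub>R (z' - z)) has_derivative (\<lambda>h. h *\<^sub>R (z' - z))) (at \<theta> within {0..1})"
          by (auto intro!: derivative_eq_intros)
        from has_derivative_in_compose[OF this has_derivative_at_withinI[OF Ck_on_has_derivative[OF G seg[OF z z' \<theta>]]]]
        have *: "((\<lambda>\<theta>. G (z + \<theta> *\<^sub>R (z' - z))) has_derivative
            (\<lambda>h. D (z + \<theta> *\<^sub>R (z' - z)) (h *\<^sub>R (z' - z)))) (at \<theta> within {0..1})"
          by (simp add: DG[OF seg[OF z z' \<theta>]])
        show "((\<lambda>\<theta>. G (z + \<theta> *\<^sub>R (z' - z))) has_vector_derivative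
            D (z + \<theta> *\<^sub>R (z' - z)) (z' - z)) (at \<theta> within {0..1})"
          using * by (simp add: has_vector_derivative_def blinfun.scaleR_right)
      qed simp
      then show ?thesis using Mapp[OF z z'] by (simp add: integral_unique)
    qed
    fix w b assume b: "\<And>\<zeta>. \<zeta> \<in> \<Omega> \<Longrightarrow> norm (fderiv G \<zeta> w) \<le> b"
    have "norm (M (z, z') w) \<le> b * (1 - 0)"
      unfolding Mapp[OF z z']
    proof (rule integral_bound)
      show "continuous_on {0..1} (\<lambda>\<theta>. blinfun_apply (D (z + \<theta> *\<^sub>R (z' - z))) w)"
        by (intro blinfun.continuous_on contD[OF z z'] continuous_intros)
      show "norm (blinfun_apply (D (z + \<theta> *\<^sub>R (z' - z))) w) \<le> b" if "\<theta> \<in> {0..1}" for \<theta>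
        using b[OF seg[OF z z' that]] by (simp add: DG[OF seg[OF z z' that]])
    qed simp
    then show "norm (M (z, z') w) \<le> b" by simp
  qed
qed

text \<open>By the mean value theorem the difference of two solutions is \<open>u (t, x') - u (t, x) = w (t, x, x') (x' - x)\<close>,
  where \<open>w\<close> solves a linear equation with parameters \<open>x, x'\<close> and is therefore continuous. The
  derivative in \<open>x\<close> is then \<open>w (t, x, x)\<close>, without any error estimates.\<close>

lemma ode_parameter_derivative_local:
  fixes G :: "real \<times> 'p::euclidean_space \<times> 'y::euclidean_space \<Rightarrow> 'y" and u :: "real \<times> 'p \<Rightarrow> 'y"
  assumes B: "open B" "convex B" and C: "convex C"
    and G: "Ck_on (Suc 0) ({-T<..<T} \<times> B \<times> C) G"
    and L: "\<And>z w. z \<in> {-T<..<T} \<times> B \<times> C \<Longrightarrow> norm (fderiv G z (0, 0, w)) \<le> L * norm w"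
    and LT: "0 \<le> L" "L * T \<le> 1/2"
    and u: "continuous_on ({-T<..<T} \<times> B) u" "\<And>t x. \<bar>t\<bar> < T \<Longrightarrow> x \<in> B \<Longrightarrow> u (t, x) \<in> C"
      "\<And>x. x \<in> B \<Longrightarrow> u (0, x) = 0"
      "\<And>t x. \<bar>t\<bar> < T \<Longrightarrow> x \<in> B \<Longrightarrow> ((\<lambda>s. u (s, x)) has_vector_derivative G (t, x, u (t, x))) (at t)"
    and t0: "\<bar>t0\<bar> < T" "x0 \<in> B"
  obtains T' r W where "\<bar>t0\<bar> < T'" "T' \<le> T" "0 < r" "ball x0 r \<subseteq> B"
    "continuous_on UNIV (W :: real \<times> 'p \<Rightarrow> 'p \<Rightarrow>\<^sub>L 'y)" "\<And>x. W (0, x) = 0"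
    "\<And>t x. \<bar>t\<bar> < T' \<Longrightarrow> x \<in> ball x0 r \<Longrightarrow>
      (u has_derivative (\<lambda>(\<tau>, v). \<tau> *\<^sub>R G (t, x, u (t, x)) + W (t, x) v)) (at (t, x))"
    "\<And>t x v. \<bar>t\<bar> < T' \<Longrightarrow> x \<in> ball x0 r \<Longrightarrow> ((\<lambda>s. W (s, x) v) has_vector_derivative
        fderiv G (t, x, u (t, x)) (0, v, W (t, x) v)) (at t)"
proof -
  define \<Omega> where "\<Omega> = {-T<..<T} \<times> B \<times> C"
  have "convex \<Omega>" unfolding \<Omega>_def by (intro convex_Times B C) auto
  obtain M where M: "continuous_on (\<Omega> \<times> \<Omega>) M"
    "\<And>z z'. z \<in> \<Omega> \<Longrightarrow> z' \<in> \<Omega> \<Longrightarrow> blinfun_apply (M (z, z')) (z' - z) = G z' - G z"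
    "\<And>z. z \<in> \<Omega> \<Longrightarrow> blinfun_apply (M (z, z)) = fderiv G z"
    "\<And>z z' w b. z \<in> \<Omega> \<Longrightarrow> z' \<in> \<Omega> \<Longrightarrow> (\<And>\<zeta>. \<zeta> \<in> \<Omega> \<Longrightarrow> norm (fderiv G \<zeta> w) \<le> b) \<Longrightarrow>
      norm (blinfun_apply (M (z, z')) w) \<le> b"
    using mean_value_blinfun[OF \<open>convex \<Omega>\<close> G[folded \<Omega>_def]] by metis
  \<comment> \<open>The closed interval [-T', T'] has t0 in its interior and lies inside the open
    interval of radius T, so that compactness gives bounds.\<close>
  define T' where "T' = (\<bar>t0\<bar> + T) / 2"
  have T': "\<bar>t0\<bar> < T'" "T' < T" "0 < T'" using t0 by (auto simp: T'_def)
  obtain r where r: "0 < r" "cball x0 r \<subseteq> B"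
    using B(1) t0(2) open_contains_cball by metis
  \<comment> \<open>Clamping time and projecting the parameters to a compact ball extend the
    coefficient to a bounded continuous map on the whole space, as
    \<open>ode_parametrized_solution\<close> demands.\<close>
  define c where "c t = max (- T') (min T' t)" for t
  have c: "continuous_on UNIV c" unfolding c_def by (intro continuous_intros)
  have cT: "c t \<in> {-T'..T'}" for t using T' by (auto simp: c_def)
  have c_id: "c t = t" if "\<bar>t\<bar> < T'" for t using that by (auto simp: c_def)
  define K where "K = cball x0 r"
  define k where "k = closest_point K"
  have K: "compact K" "convex K" "closed K" "K \<noteq> {}" "K \<subseteq> B" using r by (auto simp: K_def)
  have k: "continuous_on UNIV k"
    unfolding k_def by (rule continuous_on_closest_point[OF K(2,3,4)])
  have kK: "k x \<in> K" for x unfolding k_def by (rule closest_point_in_set[OF K(3,4)])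
  have k_id: "k x = x" if "x \<in> K" for x unfolding k_def by (rule closest_point_self[OF that])
  define Z where "Z = (\<lambda>(t, x). (t, x, u (t, x)))"
  have Z: "Z (t, x) \<in> \<Omega>" if "\<bar>t\<bar> < T" "x \<in> B" for t x
    using u(2)[OF that] that by (auto simp: Z_def \<Omega>_def)
  have Zc: "continuous_on ({-T'..T'} \<times> K) Z"
    unfolding Z_def case_prod_beta using T' K(5)
    by (intro continuous_intros continuous_on_compose2[OF u(1)]) auto
  have ZK: "Z (t, x) \<in> \<Omega>" if "t \<in> {-T'..T'}" "x \<in> K" for t x
    using that T' K by (intro Z) auto
  define N where "N = (\<lambda>(t, x, x'). M (Z (t, x), Z (t, x')))"
  have Nc: "continuous_on ({-T'..T'} \<times> K \<times> K) N"
    unfolding N_def case_prod_beta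
    by (intro continuous_on_compose2[OF M(1)] continuous_intros continuous_on_compose2[OF Zc])
      (use ZK in auto)
  define \<iota>p :: "'p \<Rightarrow>\<^sub>L (real \<times> 'p \<times> 'y)" where "\<iota>p = Blinfun (\<lambda>v. (0, v, 0))"
  define \<iota>y :: "'y \<Rightarrow>\<^sub>L (real \<times> 'p \<times> 'y)" where "\<iota>y = Blinfun (\<lambda>w. (0, 0, w))"
  have \<iota>p: "\<iota>p v = (0, v, 0)" for v
    unfolding \<iota>p_def by (rule bounded_linear_Blinfun_apply[THEN fun_cong]) (intro bounded_linear_intros)
  have \<iota>y: "\<iota>y w = (0, 0, w)" for w
    unfolding \<iota>y_def by (rule bounded_linear_Blinfun_apply[THEN fun_cong]) (intro bounded_linear_intros)
  define A where "A = (\<lambda>(t, x, x'). N (c t, k x, k x'))"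
  have A: "continuous_on UNIV A"
    unfolding A_def case_prod_beta
    by (intro continuous_on_compose2[OF Nc] continuous_intros continuous_on_compose2[OF c]
        continuous_on_compose2[OF k]) (use cT kK in auto)
  have "bounded (N ` ({-T'..T'} \<times> K \<times> K))"
    by (intro compact_imp_bounded compact_continuous_image Nc compact_Times K) auto
  then obtain b where b: "\<And>z. z \<in> {-T'..T'} \<times> K \<times> K \<Longrightarrow> norm (N z) \<le> b"
    by (auto simp: bounded_iff)
  have Ab: "norm (A z) \<le> b" for z
    unfolding A_def case_prod_beta by (rule b) (use cT kK in auto)
  have AL: "norm (A z o\<^sub>L \<iota>y) \<le> L" for z
  proof (rule norm_blinfun_bound[OF LT(1)])
    fix w
    show "norm (blinfun_apply (A z o\<^sub>L \<iota>y) w) \<le> L * norm w"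
      unfolding blinfun_apply_blinfun_compose \<iota>y A_def N_def case_prod_beta
      by (rule M(4)) (use ZK cT kK L in \<open>auto simp: \<Omega>_def\<close>)
  qed
  \<comment> \<open>The linear equation for an operator-valued unknown W: the coefficient is split
    into its fibre part, bounded by L through \<open>AL\<close>, and its parameter part.\<close>
  define F where "F = (\<lambda>(t, xx, W :: 'p \<Rightarrow>\<^sub>L 'y). ((A (t, xx) o\<^sub>L \<iota>y) o\<^sub>L W) + (A (t, xx) o\<^sub>L \<iota>p))"
  have F: "continuous_on UNIV F"
    unfolding F_def case_prod_beta
    by (intro continuous_intros bounded_bilinear.continuous_on[OF bounded_bilinear_blinfun_compose]
        continuous_on_compose2[OF A]) auto
  have F0: "norm (F (s, x, 0)) \<le> b * norm \<iota>p" for s x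
  proof -
    have "norm (F (s, x, 0)) \<le> norm (A (s, x)) * norm \<iota>p"
      using norm_blinfun_compose[of "A (s, x)" \<iota>p]
      by (simp add: F_def bounded_bilinear.zero_right[OF bounded_bilinear_blinfun_compose])
    also have "\<dots> \<le> b * norm \<iota>p" by (intro mult_right_mono Ab) auto
    finally show ?thesis .
  qed
  have FL: "norm (F (s, x, y) - F (s, x, y')) \<le> L * norm (y - y')" for s x y y'
  proof -
    have "F (s, x, y) - F (s, x, y') = (A (s, x) o\<^sub>L \<iota>y) o\<^sub>L (y - y')"
      by (simp add: F_def bounded_bilinear.diff_right[OF bounded_bilinear_blinfun_compose])
    then have "norm (F (s, x, y) - F (s, x, y')) \<le> norm (A (s, x) o\<^sub>L \<iota>y) * norm (y - y')"
      using norm_blinfun_compose by metis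
    also have "\<dots> \<le> L * norm (y - y')" by (intro mult_right_mono AL) auto
    finally show ?thesis .
  qed
  have "L * T' \<le> 1/2" using mult_left_mono[OF less_imp_le[OF T'(2)] LT(1)] LT(2) by simp
  from ode_parametrized_solution[OF F F0 FL T'(3) LT(1) this]
  obtain w where w: "continuous_on UNIV w" "\<And>x. w (0, x) = 0"
    "\<And>t x. \<bar>t\<bar> < T' \<Longrightarrow> ((\<lambda>s. w (s, x)) has_vector_derivative F (t, x, w (t, x))) (at t)"
    by metis
  have Fapp: "F (t, (x, x'), V) v = A (t, x, x') (0, v, V v)" for t x x' V v
    by (simp add: F_def \<iota>p \<iota>y blinfun.add_left blinfun.add_right[symmetric])
  have wapp: "((\<lambda>s. w (s, x, x') v) has_vector_derivative A (t, x, x') (0, v, w (t, x, x') v)) (at t)"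
    if "\<bar>t\<bar> < T'" for t x x' v
    using bounded_linear.has_vector_derivative[OF blinfun.bounded_linear_left[of v] w(3)[OF that, of "(x, x')"]]
    by (simp add: Fapp)
  \<comment> \<open>Both sides satisfy the same inhomogeneous linear equation in t and vanish at t =
    0, so uniqueness applies to their difference.\<close>
  have diff: "u (t, x') - u (t, x) = w (t, x, x') (x' - x)" if t: "\<bar>t\<bar> < T'" and x: "x \<in> K" "x' \<in> K" for t x x'
  proof -
    have u0: "u (0, x') = 0" "u (0, x) = 0" using u(3) x K(5) by auto
    have "(\<lambda>t. u (t, x') - u (t, x) - w (t, x, x') (x' - x)) t = 0"
    proof (rule ode_zero_solution_unique[of 0 T' _
          "\<lambda>t. (G (t, x', u (t, x')) - G (t, x, u (t, x))) - A (t, x, x') (0, x' - x, w (t, x, x') (x' - x))" L])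
      fix s assume "\<bar>s - 0\<bar> < T'"
      then have s: "\<bar>s\<bar> < T'" "\<bar>s\<bar> < T" using T' by auto
      have xB: "x \<in> B" "x' \<in> B" using x K(5) by auto
      show "((\<lambda>t. u (t, x') - u (t, x) - w (t, x, x') (x' - x)) has_vector_derivative
          (G (s, x', u (s, x')) - G (s, x, u (s, x))) - A (s, x, x') (0, x' - x, w (s, x, x') (x' - x))) (at s)"
        by (intro has_vector_derivative_diff u(4) wapp s xB)
      have As: "A (s, x, x') = M (Z (s, x), Z (s, x'))"
        using c_id[OF s(1)] k_id x by (simp add: A_def N_def)
      have "G (s, x', u (s, x')) - G (s, x, u (s, x)) = A (s, x, x') (Z (s, x') - Z (s, x))"
        unfolding As by (subst M(2)) (use Z s xB in \<open>auto simp: Z_def\<close>)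
      then have eq: "(G (s, x', u (s, x')) - G (s, x, u (s, x))) - A (s, x, x') (0, x' - x, w (s, x, x') (x' - x)) =
          (A (s, x, x') o\<^sub>L \<iota>y) (u (s, x') - u (s, x) - w (s, x, x') (x' - x))"
        by (simp add: \<iota>y Z_def blinfun.diff_right[symmetric])
      show "norm ((G (s, x', u (s, x')) - G (s, x, u (s, x))) - A (s, x, x') (0, x' - x, w (s, x, x') (x' - x)))
          \<le> L * norm (u (s, x') - u (s, x) - w (s, x, x') (x' - x))"
        unfolding eq by (rule order_trans[OF norm_blinfun mult_right_mono[OF AL norm_ge_zero]])
    qed (use t T' LT \<open>L * T' \<le> 1/2\<close> u0 w(2) in auto)
    then show ?thesis by simp
  qed
  define W where "W = (\<lambda>(t, x). w (t, x, x))"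
  have W: "continuous_on UNIV W"
    unfolding W_def case_prod_beta
    by (intro continuous_on_compose2[OF w(1)] continuous_intros) auto
  \<comment> \<open>By \<open>diff\<close> the error of the difference quotient is at most the norm
    of w (t, x, y) - w (t, x, x), which tends to 0 because w is continuous.\<close>
  have uder: "((\<lambda>y. u (t, y)) has_derivative W (t, x)) (at x within ball x0 r)"
    if t: "\<bar>t\<bar> < T'" and x: "x \<in> ball x0 r" for t x
  proof (rule has_derivativeI_sandwich[of 1])
    show "bounded_linear (blinfun_apply (W (t, x)))" by (rule blinfun.bounded_linear_right)
    show "norm (u (t, y) - u (t, x) - blinfun_apply (W (t, x)) (y - x)) / norm (y - x) \<le>
        norm (w (t, x, y) - w (t, x, x))" if "y \<in> ball x0 r" "y \<noteq> x" for y
    proof -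
      have "u (t, y) - u (t, x) - blinfun_apply (W (t, x)) (y - x) = blinfun_apply (w (t, x, y) - w (t, x, x)) (y - x)"
        using diff[OF t, of x y] x that by (simp add: W_def blinfun.diff_left K_def)
      then show ?thesis using norm_blinfun[of "w (t, x, y) - w (t, x, x)" "y - x"] that(2)
        by (simp add: divide_le_eq)
    qed
    have "continuous_on UNIV (\<lambda>y. norm (w (t, x, y) - w (t, x, x)))"
      by (intro continuous_intros continuous_on_compose2[OF w(1)]) auto
    then have "((\<lambda>y. norm (w (t, x, y) - w (t, x, x))) \<longlongrightarrow> norm (w (t, x, x) - w (t, x, x))) (at x within ball x0 r)"
      unfolding continuous_on_def by (blast intro: tendsto_within_subset)
    then show "((\<lambda>y. norm (w (t, x, y) - w (t, x, x))) \<longlongrightarrow> 0) (at x within ball x0 r)" by simp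
  qed simp
  show thesis
  proof (rule that[of T' r W])
    show "ball x0 r \<subseteq> B" using r by (meson ball_subset_cball subset_trans)
    show "W (0, x) = 0" for x by (simp add: W_def w)
    fix t x assume t: "\<bar>t\<bar> < T'" and x: "x \<in> ball x0 r"
    have tT: "\<bar>t\<bar> < T" "x \<in> B" using t T' x r by (auto simp: subset_iff)
    have xK: "x \<in> K" using x by (simp add: K_def)
    \<comment> \<open>The partial derivative in x is continuous and the one in t exists; together
      they give the total derivative.\<close>
    have "((\<lambda>(s, y). u (s, y)) has_derivative (\<lambda>(\<tau>, v). \<tau> *\<^sub>R G (t, x, u (t, x)) + W (t, x) v))
        (at (t, x) within {-T'<..<T'} \<times> ball x0 r)"
    proof (rule has_derivative_partialsI[where f = "\<lambda>s y. u (s, y)" and fy = "\<lambda>s y. W (s, y)"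
          and fx = "\<lambda>\<tau>. \<tau> *\<^sub>R G (t, x, u (t, x))"])
      show "((\<lambda>s. u (s, x)) has_derivative (\<lambda>\<tau>. \<tau> *\<^sub>R G (t, x, u (t, x)))) (at t within {-T'<..<T'})"
        using u(4)[OF tT] by (simp add: has_vector_derivative_def has_derivative_at_withinI)
      show "continuous (at (t, x) within {- T'<..<T'} \<times> ball x0 r) (\<lambda>(s, y). W (s, y))"
        using W by (simp add: continuous_on_eq_continuous_at continuous_at_imp_continuous_at_within)
    qed (use uder x in auto)
    moreover have "at (t, x) within {-T'<..<T'} \<times> ball x0 r = at (t, x)"
      by (rule at_within_open) (use t x in \<open>auto intro: open_Times\<close>)
    ultimately show "(u has_derivative (\<lambda>(\<tau>, v). \<tau> *\<^sub>R G (t, x, u (t, x)) + W (t, x) v)) (at (t, x))"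
      by simp
    fix v
    have "A (t, x, x) = M (Z (t, x), Z (t, x))"
      using c_id[OF t] k_id[OF xK] by (simp add: A_def N_def)
    then have "blinfun_apply (A (t, x, x)) = fderiv G (t, x, u (t, x))"
      using M(3)[OF Z[OF tT]] by (simp add: Z_def)
    then show "((\<lambda>s. W (s, x) v) has_vector_derivative
        fderiv G (t, x, u (t, x)) (0, v, W (t, x) v)) (at t)"
      using wapp[OF t, of x x v] by (simp add: W_def)
  qed (use T' r W in auto)
qed

text \<open>Asking for \<open>L * T \<le> 1/2\<close> makes the integral operator a contraction in the plain supremum norm. The
  variational equation satisfies the same hypotheses with the same \<open>T\<close> and \<open>L\<close>, so that the
  regularity of solutions can be proved by induction.\<close>

definition short_ode_solution ::
  "real \<Rightarrow> real \<Rightarrow> 'p::euclidean_space set \<Rightarrow> 'y::euclidean_space set \<Rightarrow> (real \<times> 'p \<times> 'y \<Rightarrow> 'y) \<Rightarrow>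
     (real \<times> 'p \<Rightarrow> 'y) \<Rightarrow> bool" where
  "short_ode_solution T L B C G u \<longleftrightarrow>
     open B \<and> convex B \<and> open C \<and> convex C \<and> 0 < T \<and> 0 \<le> L \<and> L * T \<le> 1/2 \<and>
     (\<forall>z\<in>{-T<..<T} \<times> B \<times> C. \<forall>w. norm (fderiv G z (0, 0, w)) \<le> L * norm w) \<and>
     continuous_on ({-T<..<T} \<times> B) u \<and>
     (\<forall>t\<in>{-T<..<T}. \<forall>x\<in>B. u (t, x) \<in> C \<and>
        ((\<lambda>s. u (s, x)) has_vector_derivative G (t, x, u (t, x))) (at t)) \<and>
     (\<forall>x\<in>B. u (0, x) = 0)"

text \<open>The operators W of the local lemma depend on choices, but each equals the parameter part
  of the Frechet derivative, so the local results combine to statements on the whole domain.\<close>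

lemma short_ode_solution_derivative:
  fixes G :: "real \<times> 'p::euclidean_space \<times> 'y::euclidean_space \<Rightarrow> 'y"
  assumes u: "short_ode_solution T L B C G u" and G: "Ck_on (Suc 0) ({-T<..<T} \<times> B \<times> C) G"
  shows "t \<in> {-T<..<T} \<Longrightarrow> x \<in> B \<Longrightarrow> (u has_derivative
      (\<lambda>(\<tau>, v). \<tau> *\<^sub>R G (t, x, u (t, x)) + fderiv u (t, x) (0, v))) (at (t, x))"
    and "continuous_on ({-T<..<T} \<times> B) (\<lambda>z. fderiv u z (0, v))"
    and "x \<in> B \<Longrightarrow> fderiv u (0, x) (0, v) = 0"
    and "t \<in> {-T<..<T} \<Longrightarrow> x \<in> B \<Longrightarrow> ((\<lambda>s. fderiv u (s, x) (0, v)) has_vector_derivative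
      fderiv G (t, x, u (t, x)) (0, v, fderiv u (t, x) (0, v))) (at t)"
proof -
  have loc: "\<exists>T' r W. \<bar>t\<bar> < T' \<and> 0 < r \<and>
      continuous_on UNIV (W :: real \<times> 'p \<Rightarrow> 'p \<Rightarrow>\<^sub>L 'y) \<and> (\<forall>x. W (0, x) = 0) \<and>
      (\<forall>t\<in>{-T'<..<T'}. \<forall>x\<in>ball x0 r.
        (u has_derivative (\<lambda>(\<tau>, v). \<tau> *\<^sub>R G (t, x, u (t, x)) + W (t, x) v)) (at (t, x)) \<and>
        (\<forall>v. ((\<lambda>s. W (s, x) v) has_vector_derivative
          fderiv G (t, x, u (t, x)) (0, v, W (t, x) v)) (at t)))"
    if "t \<in> {-T<..<T}" "x0 \<in> B" for t x0
  proof -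
    have t: "\<bar>t\<bar> < T" and x0: "x0 \<in> B" using that by auto
    have hyp: "open B" "convex B" "convex C" "0 \<le> L" "L * T \<le> 1/2" "continuous_on ({-T<..<T} \<times> B) u"
      and L: "\<And>z w. z \<in> {-T<..<T} \<times> B \<times> C \<Longrightarrow> norm (fderiv G z (0, 0, w)) \<le> L * norm w"
      and uC: "\<And>t x. \<bar>t\<bar> < T \<Longrightarrow> x \<in> B \<Longrightarrow> u (t, x) \<in> C" and u0: "\<And>x. x \<in> B \<Longrightarrow> u (0, x) = 0"
      and ud: "\<And>t x. \<bar>t\<bar> < T \<Longrightarrow> x \<in> B \<Longrightarrow> ((\<lambda>s. u (s, x)) has_vector_derivative G (t, x, u (t, x))) (at t)"
      using u by (auto simp: short_ode_solution_def ball_def abs_less_iff minus_less_iff)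
    obtain T' r W where "\<bar>t\<bar> < T'" "T' \<le> T" "0 < r" "ball x0 r \<subseteq> B"
      "continuous_on UNIV (W :: real \<times> 'p \<Rightarrow> 'p \<Rightarrow>\<^sub>L 'y)" "\<And>x. W (0, x) = 0"
      "\<And>t x. \<bar>t\<bar> < T' \<Longrightarrow> x \<in> ball x0 r \<Longrightarrow>
        (u has_derivative (\<lambda>(\<tau>, v). \<tau> *\<^sub>R G (t, x, u (t, x)) + W (t, x) v)) (at (t, x))"
      "\<And>t x v. \<bar>t\<bar> < T' \<Longrightarrow> x \<in> ball x0 r \<Longrightarrow> ((\<lambda>s. W (s, x) v) has_vector_derivative
        fderiv G (t, x, u (t, x)) (0, v, W (t, x) v)) (at t)"
      using ode_parameter_derivative_local[OF hyp(1-3) G L hyp(4-6) uC u0 ud t x0] by blast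
    then show ?thesis
      by (intro exI[of _ T'] exI[of _ r] exI[of _ W]) (simp add: abs_less_iff)
  qed
  have ex: "\<exists>T' r W. \<bar>t\<bar> < T' \<and> 0 < r \<and>
      continuous_on UNIV (W :: real \<times> 'p \<Rightarrow> 'p \<Rightarrow>\<^sub>L 'y) \<and> (\<forall>x. W (0, x) = 0) \<and>
      (\<forall>t\<in>{-T'<..<T'}. \<forall>x\<in>ball x0 r. (\<forall>v. fderiv u (t, x) (0, v) = W (t, x) v) \<and>
        (u has_derivative (\<lambda>(\<tau>, v). \<tau> *\<^sub>R G (t, x, u (t, x)) + W (t, x) v)) (at (t, x)) \<and>
        (\<forall>v. ((\<lambda>s. W (s, x) v) has_vector_derivative
          fderiv G (t, x, u (t, x)) (0, v, W (t, x) v)) (at t)))"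
    if "t \<in> {-T<..<T}" "x0 \<in> B" for t x0
  proof -
    \<comment> \<open>Evaluating at (0, v) removes the time direction.\<close>
    have *: "fderiv u z (0, v) = W v"
      if "(u has_derivative (\<lambda>(\<tau>, v). \<tau> *\<^sub>R g + blinfun_apply W v)) (at z)" for z g W v
      using frechet_derivative_at[OF that] by (metis (no_types, lifting) add_0 old.prod.case scaleR_zero_left)
    show ?thesis using loc[OF that] * by meson
  qed
  {
    fix t x assume tx: "t \<in> {-T<..<T}" "x \<in> B"
    obtain T' r W where W: "\<bar>t\<bar> < T'" "0 < r" "continuous_on UNIV (W :: real \<times> 'p \<Rightarrow> 'p \<Rightarrow>\<^sub>L 'y)"
      "\<forall>x. W (0, x) = 0"
      "\<And>t y v. t \<in> {-T'<..<T'} \<Longrightarrow> y \<in> ball x r \<Longrightarrow> fderiv u (t, y) (0, v) = W (t, y) v"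
      "\<And>t y. t \<in> {-T'<..<T'} \<Longrightarrow> y \<in> ball x r \<Longrightarrow>
        (u has_derivative (\<lambda>(\<tau>, v). \<tau> *\<^sub>R G (t, y, u (t, y)) + W (t, y) v)) (at (t, y))"
      "\<And>t y v. t \<in> {-T'<..<T'} \<Longrightarrow> y \<in> ball x r \<Longrightarrow> ((\<lambda>s. W (s, y) v) has_vector_derivative
          fderiv G (t, y, u (t, y)) (0, v, W (t, y) v)) (at t)"
      using ex[OF tx] by metis
    have t: "t \<in> {-T'<..<T'}" and x: "x \<in> ball x r" using W by auto
    show "(u has_derivative (\<lambda>(\<tau>, v). \<tau> *\<^sub>R G (t, x, u (t, x)) + fderiv u (t, x) (0, v))) (at (t, x))"
      unfolding W(5)[OF t x] by (rule W(6)[OF t x])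
    show "((\<lambda>s. fderiv u (s, x) (0, v)) has_vector_derivative
      fderiv G (t, x, u (t, x)) (0, v, fderiv u (t, x) (0, v))) (at t)"
      unfolding W(5)[OF t x]
      by (rule has_vector_derivative_transform_within_open[OF W(7)[OF t x, of v], of "{-T'<..<T'}"])
        (use t W(5)[OF _ x] in auto)
    have "continuous_on ({-T'<..<T'} \<times> ball x r) (\<lambda>z. W z v)"
      by (rule continuous_on_subset[of UNIV]) (auto intro: blinfun.continuous_on W(3))
    then have "continuous_on ({-T'<..<T'} \<times> ball x r) (\<lambda>z. fderiv u z (0, v))"
      by (rule continuous_on_cong[THEN iffD1, rotated -1]) (auto simp: W(5))
    moreover have "open ({-T'<..<T'} \<times> ball x r)" "(t, x) \<in> {-T'<..<T'} \<times> ball x r"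
      using t x by (auto intro!: open_Times)
    ultimately have "isCont (\<lambda>z. fderiv u z (0, v)) (t, x)"
      by (metis continuous_on_eq_continuous_at)
  }
  note * = this
  show "continuous_on ({-T<..<T} \<times> B) (\<lambda>z. fderiv u z (0, v))"
    using * by (intro continuous_at_imp_continuous_on) auto
  assume x: "x \<in> B"
  have "0 \<in> {-T<..<T}" using u by (auto simp: short_ode_solution_def)
  then obtain T' r W where "\<bar>0\<bar> < T'" "0 < r"
      "\<forall>x. (W :: real \<times> 'p \<Rightarrow> 'p \<Rightarrow>\<^sub>L 'y) (0, x) = 0"
      "\<forall>t\<in>{-T'<..<T'}. \<forall>y\<in>ball x r. \<forall>v. fderiv u (t, y) (0, v) = W (t, y) v"
    using ex[OF _ x] by meson
  then show "fderiv u (0, x) (0, v) = 0" by auto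
qed

lemma has_vector_derivative_along_line:
  assumes "F differentiable (at z)"
  shows "((\<lambda>s. F (z + s *\<^sub>R d)) has_vector_derivative fderiv F z d) (at 0)"
proof -
  have 1: "((\<lambda>s. z + s *\<^sub>R d) has_derivative (\<lambda>s. s *\<^sub>R d)) (at 0)"
    by (auto intro!: derivative_eq_intros)
  have 2: "(F has_derivative fderiv F z) (at (z + 0 *\<^sub>R d))"
    using assms by (simp add: frechet_derivative_works)
  show ?thesis
    using diff_chain_at[OF 1 2] linear_cmul[OF linear_frechet_derivative[OF assms]]
    by (simp add: o_def has_vector_derivative_def)
qed

text \<open>The induction hypothesis is used twice: for u itself, which makes the coefficients of
  the variational equation regular, and then for the directional derivatives of u as solutions of
  that equation.\<close>

lemma short_ode_solution_Ck:
  fixes G :: "real \<times> 'p::euclidean_space \<times> 'y::euclidean_space \<Rightarrow> 'y"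
  assumes "short_ode_solution T L B C G u" "Ck_on (Suc k) ({-T<..<T} \<times> B \<times> C) G"
  shows "Ck_on (Suc k) ({-T<..<T} \<times> B) u"
  using assms
proof (induction k arbitrary: C G u)
  case (0 C G u)
  have o: "open ({-T<..<T} \<times> B)" and C: "\<And>t x. t \<in> {-T<..<T} \<Longrightarrow> x \<in> B \<Longrightarrow> u (t, x) \<in> C"
    using "0.prems"(1) by (auto simp: short_ode_solution_def intro!: open_Times)
  note d = short_ode_solution_derivative[OF 0]
  have Gc: "continuous_on ({-T<..<T} \<times> B \<times> C) G" and uc: "continuous_on ({-T<..<T} \<times> B) u"
    using Ck_on_imp_continuous_on[OF 0(2)] 0(1) by (auto simp: short_ode_solution_def)
  show ?case
  proof (rule Ck_on_SucI[OF o, where F = "\<lambda>z d. fst d *\<^sub>R G (fst z, snd z, u z) + fderiv u z (0, snd d)"])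
    show "(u has_derivative (\<lambda>d. fst d *\<^sub>R G (fst z, snd z, u z) + fderiv u z (0, snd d))) (at z)"
      if "z \<in> {-T<..<T} \<times> B" for z
      using d(1)[of "fst z" "snd z"] that by (auto simp: case_prod_unfold)
    show "Ck_on 0 ({-T<..<T} \<times> B) (\<lambda>z. fst v *\<^sub>R G (fst z, snd z, u z) + fderiv u z (0, snd v))" for v
      unfolding Ck_on.simps
      by (intro continuous_intros d(2) continuous_on_compose2[OF Gc] uc) (use C in auto)
  qed
next
  case (Suc k C G u)
  let ?I = "{-T<..<T}"
  have o: "open (?I \<times> B)" "open (?I \<times> B \<times> (UNIV :: 'y set))"
    and C: "\<And>t x. t \<in> ?I \<Longrightarrow> x \<in> B \<Longrightarrow> u (t, x) \<in> C"
    using Suc.prems(1) by (auto simp: short_ode_solution_def intro!: open_Times)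
  have u: "Ck_on (Suc k) (?I \<times> B) u"
    by (rule Suc.IH[OF Suc.prems(1) Ck_on_SucD[OF Suc.prems(2)]])
  note d = short_ode_solution_derivative[OF Suc.prems(1) Ck_on_mono[OF Suc.prems(2)]]
  have Dlin: "linear (fderiv G (t, x, u (t, x)))"
    if "t \<in> ?I" "x \<in> B" for t x
    using Suc.prems(2) C[OF that] that by (intro linear_frechet_derivative) auto
  have w: "Ck_on (Suc k) (?I \<times> B) (\<lambda>z. fderiv u z (0, v))" for v
  proof -
    \<comment> \<open>The fibre variable is now the unknown derivative, while u has become part of
      the coefficients. G has one order to spare, so F keeps the order of u.\<close>
    define F where "F = (\<lambda>z :: real \<times> 'p \<times> 'y.
      fderiv G (fst z, fst (snd z), u (fst z, fst (snd z))) (0, v, snd (snd z)))"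
    have F: "Ck_on (Suc k) (?I \<times> B \<times> UNIV) F"
      unfolding F_def
      by (rule Ck_on_frechet_derivative_apply[OF o(2) Suc.prems(2)])
        (use C in \<open>auto simp del: Ck_on.simps intro!: Ck_on_Pair Ck_on_fst Ck_on_snd Ck_on_compose[OF _ u] o(2)\<close>)
    \<comment> \<open>F is affine in its last argument, with linear part the fibre derivative of G
      along u. This is why the constant L is inherited.\<close>
    have FD: "fderiv F (t, x, y) (0, 0, w) = fderiv G (t, x, u (t, x)) (0, 0, w)"
      if "t \<in> ?I" "x \<in> B" for t x y w
    proof -
      have "((\<lambda>s. F ((t, x, y) + s *\<^sub>R (0, 0, w))) has_vector_derivative fderiv F (t, x, y) (0, 0, w)) (at 0)"
        by (rule has_vector_derivative_along_line) (use F that in auto)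
      moreover have "F ((t, x, y) + s *\<^sub>R (0, 0, w)) =
          fderiv G (t, x, u (t, x)) (0, v, y) + s *\<^sub>R fderiv G (t, x, u (t, x)) (0, 0, w)" for s
        using linear_add[OF Dlin[OF that], of "(0, v, y)" "s *\<^sub>R (0, 0, w)"] linear_cmul[OF Dlin[OF that], of s "(0, 0, w)"]
        by (simp add: F_def)
      moreover have "((\<lambda>s. fderiv G (t, x, u (t, x)) (0, v, y) + s *\<^sub>R fderiv G (t, x, u (t, x)) (0, 0, w))
          has_vector_derivative fderiv G (t, x, u (t, x)) (0, 0, w)) (at 0)"
        by (auto intro!: derivative_eq_intros)
      ultimately show ?thesis
        by (simp add: vector_derivative_unique_at)
    qed
    have "short_ode_solution T L B UNIV F (\<lambda>z. fderiv u z (0, v))"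
      unfolding short_ode_solution_def
    proof (intro conjI ballI allI)
      show "norm (fderiv F z (0, 0, w)) \<le> L * norm w" if "z \<in> ?I \<times> B \<times> UNIV" for z w
      proof -
        obtain t x y where z: "z = (t, x, y)" by (cases z)
        then have z: "z = (t, x, y)" "t \<in> ?I" "x \<in> B" using that by auto
        show ?thesis
          using Suc.prems(1) C[OF z(2,3)] z(2,3) unfolding z(1) FD[OF z(2,3)] short_ode_solution_def
          by auto
      qed
      show "((\<lambda>s. fderiv u (s, x) (0, v)) has_vector_derivative
          F (t, x, fderiv u (t, x) (0, v))) (at t)" if "t \<in> ?I" "x \<in> B" for t x
        using d(4)[OF _ that, of v] by (simp add: F_def)
    qed (use Suc.prems(1) d(2,3) in \<open>auto simp: short_ode_solution_def\<close>)
    then show ?thesis by (rule Suc.IH[OF _ F])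
  qed
  show ?case
  proof (rule Ck_on_SucI[OF o(1), where F = "\<lambda>z d. fst d *\<^sub>R G (fst z, snd z, u z) + fderiv u z (0, snd d)"])
    show "(u has_derivative (\<lambda>d. fst d *\<^sub>R G (fst z, snd z, u z) + fderiv u z (0, snd d))) (at z)"
      if "z \<in> ?I \<times> B" for z
      using d(1)[of "fst z" "snd z"] that by (auto simp: case_prod_unfold)
    show "Ck_on (Suc k) (?I \<times> B) (\<lambda>z. fst v *\<^sub>R G (fst z, snd z, u z) + fderiv u z (0, snd v))" for v
      by (intro Ck_on_add Ck_on_scaleR Ck_on_const w o(1) Ck_on_compose[OF o(1) Ck_on_SucD[OF Suc.prems(2)]]
          Ck_on_Pair Ck_on_fst Ck_on_snd Ck_on_ident u) (use C in auto)
  qed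
qed

section \<open>Smooth local flow of an autonomous vector field\<close>

lemma Ck_on_compact_imp_lipschitz:
  fixes X :: "'a::euclidean_space \<Rightarrow> 'b::real_normed_vector"
  assumes X: "Ck_on (Suc 0) Y X" and K: "compact K" "convex K" "K \<subseteq> Y"
  obtains L where "0 \<le> L" "\<And>z w. z \<in> K \<Longrightarrow> norm (fderiv X z w) \<le> L * norm w"
    "\<And>z z'. z \<in> K \<Longrightarrow> z' \<in> K \<Longrightarrow> norm (X z' - X z) \<le> L * norm (z' - z)"
proof -
  define D where "D z = Blinfun (fderiv X z)" for z
  have "continuous_on K D"
    unfolding D_def by (rule continuous_on_subset[OF continuous_on_Blinfun_frechet_derivative(1)[OF X] K(3)])
  then have "bounded (D ` K)" by (intro compact_imp_bounded compact_continuous_image K)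
  then obtain L where L: "\<And>z. z \<in> K \<Longrightarrow> norm (D z) \<le> L" "0 < L"
    by (metis bounded_pos imageI)
  have D: "fderiv X z w = D z w" if "z \<in> K" for z w
    unfolding D_def using continuous_on_Blinfun_frechet_derivative(2)[OF X, of z] that K(3) by auto
  have bound: "norm (fderiv X z w) \<le> L * norm w" if "z \<in> K" for z w
    unfolding D[OF that] by (rule order_trans[OF norm_blinfun mult_right_mono[OF L(1)[OF that] norm_ge_zero]])
  show thesis
  proof (rule that[of L])
    show "norm (X z' - X z) \<le> L * norm (z' - z)" if "z \<in> K" "z' \<in> K" for z z'
    proof (rule differentiable_bound[OF K(2), where f' = "\<lambda>z. fderiv X z"])
      show "(X has_derivative fderiv X z) (at z within K)" if "z \<in> K" for z
        using Ck_on_has_derivative[OF X, of z] K(3) that by (auto intro: has_derivative_at_withinI)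
      show "onorm (fderiv X z) \<le> L" if "z \<in> K" for z
        using bound[OF that] by (rule onorm_le)
    qed (use that in auto)
  qed (use L bound in auto)
qed

text \<open>The unknown is the displacement from the initial point and the initial point is a
  parameter: all initial values become 0 and the results with parameters apply. The last two
  conclusions are the variational equation, needed to differentiate the action.\<close>

theorem smooth_local_flow:
  fixes X :: "'a::euclidean_space \<Rightarrow> 'a"
  assumes Y: "open Y" "smooth_on Y X" "z0 \<in> Y"
  obtains T r \<phi> where "0 < T" "0 < r" "ball z0 r \<subseteq> Y" "smooth_on ({-T<..<T} \<times> ball z0 r) \<phi>"
    "\<And>z. z \<in> ball z0 r \<Longrightarrow> \<phi> (0, z) = z"
    "\<And>t z. t \<in> {-T<..<T} \<Longrightarrow> z \<in> ball z0 r \<Longrightarrow> \<phi> (t, z) \<in> Y"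
    "\<And>t z. t \<in> {-T<..<T} \<Longrightarrow> z \<in> ball z0 r \<Longrightarrow>
      ((\<lambda>s. \<phi> (s, z)) has_vector_derivative X (\<phi> (t, z))) (at t)"
    "\<And>z v. z \<in> ball z0 r \<Longrightarrow> fderiv \<phi> (0, z) (0, v) = v"
    "\<And>t z v. t \<in> {-T<..<T} \<Longrightarrow> z \<in> ball z0 r \<Longrightarrow>
      ((\<lambda>s. fderiv \<phi> (s, z) (0, v)) has_vector_derivative
        fderiv X (\<phi> (t, z)) (fderiv \<phi> (t, z) (0, v))) (at t)"
proof -
  have X: "Ck_on k Y X" for k using Y(2) by (simp add: smooth_on_def)
  obtain R where R: "0 < R" "cball z0 R \<subseteq> Y"
    using Y open_contains_cball by metis
  \<comment> \<open>Initial point and displacement each stay within r, so that trajectories stay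
    within R of the centre.\<close>
  define r where "r = R / 2"
  define K where "K = cball z0 R"
  have r: "0 < r" "R = 2 * r" using R by (auto simp: r_def)
  have K: "compact K" "convex K" "K \<subseteq> Y" "closed K" "K \<noteq> {}" using R by (auto simp: K_def)
  obtain L where L: "0 \<le> L" "\<And>z w. z \<in> K \<Longrightarrow> norm (fderiv X z w) \<le> L * norm w"
    "\<And>z z'. z \<in> K \<Longrightarrow> z' \<in> K \<Longrightarrow> norm (X z' - X z) \<le> L * norm (z' - z)"
    using Ck_on_compact_imp_lipschitz[OF X K(1-3)] by metis
  have Xc: "continuous_on K X" by (rule continuous_on_subset[OF Ck_on_imp_continuous_on[OF X] K(3)])
  then have "bounded (X ` K)" by (intro compact_imp_bounded compact_continuous_image K)
  then obtain M where M: "\<And>z. z \<in> K \<Longrightarrow> norm (X z) \<le> M" "0 < M"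
    by (metis bounded_pos imageI)
  \<comment> \<open>The first bound makes the integral operator a contraction, with L + 1 covering L
    = 0; the second keeps displacements below r.\<close>
  define T where "T = min (1 / (2 * (L + 1))) (r / M)"
  have T: "0 < T" using L r M by (auto simp: T_def)
  have LT: "L * T \<le> 1/2"
  proof -
    have "L * T \<le> L * (1 / (2 * (L + 1)))"
      using L by (intro mult_left_mono) (auto simp: T_def)
    also have "\<dots> \<le> 1/2" using L by (auto simp: field_simps)
    finally show ?thesis .
  qed
  have MT: "M * T \<le> r"
  proof -
    have "M * T \<le> M * (r / M)"
      using M by (intro mult_left_mono) (auto simp: T_def)
    then show ?thesis using M by simp
  qed
  define k where "k = closest_point K"
  have k: "continuous_on UNIV k"
    unfolding k_def by (rule continuous_on_closest_point[OF K(2,4,5)])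
  have kK: "k x \<in> K" for x unfolding k_def by (rule closest_point_in_set[OF K(4,5)])
  have k_id: "k x = x" if "x \<in> K" for x unfolding k_def by (rule closest_point_self[OF that])
  have k_lip: "norm (k x - k y) \<le> norm (x - y)" for x y
    unfolding k_def dist_norm[symmetric] by (rule closest_point_lipschitz[OF K(2,4,5)])
  \<comment> \<open>Projecting to K makes the field bounded and Lipschitz everywhere; by
    \<open>FG\<close> the projection changes nothing along trajectories up to time T.\<close>
  define F where "F = (\<lambda>(s :: real, x, y). X (k (x + y)))"
  have F: "continuous_on UNIV F"
    unfolding F_def case_prod_beta
    by (intro continuous_on_compose2[OF Xc] continuous_on_compose2[OF k] continuous_intros) (auto simp: kK)
  have F0: "norm (F z) \<le> M" for z
    unfolding F_def case_prod_beta by (rule M(1)[OF kK])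
  have FL: "norm (F (s, x, y) - F (s, x, y')) \<le> L * norm (y - y')" for s x y y'
  proof -
    have "norm (F (s, x, y) - F (s, x, y')) \<le> L * norm (k (x + y) - k (x + y'))"
      unfolding F_def prod.case by (rule L(3)[OF kK kK])
    also have "\<dots> \<le> L * norm (y - y')"
      using k_lip[of "x + y" "x + y'"] L(1) by (intro mult_left_mono) auto
    finally show ?thesis .
  qed
  obtain u where u: "continuous_on UNIV u" "\<And>x. u (0, x) = 0"
    "\<And>t x. \<bar>t\<bar> < T \<Longrightarrow> ((\<lambda>s. u (s, x)) has_vector_derivative F (t, x, u (t, x))) (at t)"
    using ode_parametrized_solution[OF F F0 FL T L(1) LT] by metis
  have ub: "norm (u (t, x)) < r" if t: "\<bar>t\<bar> < T" for t x
  proof -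
    have "norm (u (t, x) - u (0, x)) \<le> M * \<bar>t - 0\<bar>"
    proof (rule norm_diff_le_of_vector_derivative)
      fix s assume "s \<in> closed_segment 0 t"
      then have "\<bar>s\<bar> < T" using t by (auto simp: closed_segment_eq_real_ivl split: if_splits)
      then show "((\<lambda>t. u (t, x)) has_vector_derivative F (s, x, u (s, x))) (at s)" by (rule u(3))
    qed (rule F0)
    also have "\<dots> < M * T" using t M(2) by simp
    finally show ?thesis using u(2) MT by simp
  qed
  have in_K: "x + y \<in> K" if "x \<in> ball z0 r" "y \<in> ball 0 r" for x y
  proof -
    have "dist z0 (x + y) \<le> dist z0 x + norm y"
      using dist_triangle[of z0 "x + y" x] by (simp add: dist_norm)
    then show ?thesis using that r by (auto simp: K_def)
  qed
  define G where "G = (\<lambda>z :: real \<times> 'a \<times> 'a. X (fst (snd z) + snd (snd z)))"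
  let ?\<Omega> = "{-T<..<T} \<times> ball z0 r \<times> ball 0 r"
  have o: "open ?\<Omega>" "open ({-T<..<T} \<times> ball z0 r)" by (auto intro!: open_Times)
  have in_Y: "fst (snd z) + snd (snd z) \<in> Y" if "z \<in> ?\<Omega>" for z
    using in_K[of "fst (snd z)" "snd (snd z)"] that K(3) by auto
  have G: "Ck_on j ?\<Omega> G" for j
    unfolding G_def
    by (rule Ck_on_compose[OF o(1) X])
      (use in_Y in \<open>auto intro!: Ck_on_add Ck_on_fst Ck_on_snd o(1) simp del: ball_eq_empty\<close>)
  have GD: "fderiv G z (0, v, w) = fderiv X (fst (snd z) + snd (snd z)) (v + w)"
    if "z \<in> ?\<Omega>" for z v w
  proof -
    have 1: "((\<lambda>z :: real \<times> 'a \<times> 'a. fst (snd z) + snd (snd z)) has_derivative (\<lambda>d. fst (snd d) + snd (snd d))) (at z)"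
      by (auto intro!: derivative_eq_intros)
    have "fderiv G z = (\<lambda>d. fderiv X (fst (snd z) + snd (snd z)) (fst (snd d) + snd (snd d)))"
      using diff_chain_at[OF 1 Ck_on_has_derivative[OF X in_Y[OF that]]]
      by (intro frechet_derivative_at[symmetric]) (simp add: G_def o_def)
    then show ?thesis by simp
  qed
  have FG: "F (t, x, u (t, x)) = G (t, x, u (t, x))" if "t \<in> {-T<..<T}" "x \<in> ball z0 r" for t x
  proof -
    have "x + u (t, x) \<in> K" using that ub[of t x] by (intro in_K) (auto simp: abs_less_iff)
    then show ?thesis by (simp add: F_def G_def k_id)
  qed
  have sol: "short_ode_solution T L (ball z0 r) (ball 0 r) G u"
    unfolding short_ode_solution_def
  proof (intro conjI ballI allI)
    show "norm (fderiv G z (0, 0, w)) \<le> L * norm w" if "z \<in> ?\<Omega>" for z w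
      unfolding GD[OF that] using L(2)[OF in_K, of "fst (snd z)" "snd (snd z)" w] that by auto
    show "u (t, x) \<in> ball 0 r" if "t \<in> {-T<..<T}" for t x using ub[of t x] that by auto
    show "((\<lambda>s. u (s, x)) has_vector_derivative G (t, x, u (t, x))) (at t)"
      if "t \<in> {-T<..<T}" "x \<in> ball z0 r" for t x
      using u(3)[of t x] that FG[OF that] by (auto simp: abs_less_iff)
  qed (use T L LT u in \<open>auto intro: continuous_on_subset\<close>)
  have uCk: "Ck_on j ({-T<..<T} \<times> ball z0 r) u" for j
    by (rule Ck_on_SucD, rule short_ode_solution_Ck[OF sol G])
  note d = short_ode_solution_derivative[OF sol G]
  define \<phi> where "\<phi> z = snd z + u z" for z
  have \<phi>D: "fderiv \<phi> z (0, v) = v + fderiv u z (0, v)"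
    if "z \<in> {-T<..<T} \<times> ball z0 r" for z v
  proof -
    have "(\<phi> has_derivative (\<lambda>d. snd d + fderiv u z d)) (at z)"
      unfolding \<phi>_def by (intro derivative_intros Ck_on_has_derivative[OF uCk that])
    from frechet_derivative_at[OF this] show ?thesis by (metis snd_conv)
  qed
  have uin: "u (t, x) \<in> ball 0 r" if "t \<in> {-T<..<T}" for t x using ub[of t x] that by auto
  show thesis
  proof (rule that[of T r \<phi>])
    show "ball z0 r \<subseteq> Y" using R r by (auto simp: subset_iff)
    show "smooth_on ({-T<..<T} \<times> ball z0 r) \<phi>"
      unfolding smooth_on_def \<phi>_def by (intro allI Ck_on_add Ck_on_snd Ck_on_ident uCk o)
    show "\<phi> (0, z) = z" for z by (simp add: \<phi>_def u)
    show "\<phi> (t, z) \<in> Y" if "t \<in> {-T<..<T}" "z \<in> ball z0 r" for t z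
      using in_K[OF that(2) uin[OF that(1)], of z] K(3) by (auto simp: \<phi>_def)
    show "((\<lambda>s. \<phi> (s, z)) has_vector_derivative X (\<phi> (t, z))) (at t)"
      if "t \<in> {-T<..<T}" "z \<in> ball z0 r" for t z
      unfolding \<phi>_def snd_conv using u(3)[of t z] FG[OF that] that
      by (auto intro!: derivative_eq_intros simp: G_def abs_less_iff)
    show "fderiv \<phi> (0, z) (0, v) = v" if "z \<in> ball z0 r" for z v
      using \<phi>D[of "(0, z)" v] d(3)[OF that, of v] T that by simp
    show "((\<lambda>s. fderiv \<phi> (s, z) (0, v)) has_vector_derivative
        fderiv X (\<phi> (t, z)) (fderiv \<phi> (t, z) (0, v))) (at t)"
      if "t \<in> {-T<..<T}" "z \<in> ball z0 r" for t z v
    proof (rule has_vector_derivative_transform_within_open[where S = "{-T<..<T}"])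
      show "((\<lambda>s. v + fderiv u (s, z) (0, v)) has_vector_derivative
        fderiv X (\<phi> (t, z)) (fderiv \<phi> (t, z) (0, v))) (at t)"
        using d(4)[OF that, of v] \<phi>D[of "(t, z)" v] that uin[OF that(1), of z]
        by (auto intro!: derivative_eq_intros simp: GD \<phi>_def)
    qed (use that \<phi>D in auto)
  qed (use T r in auto)
qed

section \<open>Symmetry of second derivatives\<close>

lemma has_real_derivative_along_line:
  fixes f :: "'a::real_normed_vector \<Rightarrow> real"
  assumes "f differentiable (at (y + a *\<^sub>R v))"
  shows "((\<lambda>a. f (y + a *\<^sub>R v)) has_real_derivative fderiv f (y + a *\<^sub>R v) v) (at a)"
proof -
  have 1: "((\<lambda>s. y + s *\<^sub>R v) has_derivative (\<lambda>s. s *\<^sub>R v)) (at a)"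
    by (auto intro!: derivative_eq_intros)
  have 2: "(f has_derivative fderiv f (y + a *\<^sub>R v)) (at (y + a *\<^sub>R v))"
    using assms by (simp add: frechet_derivative_works)
  show ?thesis
    using diff_chain_at[OF 1 2] linear_cmul[OF linear_frechet_derivative[OF assms]]
    by (simp add: o_def has_real_derivative_iff_has_vector_derivative has_vector_derivative_def)
qed

text \<open>The mean value theorem is applied along v and then along w. The second difference itself
  is symmetric in v and w, so exchanging them compares the two mixed derivatives.\<close>

lemma second_difference_mean_value:
  fixes f :: "'a::real_normed_vector \<Rightarrow> real"
  assumes f: "Ck_on (Suc (Suc 0)) (ball x \<rho>) f" and s: "0 < s" "s * (norm v + norm w) < \<rho>"
  shows "\<exists>y. dist x y \<le> s * (norm v + norm w) \<and>
    f (x + s *\<^sub>R v + s *\<^sub>R w) - f (x + s *\<^sub>R v) - f (x + s *\<^sub>R w) + f x =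
      s * (s * fderiv (\<lambda>y. fderiv f y v) y w)"
proof -
  have dist: "dist x (x + a *\<^sub>R v + b *\<^sub>R w) \<le> s * (norm v + norm w)"
    if "0 \<le> a" "a \<le> s" "0 \<le> b" "b \<le> s" for a b
  proof -
    have "x - (x + a *\<^sub>R v + b *\<^sub>R w) = - (a *\<^sub>R v + b *\<^sub>R w)" by simp
    then have "dist x (x + a *\<^sub>R v + b *\<^sub>R w) = norm (a *\<^sub>R v + b *\<^sub>R w)"
      by (simp only: dist_norm norm_minus_cancel)
    also have "\<dots> \<le> a * norm v + b * norm w"
      using norm_triangle_ineq[of "a *\<^sub>R v" "b *\<^sub>R w"] that by simp
    also have "\<dots> \<le> s * norm v + s * norm w"
      using that by (intro add_mono mult_right_mono) auto
    finally show ?thesis by (simp add: distrib_left)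
  qed
  have in_ball: "x + a *\<^sub>R v + b *\<^sub>R w \<in> ball x \<rho>"
    if "0 \<le> a" "a \<le> s" "0 \<le> b" "b \<le> s" for a b
    using dist[OF that] s(2) by simp
  define D where "D y = fderiv f y v" for y
  have fd: "f differentiable (at y)" "D differentiable (at y)" if "y \<in> ball x \<rho>" for y
    using f that unfolding D_def by auto
  define \<phi> where "\<phi> a = f (x + s *\<^sub>R w + a *\<^sub>R v) - f (x + a *\<^sub>R v)" for a
  have "\<exists>\<xi>>0. \<xi> < s \<and> \<phi> s - \<phi> 0 = (s - 0) * (D (x + s *\<^sub>R w + \<xi> *\<^sub>R v) - D (x + \<xi> *\<^sub>R v))"
  proof (rule MVT2[OF s(1)])
    fix a assume a: "0 \<le> a" "a \<le> s"
    show "(\<phi> has_real_derivative (D (x + s *\<^sub>R w + a *\<^sub>R v) - D (x + a *\<^sub>R v))) (at a)"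
      unfolding \<phi>_def D_def
      by (intro DERIV_diff has_real_derivative_along_line fd)
        (use in_ball[OF a, of s] in_ball[OF a, of 0] s in \<open>auto simp: ac_simps\<close>)
  qed
  then obtain \<xi> where \<xi>: "0 < \<xi>" "\<xi> < s" "\<phi> s - \<phi> 0 = s * (D (x + \<xi> *\<^sub>R v + s *\<^sub>R w) - D (x + \<xi> *\<^sub>R v))"
    by (auto simp: ac_simps)
  have "\<exists>\<eta>>0. \<eta> < s \<and> D (x + \<xi> *\<^sub>R v + s *\<^sub>R w) - D (x + \<xi> *\<^sub>R v + 0 *\<^sub>R w) =
      (s - 0) * fderiv D (x + \<xi> *\<^sub>R v + \<eta> *\<^sub>R w) w"
    by (rule MVT2[OF s(1)], rule has_real_derivative_along_line, rule fd, rule in_ball) (use \<xi> in auto)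
  then obtain \<eta> where \<eta>: "0 < \<eta>" "\<eta> < s" "D (x + \<xi> *\<^sub>R v + s *\<^sub>R w) - D (x + \<xi> *\<^sub>R v) =
      s * fderiv D (x + \<xi> *\<^sub>R v + \<eta> *\<^sub>R w) w"
    by auto
  have "f (x + s *\<^sub>R v + s *\<^sub>R w) - f (x + s *\<^sub>R v) - f (x + s *\<^sub>R w) + f x = \<phi> s - \<phi> 0"
    by (simp add: \<phi>_def ac_simps)
  then show ?thesis
    using \<xi> \<eta> dist[of \<xi> \<eta>] unfolding D_def
    by (intro exI[of _ "x + \<xi> *\<^sub>R v + \<eta> *\<^sub>R w"]) auto
qed

lemma second_derivative_symmetric_real:
  fixes f :: "'a::real_normed_vector \<Rightarrow> real"
  assumes f: "Ck_on (Suc (Suc 0)) X f" and X: "open X" "x \<in> X"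
  shows "fderiv (\<lambda>y. fderiv f y v) x w =
    fderiv (\<lambda>y. fderiv f y w) x v"
proof -
  define g where "g v w y = fderiv (\<lambda>y. fderiv f y v) y w" for v w y
  have "continuous_on X (g v w)" for v w
    using f unfolding g_def by simp
  then have g: "isCont (g v w) x" for v w
    using X(2) continuous_on_eq_continuous_at[OF X(1)] by blast
  obtain \<rho> where \<rho>: "0 < \<rho>" "ball x \<rho> \<subseteq> X" using X open_contains_ball by metis
  have fb: "Ck_on (Suc (Suc 0)) (ball x \<rho>) f" by (rule Ck_on_subset[OF f \<rho>(2)])
  have "dist (g v w x) (g w v x) \<le> 0 + e" if "0 < e" for e
  proof -
    obtain d1 where d1: "0 < d1" "\<And>y. dist y x < d1 \<Longrightarrow> dist (g v w y) (g v w x) < e/2"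
      using g[of v w] \<open>0 < e\<close> by (auto simp: continuous_at_eps_delta dest: spec[of _ "e/2"])
    obtain d2 where d2: "0 < d2" "\<And>y. dist y x < d2 \<Longrightarrow> dist (g w v y) (g w v x) < e/2"
      using g[of w v] \<open>0 < e\<close> by (auto simp: continuous_at_eps_delta dest: spec[of _ "e/2"])
    define d where "d = min \<rho> (min d1 d2)"
    \<comment> \<open>With this s both intermediate points lie within d of x; the summand 1 keeps
      the divisor positive when v and w vanish.\<close>
    define s where "s = d / (norm v + norm w + 1)"
    have n: "0 < norm v + norm w + 1" by (smt (verit) norm_ge_zero)
    have d: "0 < d" using \<rho> d1 d2 by (auto simp: d_def)
    have s: "0 < s" using d n by (simp add: s_def)
    have "s * (norm v + norm w) < s * (norm v + norm w + 1)" using s by simp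
    also have "\<dots> = d" using n by (simp add: s_def)
    finally have sd: "s * (norm v + norm w) < d" .
    obtain y1 where y1: "dist x y1 \<le> s * (norm v + norm w)"
      "f (x + s *\<^sub>R v + s *\<^sub>R w) - f (x + s *\<^sub>R v) - f (x + s *\<^sub>R w) + f x = s * (s * g v w y1)"
      using second_difference_mean_value[OF fb s, of v w] sd unfolding g_def by (auto simp: d_def)
    obtain y2 where y2: "dist x y2 \<le> s * (norm v + norm w)"
      "f (x + s *\<^sub>R w + s *\<^sub>R v) - f (x + s *\<^sub>R w) - f (x + s *\<^sub>R v) + f x = s * (s * g w v y2)"
      using second_difference_mean_value[OF fb s, of w v] sd unfolding g_def by (auto simp: d_def add.commute)
    \<comment> \<open>The second difference does not see the order of v and w.\<close>
    have "s * (s * g v w y1) = s * (s * g w v y2)"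
      using y1(2) y2(2) unfolding add.assoc add.commute[of "s *\<^sub>R w"] by linarith
    then have eq: "g v w y1 = g w v y2" using s by simp
    have "dist y1 x < d1" "dist y2 x < d2"
      using y1(1) y2(1) sd by (auto simp: d_def dist_commute)
    from d1(2)[OF this(1)] d2(2)[OF this(2)] show ?thesis
      unfolding eq dist_real_def by linarith
  qed
  then have "dist (g v w x) (g w v x) \<le> 0" by (rule field_le_epsilon)
  then show ?thesis by (simp add: g_def)
qed

lemma second_derivative_symmetric:
  fixes f :: "'a::real_normed_vector \<Rightarrow> 'b::euclidean_space"
  assumes f: "Ck_on (Suc (Suc 0)) X f" and X: "open X" "x \<in> X"
  shows "fderiv (\<lambda>y. fderiv f y v) x w =
    fderiv (\<lambda>y. fderiv f y w) x v"
proof (rule euclidean_eqI)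
  fix b :: 'b assume "b \<in> Basis"
  have comp: "fderiv (\<lambda>y. h y \<bullet> b) y = (\<lambda>v. fderiv h y v \<bullet> b)"
    if "h differentiable (at y)" for h :: "'a \<Rightarrow> 'b" and y
    using that unfolding frechet_derivative_works
    by (intro frechet_derivative_at[symmetric] has_derivative_inner_left)
  have fb: "Ck_on (Suc (Suc 0)) X (\<lambda>y. f y \<bullet> b)"
    by (rule Ck_on_compose_bounded_linear[OF bounded_linear_inner_left X(1) f])
  have "fderiv (\<lambda>y. fderiv (\<lambda>y. f y \<bullet> b) y v) x w =
      fderiv (\<lambda>y. fderiv f y v) x w \<bullet> b" for v w
  proof -
    have "fderiv (\<lambda>y. fderiv (\<lambda>y. f y \<bullet> b) y v) x =
        fderiv (\<lambda>y. fderiv f y v \<bullet> b) x"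
    proof (rule frechet_derivative_transform_within_open[OF _ X])
      show "(\<lambda>y. fderiv (\<lambda>y. f y \<bullet> b) y v) differentiable (at x)"
        using fb X by auto
      show "fderiv (\<lambda>y. f y \<bullet> b) y v = fderiv f y v \<bullet> b" if "y \<in> X" for y
        using f that by (subst comp) auto
    qed
    then show ?thesis using f X by (subst (asm) comp) auto
  qed
  then show "fderiv (\<lambda>y. fderiv f y v) x w \<bullet> b =
      fderiv (\<lambda>y. fderiv f y w) x v \<bullet> b"
    using second_derivative_symmetric_real[OF fb X, of v w] by simp
qed

section \<open>Charts of the cotangent bundle\<close>

locale smooth_manifold =
  fixes A :: "('m::{t2_space, second_countable_topology}, 'n::finite) chart set"
  assumes smooth: "smooth_structure A"
begin

lemma chart:
  assumes "c \<in> A"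
  shows "open (fst c)" "open (patch_domain c)" "homeomorphism (fst c) (patch_domain c) (snd c) (patch c)"
  using smooth assms by (auto simp: smooth_structure_def is_chart_def)

lemma patch_chart [simp]: "c \<in> A \<Longrightarrow> q \<in> fst c \<Longrightarrow> patch c (snd c q) = q"
  using chart(3) homeomorphism_apply1 by blast

lemma chart_patch [simp]: "c \<in> A \<Longrightarrow> x \<in> patch_domain c \<Longrightarrow> snd c (patch c x) = x"
  using chart(3) homeomorphism_apply2 by blast

lemma chart_in_patch_domain [simp]: "q \<in> fst c \<Longrightarrow> snd c q \<in> patch_domain c"
  by (simp add: patch_domain_def)

lemma patch_in_chart [simp]: "c \<in> A \<Longrightarrow> x \<in> patch_domain c \<Longrightarrow> patch c x \<in> fst c"
  using homeomorphism_image2[OF chart(3)] by blast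

lemma open_chart_image:
  assumes "c \<in> A" "open W" "W \<subseteq> fst c"
  shows "open (snd c ` W)"
proof -
  have "openin (top_of_set (patch_domain c)) (snd c ` W)"
    using chart[OF assms(1)] assms(2,3)
    by (intro homeomorphism_imp_open_map[OF chart(3)[OF assms(1)]]) (auto simp: openin_open_eq)
  then show ?thesis
    using chart(2)[OF assms(1)] by (simp add: openin_open_eq)
qed

definition overlap :: "('m, 'n) chart \<Rightarrow> ('m, 'n) chart \<Rightarrow> (real^'n) set" where
  "overlap c d = snd c ` (fst c \<inter> fst d)"

lemma overlap_iff:
  assumes "c \<in> A"
  shows "x \<in> overlap c d \<longleftrightarrow> x \<in> patch_domain c \<and> patch c x \<in> fst d"
  using assms by (force simp: overlap_def patch_domain_def)

lemma open_overlap: "c \<in> A \<Longrightarrow> d \<in> A \<Longrightarrow> open (overlap c d)"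
  unfolding overlap_def by (intro open_chart_image open_Int chart) auto

lemma chart_in_overlap [simp]: "q \<in> fst c \<Longrightarrow> q \<in> fst d \<Longrightarrow> snd c q \<in> overlap c d"
  by (simp add: overlap_def)

lemma transition_Ck:
  assumes "c \<in> A" "d \<in> A"
  shows "Ck_on k (overlap c d) (transition c d)"
  using smooth assms by (auto simp: smooth_structure_def compatible_def smooth_on_def overlap_def)

abbreviation Dtrans :: "('m, 'n) chart \<Rightarrow> ('m, 'n) chart \<Rightarrow> real^'n \<Rightarrow> real^'n \<Rightarrow> real^'n" where
  "Dtrans c d x \<equiv> fderiv (transition c d) x"

lemma has_derivative_transition:
  "c \<in> A \<Longrightarrow> d \<in> A \<Longrightarrow> x \<in> overlap c d \<Longrightarrow> (transition c d has_derivative Dtrans c d x) (at x)"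
  by (rule Ck_on_has_derivative[OF transition_Ck])

lemma transition_in_overlap:
  "c \<in> A \<Longrightarrow> d \<in> A \<Longrightarrow> x \<in> overlap c d \<Longrightarrow> transition c d x \<in> overlap d c"
  by (auto simp: overlap_iff transition_def)

text \<open>The cocycle rule; it makes components prescribed through one chart consistent in all
  others.\<close>

lemma Dtrans_chain:
  assumes "c \<in> A" "d \<in> A" "e \<in> A" "q \<in> fst c" "q \<in> fst d" "q \<in> fst e"
  shows "Dtrans c e (snd c q) v = Dtrans d e (snd d q) (Dtrans c d (snd c q) v)"
proof -
  have t: "transition c d (snd c q) = snd d q" using assms by (simp add: transition_def)
  have 1: "(transition c d has_derivative Dtrans c d (snd c q)) (at (snd c q))"
    and 2: "(transition d e has_derivative Dtrans d e (snd d q)) (at (transition c d (snd c q)))"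
    using has_derivative_transition[of c d "snd c q"] has_derivative_transition[of d e "snd d q"] assms
    unfolding t by simp_all
  have "((transition d e \<circ> transition c d) has_derivative Dtrans d e (snd d q) \<circ> Dtrans c d (snd c q)) (at (snd c q))"
    by (rule diff_chain_at[OF 1 2])
  then have "(transition c e has_derivative Dtrans d e (snd d q) \<circ> Dtrans c d (snd c q)) (at (snd c q))"
    by (rule has_derivative_transform_within_open[where s = "overlap c d \<inter> overlap c e"])
      (use assms in \<open>auto intro!: open_overlap simp: transition_def overlap_iff\<close>)
  from frechet_derivative_at[OF this] show ?thesis by (metis comp_apply)
qed

lemma Dtrans_refl:
  assumes "c \<in> A" "q \<in> fst c"
  shows "Dtrans c c (snd c q) v = v"
proof -
  have "((\<lambda>x. x) has_derivative (\<lambda>v. v)) (at (snd c q))" by simp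
  then have "(transition c c has_derivative (\<lambda>v. v)) (at (snd c q))"
    by (rule has_derivative_transform_within_open[where s = "patch_domain c"])
      (use assms chart in \<open>auto simp: transition_def\<close>)
  from frechet_derivative_at[OF this] show ?thesis by metis
qed

lemma cotangent_bundleD:
  assumes "z \<in> cotangent_bundle A" "c \<in> A" "d \<in> A" "fst z \<in> fst c" "fst z \<in> fst d"
  shows "snd z c \<bullet> v = snd z d \<bullet> Dtrans c d (snd c (fst z)) v"
proof -
  have *: "\<forall>c\<in>A. \<forall>d\<in>A. fst z \<in> fst c \<inter> fst d \<longrightarrow>
      (\<forall>v. snd z c \<bullet> v = snd z d \<bullet> Dtrans c d (snd c (fst z)) v)"
    using assms(1) unfolding cotangent_bundle_def mem_Collect_eq case_prod_unfold by (rule conjunct2)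
  show ?thesis
    by (rule spec[OF mp[OF bspec[OF bspec[OF * assms(2)] assms(3)] IntI[OF assms(4,5)]]])
qed

text \<open>The witness that cotangent charts are onto: one component is prescribed and the
  transformation law dictates the rest.\<close>

definition covector_lift :: "('m, 'n) chart \<Rightarrow> (real^'n) \<times> (real^'n) \<Rightarrow> ('m, 'n) covector" where
  "covector_lift c = (\<lambda>(p, x). (patch c x, \<lambda>d. if d \<in> A \<and> patch c x \<in> fst d
     then adjoint (Dtrans d c (snd d (patch c x))) p else 0))"

lemma covector_lift:
  assumes c: "c \<in> A" and x: "x \<in> patch_domain c"
  shows "covector_lift c (p, x) \<in> cotangent_over A c" "cot_chart c (covector_lift c (p, x)) = (p, x)"
proof -
  let ?q = "patch c x"
  have q: "?q \<in> fst c" using assms by simp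
  have adj: "adjoint (Dtrans d c (snd d ?q)) p \<bullet> v = p \<bullet> Dtrans d c (snd d ?q) v"
    if "d \<in> A" "?q \<in> fst d" for d v
    using adjoint_works[of "Dtrans d c (snd d ?q)" v p]
      has_derivative_linear[OF has_derivative_transition[of d c "snd d ?q"]] that c q
    by (simp add: inner_commute)
  define \<xi> where "\<xi> = (\<lambda>d. if d \<in> A \<and> ?q \<in> fst d then adjoint (Dtrans d c (snd d ?q)) p else 0)"
  have lift: "covector_lift c (p, x) = (?q, \<xi>)" by (simp add: covector_lift_def \<xi>_def)
  have "(?q, \<xi>) \<in> cotangent_bundle A"
    unfolding cotangent_bundle_def mem_Collect_eq prod.case
  proof (intro conjI allI ballI impI)
    show "\<xi> d = 0" if "\<not> (d \<in> A \<and> ?q \<in> fst d)" for d using that by (auto simp: \<xi>_def)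
    fix d1 d2 v assume d: "d1 \<in> A" "d2 \<in> A" "?q \<in> fst d1 \<inter> fst d2"
    then have \<xi>d: "\<xi> d1 = adjoint (Dtrans d1 c (snd d1 ?q)) p" "\<xi> d2 = adjoint (Dtrans d2 c (snd d2 ?q)) p"
      by (auto simp: \<xi>_def)
    have "Dtrans d1 c (snd d1 ?q) v = Dtrans d2 c (snd d2 ?q) (Dtrans d1 d2 (snd d1 ?q) v)"
      by (rule Dtrans_chain) (use d c q in auto)
    then show "\<xi> d1 \<bullet> v = \<xi> d2 \<bullet> Dtrans d1 d2 (snd d1 ?q) v"
      using d unfolding \<xi>d by (subst (1 2) adj) auto
  qed
  then show "covector_lift c (p, x) \<in> cotangent_over A c"
    unfolding lift cotangent_over_def using q by simp
  have "adjoint (Dtrans c c (snd c ?q)) p \<bullet> v = p \<bullet> v" for v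
    unfolding adj[OF c q] Dtrans_refl[OF c q] ..
  then have "adjoint (Dtrans c c (snd c ?q)) p = p"
    by (metis vector_eq_rdot)
  then show "cot_chart c (covector_lift c (p, x)) = (p, x)"
    using assms q by (simp add: cot_chart_def covector_lift_def)
qed

lemma cot_chart_bij:
  assumes "c \<in> A"
  shows "bij_betw (cot_chart c) (cotangent_over A c) (UNIV \<times> patch_domain c)"
  unfolding bij_betw_def
proof
  show "inj_on (cot_chart c) (cotangent_over A c)" by (rule inj_on_cot_chart[OF smooth assms])
  show "cot_chart c ` cotangent_over A c = UNIV \<times> patch_domain c"
  proof safe
    fix p x assume "x \<in> patch_domain c"
    then show "(p, x) \<in> cot_chart c ` cotangent_over A c"
      using covector_lift[OF assms, of x p] by (metis image_eqI)
  qed (auto simp: cot_chart_def cotangent_over_def)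
qed

lemma cot_patch_chart [simp]: "c \<in> A \<Longrightarrow> z \<in> cotangent_over A c \<Longrightarrow> cot_patch A c (cot_chart c z) = z"
  unfolding cot_patch_def using inj_on_cot_chart[OF smooth] by (rule inv_into_f_f)

lemma cot_chart_patch [simp]: "c \<in> A \<Longrightarrow> snd \<zeta> \<in> patch_domain c \<Longrightarrow> cot_chart c (cot_patch A c \<zeta>) = \<zeta>"
  unfolding cot_patch_def
  by (rule f_inv_into_f) (simp add: bij_betw_imp_surj_on[OF cot_chart_bij] mem_Times_iff)

lemma cot_patch_in_over [simp]: "c \<in> A \<Longrightarrow> snd \<zeta> \<in> patch_domain c \<Longrightarrow> cot_patch A c \<zeta> \<in> cotangent_over A c"
  unfolding cot_patch_def
  by (rule inv_into_into) (simp add: bij_betw_imp_surj_on[OF cot_chart_bij] mem_Times_iff)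

lemma cotangent_overD: "z \<in> cotangent_over A c \<Longrightarrow> fst z \<in> fst c" "z \<in> cotangent_over A c \<Longrightarrow> z \<in> cotangent_bundle A"
  by (auto simp: cotangent_over_def)

lemma fst_cot_patch: "c \<in> A \<Longrightarrow> snd \<zeta> \<in> patch_domain c \<Longrightarrow> fst (cot_patch A c \<zeta>) = patch c (snd \<zeta>)"
  using cot_chart_patch[of c \<zeta>] cotangent_overD(1)[OF cot_patch_in_over[of c \<zeta>]]
  by (metis cot_chart_def patch_chart snd_conv)

lemma zero_covector_in_over: "q \<in> fst c \<Longrightarrow> zero_covector q \<in> cotangent_over A c"
  by (simp add: zero_covector_def cotangent_over_def cotangent_bundle_def)

lemma cot_patch_zero: "c \<in> A \<Longrightarrow> x \<in> patch_domain c \<Longrightarrow> cot_patch A c (0, x) = zero_covector (patch c x)"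
  using cot_patch_chart[of c "zero_covector (patch c x)"] zero_covector_in_over[of "patch c x" c]
  by (simp add: cot_chart_def zero_covector_def)

lemma openin_cot_imp_open: "openin (cotangent_topology A) W \<Longrightarrow> c \<in> A \<Longrightarrow> open (cot_chart c ` (W \<inter> cotangent_over A c))"
  using openin_cotangent_topology[OF smooth] by blast

text \<open>Continuity of the bundle projection; it keeps an integral curve over one chart for a
  short time.\<close>

lemma openin_cot_over_base:
  assumes "open W"
  shows "openin (cotangent_topology A) {z \<in> cotangent_bundle A. fst z \<in> W}"
  unfolding openin_cotangent_topology[OF smooth]
proof (intro conjI ballI)
  fix d assume d: "d \<in> A"
  have "cot_chart d ` ({z \<in> cotangent_bundle A. fst z \<in> W} \<inter> cotangent_over A d) = UNIV \<times> snd d ` (W \<inter> fst d)"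
    (is "?L = ?R")
  proof
    show "?L \<subseteq> ?R" by (auto simp: cot_chart_def cotangent_over_def)
    show "?R \<subseteq> ?L"
    proof safe
      fix p q assume q: "q \<in> W" "q \<in> fst d"
      have over: "cot_patch A d (p, snd d q) \<in> cotangent_over A d" by (rule cot_patch_in_over) (use q d in auto)
      have "fst (cot_patch A d (p, snd d q)) = q" by (subst fst_cot_patch) (use q d in auto)
      with over q have mem: "cot_patch A d (p, snd d q) \<in> {z \<in> cotangent_bundle A. fst z \<in> W} \<inter> cotangent_over A d"
        using cotangent_overD(2)[OF over] by simp
      show "(p, snd d q) \<in> ?L"
        by (rule image_eqI[OF _ mem]) (use q d in simp)
    qed
  qed
  then show "open (cot_chart d ` ({z \<in> cotangent_bundle A. fst z \<in> W} \<inter> cotangent_over A d))"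
    using open_chart_image[OF d open_Int[OF assms chart(1)[OF d]]] by (simp add: open_Times)
qed auto

lemma topspace_cotangent_topology [simp]: "topspace (cotangent_topology A) = cotangent_bundle A"
proof (rule subset_antisym)
  show "topspace (cotangent_topology A) \<subseteq> cotangent_bundle A"
    using openin_cotangent_topology[OF smooth] openin_topspace by blast
  show "cotangent_bundle A \<subseteq> topspace (cotangent_topology A)"
    using openin_subset[OF openin_cot_over_base[OF open_UNIV]] by simp
qed

text \<open>Open sets of the bundle have open chart images, and on the chart domain these images are
  the preimages under the patch. Curves and neighbourhoods can thus be moved between chart and
  bundle.\<close>

lemma continuous_map_cot_patch:
  assumes c: "c \<in> A"
  shows "continuous_map (top_of_set (UNIV \<times> patch_domain c)) (cotangent_topology A) (cot_patch A c)"
  unfolding continuous_map_def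
proof (intro conjI allI impI)
  let ?U = "UNIV \<times> patch_domain c :: ((real^'n) \<times> (real^'n)) set"
  have over: "cot_patch A c \<zeta> \<in> cotangent_over A c" "cot_chart c (cot_patch A c \<zeta>) = \<zeta>" if "\<zeta> \<in> ?U" for \<zeta>
    using that c by (auto simp: mem_Times_iff)
  show "cot_patch A c \<in> topspace (top_of_set ?U) \<rightarrow> topspace (cotangent_topology A)"
    using cotangent_overD(2)[OF over(1)] by simp
  fix W assume W: "openin (cotangent_topology A) W"
  have "cot_patch A c \<zeta> \<in> W \<longleftrightarrow> \<zeta> \<in> cot_chart c ` (W \<inter> cotangent_over A c)" if "\<zeta> \<in> ?U" for \<zeta>
  proof
    assume "cot_patch A c \<zeta> \<in> W"
    then show "\<zeta> \<in> cot_chart c ` (W \<inter> cotangent_over A c)"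
      using over[OF that] by (intro image_eqI[of _ _ "cot_patch A c \<zeta>"]) auto
  next
    assume "\<zeta> \<in> cot_chart c ` (W \<inter> cotangent_over A c)"
    then obtain z where "\<zeta> = cot_chart c z" "z \<in> W" "z \<in> cotangent_over A c" by blast
    then show "cot_patch A c \<zeta> \<in> W" using c by simp
  qed
  then have "{\<zeta> \<in> topspace (top_of_set ?U). cot_patch A c \<zeta> \<in> W} = ?U \<inter> cot_chart c ` (W \<inter> cotangent_over A c)"
    unfolding topspace_euclidean_subtopology by blast
  then show "openin (top_of_set ?U) {\<zeta> \<in> topspace (top_of_set ?U). cot_patch A c \<zeta> \<in> W}"
    using openin_cot_imp_open[OF W c] by (simp add: openin_open_Int)
qed

section \<open>Transition maps of the cotangent bundle\<close>

definition cot_trans :: "('m, 'n) chart \<Rightarrow> ('m, 'n) chart \<Rightarrow> (real^'n) \<times> (real^'n) \<Rightarrow> (real^'n) \<times> (real^'n)" where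
  "cot_trans c d \<zeta> = cot_chart d (cot_patch A c \<zeta>)"

context
  fixes c d assumes c: "c \<in> A" and d: "d \<in> A"
begin

lemma cot_patch_in_over2: "snd \<zeta> \<in> overlap c d \<Longrightarrow> cot_patch A c \<zeta> \<in> cotangent_over A d"
  using c d cot_patch_in_over[of c \<zeta>] by (auto simp: cotangent_over_def overlap_iff fst_cot_patch)

lemma snd_cot_trans: "snd \<zeta> \<in> overlap c d \<Longrightarrow> snd (cot_trans c d \<zeta>) = transition c d (snd \<zeta>)"
  using c d by (auto simp: cot_trans_def cot_chart_def fst_cot_patch overlap_iff transition_def)

text \<open>The transformation law in both directions. The first form is the one to differentiate;
  the second determines the new covector explicitly.\<close>

lemma fst_cot_trans_inner:
  assumes "snd \<zeta> \<in> overlap c d"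
  shows "fst (cot_trans c d \<zeta>) \<bullet> Dtrans c d (snd \<zeta>) v = fst \<zeta> \<bullet> v"
    and "fst (cot_trans c d \<zeta>) \<bullet> v = fst \<zeta> \<bullet> Dtrans d c (transition c d (snd \<zeta>)) v"
proof -
  have x: "snd \<zeta> \<in> patch_domain c" "patch c (snd \<zeta>) \<in> fst d" using assms c by (auto simp: overlap_iff)
  have z: "cot_patch A c \<zeta> \<in> cotangent_bundle A" "fst (cot_patch A c \<zeta>) = patch c (snd \<zeta>)"
    and p: "snd (cot_patch A c \<zeta>) c = fst \<zeta>"
    using cot_patch_in_over[OF c x(1)] fst_cot_patch[OF c x(1)] cot_chart_patch[OF c x(1)]
    by (auto simp: cotangent_over_def cot_chart_def dest: arg_cong[of _ _ fst])
  show "fst (cot_trans c d \<zeta>) \<bullet> Dtrans c d (snd \<zeta>) v = fst \<zeta> \<bullet> v"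
    using cotangent_bundleD[OF z(1) c d, of v] x z c by (simp add: cot_trans_def cot_chart_def p)
  show "fst (cot_trans c d \<zeta>) \<bullet> v = fst \<zeta> \<bullet> Dtrans d c (transition c d (snd \<zeta>)) v"
    using cotangent_bundleD[OF z(1) d c, of v] x z c by (simp add: cot_trans_def cot_chart_def p transition_def)
qed

lemma cot_trans_Ck: "Ck_on k (UNIV \<times> overlap c d) (cot_trans c d)"
proof -
  have o: "open (UNIV \<times> overlap c d :: ((real^'n) \<times> (real^'n)) set)"
    using open_overlap[OF c d] by (auto intro: open_Times)
  have t: "Ck_on k (UNIV \<times> overlap c d) (\<lambda>\<zeta> :: (real^'n) \<times> (real^'n). transition c d (snd \<zeta>))" for k
    by (rule Ck_on_compose[OF o transition_Ck[OF c d]]) (auto simp del: Ck_on.simps intro!: Ck_on_snd o)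
  have D: "Ck_on k (UNIV \<times> overlap c d)
      (\<lambda>\<zeta> :: (real^'n) \<times> (real^'n). Dtrans d c (transition c d (snd \<zeta>)) v)" for v
    by (rule Ck_on_frechet_derivative_apply[OF o transition_Ck[OF d c] t])
      (use transition_in_overlap[OF c d] in auto)
  have "Ck_on k (UNIV \<times> overlap c d)
      (\<lambda>\<zeta>. ((\<chi> i. fst \<zeta> \<bullet> Dtrans d c (transition c d (snd \<zeta>)) (axis i 1)), transition c d (snd \<zeta>)))"
    by (intro Ck_on_Pair Ck_on_vec Ck_on_inner D t o Ck_on_fst Ck_on_ident)
  moreover have "cot_trans c d \<zeta> =
      ((\<chi> i. fst \<zeta> \<bullet> Dtrans d c (transition c d (snd \<zeta>)) (axis i 1)), transition c d (snd \<zeta>))"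
    if "\<zeta> \<in> UNIV \<times> overlap c d" for \<zeta>
  proof (rule prod_eqI)
    have x: "snd \<zeta> \<in> overlap c d" using that by auto
    show "snd (cot_trans c d \<zeta>) = snd ((\<chi> i. fst \<zeta> \<bullet> Dtrans d c (transition c d (snd \<zeta>)) (axis i 1)), transition c d (snd \<zeta>))"
      by (simp add: snd_cot_trans[OF x])
    show "fst (cot_trans c d \<zeta>) = fst ((\<chi> i. fst \<zeta> \<bullet> Dtrans d c (transition c d (snd \<zeta>)) (axis i 1)), transition c d (snd \<zeta>))"
      using fst_cot_trans_inner(2)[OF x, of "axis i 1" for i] by (simp add: vec_eq_iff inner_axis)
  qed
  ultimately show ?thesis
    by (subst Ck_on_cong[OF o])
qed

text \<open>Differentiating the pairing identity of \<open>fst_cot_trans_inner\<close> expresses the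
  derivative of the covector part. The terms with second derivatives of the transition enter the
  form twice with opposite signs and cancel by symmetry.\<close>

lemma cot_trans_symplectic:
  assumes "snd \<zeta> \<in> overlap c d"
  shows "canonical_form (fderiv (cot_trans c d) \<zeta> a) (fderiv (cot_trans c d) \<zeta> b) =
    canonical_form a b"
proof -
  let ?\<Phi> = "cot_trans c d" and ?x = "snd \<zeta>"
  define D where "D = fderiv ?\<Phi> \<zeta>"
  have o: "open (UNIV \<times> overlap c d :: ((real^'n) \<times> (real^'n)) set)" "\<zeta> \<in> UNIV \<times> overlap c d"
    using open_overlap[OF c d] assms by (auto intro: open_Times simp: mem_Times_iff)
  have \<Phi>: "(?\<Phi> has_derivative D) (at \<zeta>)"
    unfolding D_def by (rule Ck_on_has_derivative[OF cot_trans_Ck o(2)])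
  define D2 where "D2 v = fderiv (\<lambda>x. Dtrans c d x v) ?x" for v
  have D2: "((\<lambda>x. Dtrans c d x v) has_derivative D2 v) (at ?x)" for v
    unfolding D2_def using transition_Ck[OF c d, of "Suc (Suc 0)"] assms
    by (auto simp: frechet_derivative_works[symmetric])
  have snd: "snd (D b) = Dtrans c d ?x (snd b)" for b
  proof -
    have "((\<lambda>\<zeta>. snd (?\<Phi> \<zeta>)) has_derivative (\<lambda>b. snd (D b))) (at \<zeta>)"
      by (rule has_derivative_snd[OF \<Phi>])
    moreover have "((\<lambda>\<zeta> :: (real^'n) \<times> (real^'n). transition c d (snd \<zeta>)) has_derivative (\<lambda>b. Dtrans c d ?x (snd b))) (at \<zeta>)"
      using diff_chain_at[OF has_derivative_snd[OF has_derivative_ident], of "transition c d" "Dtrans c d ?x" \<zeta>]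
        has_derivative_transition[OF c d assms] by (simp add: o_def)
    then have "((\<lambda>\<zeta>. snd (?\<Phi> \<zeta>)) has_derivative (\<lambda>b. Dtrans c d ?x (snd b))) (at \<zeta>)"
      by (rule has_derivative_transform_within_open[OF _ o]) (auto simp: snd_cot_trans)
    ultimately have "(\<lambda>b. snd (D b)) = (\<lambda>b. Dtrans c d ?x (snd b))" by (rule has_derivative_unique)
    then show ?thesis by (rule fun_cong)
  qed
  have key: "fst (D b) \<bullet> Dtrans c d ?x v = fst b \<bullet> v - fst (?\<Phi> \<zeta>) \<bullet> D2 v (snd b)" for b v
  proof -
    have 1: "((\<lambda>\<zeta> :: (real^'n) \<times> (real^'n). Dtrans c d (snd \<zeta>) v) has_derivative (\<lambda>b. D2 v (snd b))) (at \<zeta>)"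
      using diff_chain_at[OF has_derivative_snd[OF has_derivative_ident], of "\<lambda>x. Dtrans c d x v" "D2 v" \<zeta>] D2
      by (simp add: o_def)
    have "((\<lambda>\<zeta>. fst (?\<Phi> \<zeta>) \<bullet> Dtrans c d (snd \<zeta>) v) has_derivative
        (\<lambda>b. fst (?\<Phi> \<zeta>) \<bullet> D2 v (snd b) + fst (D b) \<bullet> Dtrans c d ?x v)) (at \<zeta>)"
      by (rule has_derivative_inner[OF has_derivative_fst[OF \<Phi>] 1])
    moreover have "((\<lambda>\<zeta> :: (real^'n) \<times> (real^'n). fst \<zeta> \<bullet> v) has_derivative (\<lambda>b. fst b \<bullet> v)) (at \<zeta>)"
      by (auto intro!: derivative_eq_intros)
    then have "((\<lambda>\<zeta>. fst (?\<Phi> \<zeta>) \<bullet> Dtrans c d (snd \<zeta>) v) has_derivative (\<lambda>b. fst b \<bullet> v)) (at \<zeta>)"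
      by (rule has_derivative_transform_within_open[OF _ o])
        (rule fst_cot_trans_inner(1)[symmetric], simp add: mem_Times_iff)
    ultimately have "(\<lambda>b. fst (?\<Phi> \<zeta>) \<bullet> D2 v (snd b) + fst (D b) \<bullet> Dtrans c d ?x v) = (\<lambda>b. fst b \<bullet> v)"
      by (rule has_derivative_unique)
    from fun_cong[OF this, of b] show ?thesis by simp
  qed
  have "D2 v w = D2 w v" for v w
    unfolding D2_def
    by (rule second_derivative_symmetric[OF transition_Ck[OF c d] open_overlap[OF c d] assms])
  then show ?thesis
    unfolding D_def[symmetric] canonical_form_def snd key by simp
qed

lemma in_chart_cot_trans:
  assumes "snd \<zeta> \<in> overlap c d"
  shows "in_chart A d H (cot_trans c d \<zeta>) = in_chart A c H \<zeta>"
  using assms cot_patch_in_over2 d by (simp add: in_chart_def cot_trans_def)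

end

lemma cot_trans_inverse:
  assumes "c \<in> A" "d \<in> A" "snd \<zeta> \<in> overlap c d"
  shows "cot_trans d c (cot_trans c d \<zeta>) = \<zeta>"
  using assms cot_patch_in_over2[OF assms] by (simp add: cot_trans_def overlap_iff)

text \<open>An integral curve has to satisfy Hamilton's equations in every chart around its points.
  A symplectic derivative that is onto carries the defining identity along; it is onto because of
  the transition in the opposite direction.\<close>

lemma hamiltonian_vector_cot_trans:
  assumes "c \<in> A" "d \<in> A" "snd \<zeta> \<in> overlap c d"
    and "in_chart A d H differentiable (at (cot_trans c d \<zeta>))"
    and v: "hamiltonian_vector (in_chart A c H) \<zeta> v"
  shows "hamiltonian_vector (in_chart A d H) (cot_trans c d \<zeta>) (fderiv (cot_trans c d) \<zeta> v)"
proof -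
  let ?\<Phi> = "cot_trans c d" and ?\<Psi> = "cot_trans d c" and ?U = "UNIV \<times> overlap c d" and ?V = "UNIV \<times> overlap d c"
  let ?D = "fderiv ?\<Phi> \<zeta>" and ?E = "fderiv ?\<Psi> (?\<Phi> \<zeta>)"
  have \<zeta>: "\<zeta> \<in> ?U" "?\<Phi> \<zeta> \<in> ?V"
    using assms transition_in_overlap[OF assms(1-3)] by (auto simp: mem_Times_iff snd_cot_trans)
  have o: "open (?U :: ((real^'n) \<times> (real^'n)) set)" "open (?V :: ((real^'n) \<times> (real^'n)) set)"
    using open_overlap[OF assms(1,2)] open_overlap[OF assms(2,1)] by (auto intro: open_Times)
  have \<Phi>: "(?\<Phi> has_derivative ?D) (at \<zeta>)" and \<Psi>: "(?\<Psi> has_derivative ?E) (at (?\<Phi> \<zeta>))"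
    by (rule Ck_on_has_derivative[OF cot_trans_Ck[OF assms(1,2)] \<zeta>(1)],
        rule Ck_on_has_derivative[OF cot_trans_Ck[OF assms(2,1)] \<zeta>(2)])
  have "(?\<Phi> \<circ> ?\<Psi> has_derivative ?D \<circ> ?E) (at (?\<Phi> \<zeta>))"
    by (rule diff_chain_at[OF \<Psi>]) (use \<Phi> cot_trans_inverse[OF assms(1-3)] in simp)
  moreover have "(?\<Phi> \<circ> ?\<Psi> has_derivative (\<lambda>v. v)) (at (?\<Phi> \<zeta>))"
    by (rule has_derivative_transform_within_open[OF has_derivative_ident o(2) \<zeta>(2)])
      (use cot_trans_inverse[OF assms(2,1)] in \<open>simp add: mem_Times_iff\<close>)
  ultimately have DE: "?D (?E w) = w" for w
    using has_derivative_unique by (metis comp_apply)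
  have "(in_chart A d H \<circ> ?\<Phi> has_derivative fderiv (in_chart A d H) (?\<Phi> \<zeta>) \<circ> ?D) (at \<zeta>)"
    by (rule diff_chain_at[OF \<Phi>]) (use assms(4) in \<open>simp add: frechet_derivative_works\<close>)
  then have "(in_chart A c H has_derivative fderiv (in_chart A d H) (?\<Phi> \<zeta>) \<circ> ?D) (at \<zeta>)"
    by (rule has_derivative_transform_within_open[OF _ o(1) \<zeta>(1)])
      (use in_chart_cot_trans[OF assms(1,2)] in \<open>simp add: mem_Times_iff\<close>)
  from frechet_derivative_at[OF this]
  have h: "fderiv (in_chart A c H) \<zeta> w = fderiv (in_chart A d H) (?\<Phi> \<zeta>) (?D w)" for w
    by (metis comp_apply)
  show ?thesis
    unfolding hamiltonian_vector_def
  proof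
    fix w
    have "canonical_form (?D v) w = canonical_form v (?E w)"
      using cot_trans_symplectic[OF assms(1-3), of v "?E w"] by (simp add: DE)
    also have "\<dots> = fderiv (in_chart A d H) (?\<Phi> \<zeta>) w"
      using v h[of "?E w"] unfolding hamiltonian_vector_def DE by metis
    finally show "canonical_form (?D v) w = fderiv (in_chart A d H) (?\<Phi> \<zeta>) w" .
  qed
qed

end

section \<open>Hamilton's equations in coordinates\<close>

lemma linear_eq_inner_axis:
  fixes f :: "real^'n \<Rightarrow> real"
  assumes "linear f"
  shows "(\<chi> i. f (axis i 1)) \<bullet> v = f v"
proof -
  have "f v = f (\<Sum>i\<in>UNIV. v $ i *\<^sub>R axis i 1)"
    using basis_expansion[of v] by (simp add: scalar_mult_eq_scaleR)
  also have "\<dots> = (\<Sum>i\<in>UNIV. v $ i * f (axis i 1))"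
    by (simp add: linear_sum[OF assms] linear_cmul[OF assms])
  finally show ?thesis by (simp add: inner_vec_def mult.commute)
qed

lemma gradient_inner:
  assumes "f differentiable (at x)"
  shows "gradient f x \<bullet> v = fderiv f x v"
  unfolding gradient_def by (rule linear_eq_inner_axis[OF linear_frechet_derivative[OF assms]])

lemma gradient_unique:
  assumes "(f has_derivative (\<lambda>v. g \<bullet> v)) (at x)"
  shows "gradient f x = g"
proof -
  have "gradient f x \<bullet> v = g \<bullet> v" for v
    using gradient_inner[of f x v] assms frechet_derivative_at[OF assms]
    by (metis differentiable_def)
  then show ?thesis by (metis vector_eq_rdot)
qed

definition hamiltonian_field ::
  "((real^'n) \<times> (real^'n::finite) \<Rightarrow> real) \<Rightarrow> (real^'n) \<times> (real^'n) \<Rightarrow> (real^'n) \<times> (real^'n)" where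
  "hamiltonian_field h z = ((\<chi> i. fderiv h z (0, axis i 1)),
     - (\<chi> i. fderiv h z (axis i 1, 0)))"

lemma hamiltonian_field_Ck:
  assumes "open Y" "Ck_on (Suc k) Y h"
  shows "Ck_on k Y (hamiltonian_field h)"
  unfolding hamiltonian_field_def
  by (intro Ck_on_Pair Ck_on_minus Ck_on_vec assms) (use assms(2) in auto)

lemma canonical_form_hamiltonian_field:
  assumes "h differentiable (at z)"
  shows "canonical_form (hamiltonian_field h z) w = fderiv h z w"
proof -
  have lin: "linear (fderiv h z)" by (rule linear_frechet_derivative[OF assms])
  have 1: "linear (\<lambda>v. fderiv h z (0, v))" "linear (\<lambda>v. fderiv h z (v, 0))"
    using linear_compose[OF _ lin, of "\<lambda>v. (0, v)"] linear_compose[OF _ lin, of "\<lambda>v. (v, 0)"]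
    by (auto simp: o_def linear_iff)
  have "canonical_form (hamiltonian_field h z) w =
      fderiv h z (0, snd w) + fderiv h z (fst w, 0)"
    using linear_eq_inner_axis[OF 1(1), of "snd w"] linear_eq_inner_axis[OF 1(2), of "fst w"]
    by (simp add: canonical_form_def hamiltonian_field_def inner_commute[of "fst w"])
  also have "\<dots> = fderiv h z ((0, snd w) + (fst w, 0))"
    by (rule linear_add[OF lin, symmetric])
  finally show ?thesis by simp
qed

text \<open>Nondegeneracy of the canonical form, tested on purely horizontal and purely vertical
  vectors.\<close>

lemma hamiltonian_vector_iff:
  assumes "h differentiable (at z)"
  shows "hamiltonian_vector h z v \<longleftrightarrow> v = hamiltonian_field h z"
proof
  assume "hamiltonian_vector h z v"
  then have v: "canonical_form v w = canonical_form (hamiltonian_field h z) w" for w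
    using canonical_form_hamiltonian_field[OF assms] unfolding hamiltonian_vector_def by metis
  have "fst v \<bullet> q = fst (hamiltonian_field h z) \<bullet> q" for q
    using v[of "(0, q)"] by (simp add: canonical_form_def)
  moreover have "snd v \<bullet> p = snd (hamiltonian_field h z) \<bullet> p" for p
    using v[of "(p, 0)"] by (simp add: canonical_form_def inner_commute)
  ultimately show "v = hamiltonian_field h z"
    by (metis prod_eqI vector_eq_rdot)
qed (simp add: hamiltonian_vector_def canonical_form_hamiltonian_field[OF assms])

text \<open>The action \<open>a\<close> is carried along as an additional component of the flow, so that its derivative
  solves the variational equation as well: \<open>\<delta>a - P \<bullet> \<delta>Q\<close> is constant in time because of
  Hamilton's equations.\<close>

lemma local_characteristics:
  fixes h :: "(real^'n) \<times> (real^'n::finite) \<Rightarrow> real"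
  assumes U: "open U" and h: "smooth_on (UNIV \<times> U) h" and x: "x \<in> U"
  obtains \<epsilon> y a where "0 < \<epsilon>" "smooth_on ({-\<epsilon><..<\<epsilon>} \<times> ball (0, x) \<epsilon>) y"
    "\<And>\<zeta>. \<zeta> \<in> ball (0, x) \<epsilon> \<Longrightarrow> y (0, \<zeta>) = \<zeta>" "\<And>\<zeta>. \<zeta> \<in> ball (0, x) \<epsilon> \<Longrightarrow> a (0, \<zeta>) = fst \<zeta> \<bullet> snd \<zeta>"
    "\<And>t \<zeta>. t \<in> {-\<epsilon><..<\<epsilon>} \<Longrightarrow> \<zeta> \<in> ball (0, x) \<epsilon> \<Longrightarrow> snd (y (t, \<zeta>)) \<in> U"
    "\<And>t \<zeta>. t \<in> {-\<epsilon><..<\<epsilon>} \<Longrightarrow> \<zeta> \<in> ball (0, x) \<epsilon> \<Longrightarrow>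
      ((\<lambda>s. y (s, \<zeta>)) has_vector_derivative hamiltonian_field h (y (t, \<zeta>))) (at t)"
    "\<And>t \<zeta>. t \<in> {-\<epsilon><..<\<epsilon>} \<Longrightarrow> \<zeta> \<in> ball (0, x) \<epsilon> \<Longrightarrow> ((\<lambda>s. a (s, \<zeta>)) has_vector_derivative
      h (y (t, \<zeta>)) + fst (y (t, \<zeta>)) \<bullet> snd (hamiltonian_field h (y (t, \<zeta>)))) (at t)"
    "\<And>t \<zeta>. t \<in> {-\<epsilon><..<\<epsilon>} \<Longrightarrow> \<zeta> \<in> ball (0, x) \<epsilon> \<Longrightarrow> (a has_derivative (\<lambda>d. fst d * h (y (t, \<zeta>)) +
      fst (snd d) \<bullet> snd \<zeta> + fst (y (t, \<zeta>)) \<bullet> snd (fderiv y (t, \<zeta>) d))) (at (t, \<zeta>))"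
proof -
  let ?X = "hamiltonian_field h"
  define V where "V = (UNIV \<times> U :: ((real^'n) \<times> (real^'n)) set)"
  have V: "open V" using U by (auto simp: V_def intro: open_Times)
  have hk: "Ck_on k V h" for k using h by (simp add: smooth_on_def V_def)
  have X: "Ck_on k V ?X" for k by (rule hamiltonian_field_Ck[OF V hk])
  define F where "F = (\<lambda>y :: ((real^'n) \<times> (real^'n)) \<times> real. (?X (fst y), h (fst y) + fst (fst y) \<bullet> snd (?X (fst y))))"
  define Y where "Y = V \<times> (UNIV :: real set)"
  have Y: "open Y" using V by (auto simp: Y_def intro: open_Times)
  have fstY: "Ck_on k Y fst" for k by (rule Ck_on_bounded_linear[OF bounded_linear_fst])
  have XY: "Ck_on k Y (\<lambda>y. ?X (fst y))" "Ck_on k Y (\<lambda>y. h (fst y))" for k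
    by (rule Ck_on_compose[OF Y X fstY], simp add: Y_def mem_Times_iff,
        rule Ck_on_compose[OF Y hk fstY], simp add: Y_def mem_Times_iff)
  have F: "smooth_on Y F"
    unfolding smooth_on_def F_def
    by (intro allI Ck_on_Pair Ck_on_add Ck_on_inner Ck_on_snd Ck_on_fst XY fstY Y)
  have z0: "((0, x), 0) \<in> Y" using x by (simp add: Y_def V_def)
  obtain T r \<phi> where \<phi>: "0 < T" "0 < r" "ball ((0, x), 0) r \<subseteq> Y" "smooth_on ({-T<..<T} \<times> ball ((0, x), 0) r) \<phi>"
    "\<And>z. z \<in> ball ((0, x), 0) r \<Longrightarrow> \<phi> (0, z) = z"
    "\<And>t z. t \<in> {-T<..<T} \<Longrightarrow> z \<in> ball ((0, x), 0) r \<Longrightarrow> \<phi> (t, z) \<in> Y"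
    "\<And>t z. t \<in> {-T<..<T} \<Longrightarrow> z \<in> ball ((0, x), 0) r \<Longrightarrow>
      ((\<lambda>s. \<phi> (s, z)) has_vector_derivative F (\<phi> (t, z))) (at t)"
    "\<And>z v. z \<in> ball ((0, x), 0) r \<Longrightarrow> fderiv \<phi> (0, z) (0, v) = v"
    "\<And>t z v. t \<in> {-T<..<T} \<Longrightarrow> z \<in> ball ((0, x), 0) r \<Longrightarrow>
      ((\<lambda>s. fderiv \<phi> (s, z) (0, v)) has_vector_derivative
        fderiv F (\<phi> (t, z)) (fderiv \<phi> (t, z) (0, v))) (at t)"
    by (rule smooth_local_flow[OF Y F z0]) (rule that)
  \<comment> \<open>Initial points are lifted so that the action component starts at p \<bullet> q;
    \<open>De\<close> is the derivative of this lift.\<close>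
  define e where "e \<zeta> = (\<zeta>, fst \<zeta> \<bullet> snd \<zeta>)" for \<zeta> :: "(real^'n) \<times> (real^'n)"
  define De where "De \<zeta> w = (w, fst \<zeta> \<bullet> snd w + fst w \<bullet> snd \<zeta>)" for \<zeta> w :: "(real^'n) \<times> (real^'n)"
  have e: "(e has_derivative De \<zeta>) (at \<zeta>)" for \<zeta>
    unfolding e_def De_def by (auto intro!: derivative_eq_intros)
  have eC: "Ck_on k UNIV e" for k
    unfolding e_def by (intro Ck_on_Pair Ck_on_inner Ck_on_fst Ck_on_snd Ck_on_ident open_UNIV)
  have "open (e -` ball ((0, x), 0) r)"
    by (rule open_vimage) (use Ck_on_imp_continuous_on[OF eC] in auto)
  moreover have "(0, x) \<in> e -` ball ((0, x), 0) r" using \<phi>(2) by (simp add: e_def)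
  ultimately obtain \<delta> where \<delta>: "0 < \<delta>" "ball (0, x) \<delta> \<subseteq> e -` ball ((0, x), 0) r"
    by (meson open_contains_ball)
  define \<epsilon> where "\<epsilon> = min \<delta> T"
  have \<epsilon>: "0 < \<epsilon>" using \<delta> \<phi>(1) by (simp add: \<epsilon>_def)
  have er: "e \<zeta> \<in> ball ((0, x), 0) r" if "\<zeta> \<in> ball (0, x) \<epsilon>" for \<zeta>
    using \<delta>(2) that by (auto simp: \<epsilon>_def)
  have tT: "t \<in> {-T<..<T}" if "t \<in> {-\<epsilon><..<\<epsilon>}" for t
    using that by (auto simp: \<epsilon>_def)
  let ?B = "{-\<epsilon><..<\<epsilon>} \<times> ball (0, x) \<epsilon>"
  have B: "open ?B" by (auto intro!: open_Times)
  define ya where "ya = (\<lambda>z. \<phi> (fst z, e (snd z)))"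
  define y where "y z = fst (ya z)" for z
  define a where "a z = snd (ya z)" for z
  have ya: "Ck_on k ?B ya" for k
    unfolding ya_def
  proof (rule Ck_on_compose[OF B, where Y = "{-T<..<T} \<times> ball ((0, x), 0) r"])
    show "Ck_on k ({-T<..<T} \<times> ball ((0, x), 0) r) \<phi>" using \<phi>(4) by (simp add: smooth_on_def)
    show "Ck_on k ?B (\<lambda>z. (fst z, e (snd z)))"
      by (intro Ck_on_Pair Ck_on_fst Ck_on_compose[OF B eC] Ck_on_snd Ck_on_ident B) auto
  qed (use tT er in auto)
  have y: "smooth_on ?B y" unfolding smooth_on_def y_def by (intro allI Ck_on_fst ya B)
  have yaY: "ya (t, \<zeta>) \<in> Y" if "t \<in> {-\<epsilon><..<\<epsilon>}" "\<zeta> \<in> ball (0, x) \<epsilon>" for t \<zeta>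
    unfolding ya_def fst_conv snd_conv by (rule \<phi>(6)[OF tT[OF that(1)] er[OF that(2)]])
  have yV: "y (t, \<zeta>) \<in> V" if "t \<in> {-\<epsilon><..<\<epsilon>}" "\<zeta> \<in> ball (0, x) \<epsilon>" for t \<zeta>
    using yaY[OF that] by (simp add: y_def Y_def mem_Times_iff)
  have yader: "((\<lambda>s. ya (s, \<zeta>)) has_vector_derivative F (ya (t, \<zeta>))) (at t)"
    if "t \<in> {-\<epsilon><..<\<epsilon>}" "\<zeta> \<in> ball (0, x) \<epsilon>" for t \<zeta>
    using \<phi>(7)[OF tT[OF that(1)] er[OF that(2)]] by (simp add: ya_def)
  have yder: "((\<lambda>s. y (s, \<zeta>)) has_vector_derivative ?X (y (t, \<zeta>))) (at t)"
    if "t \<in> {-\<epsilon><..<\<epsilon>}" "\<zeta> \<in> ball (0, x) \<epsilon>" for t \<zeta>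
    using bounded_linear.has_vector_derivative[OF bounded_linear_fst yader[OF that]]
    by (simp add: y_def F_def)
  have ader: "((\<lambda>s. a (s, \<zeta>)) has_vector_derivative h (y (t, \<zeta>)) + fst (y (t, \<zeta>)) \<bullet> snd (?X (y (t, \<zeta>)))) (at t)"
    if "t \<in> {-\<epsilon><..<\<epsilon>}" "\<zeta> \<in> ball (0, x) \<epsilon>" for t \<zeta>
    using bounded_linear.has_vector_derivative[OF bounded_linear_snd yader[OF that]]
    by (simp add: y_def a_def F_def)
  define \<eta> where "\<eta> \<zeta> w s = fderiv \<phi> (s, e \<zeta>) (0, De \<zeta> w)" for \<zeta> w s
  have \<phi>d: "(\<phi> has_derivative fderiv \<phi> (t, e \<zeta>)) (at (t, e \<zeta>))"
    if "t \<in> {-\<epsilon><..<\<epsilon>}" "\<zeta> \<in> ball (0, x) \<epsilon>" for t \<zeta>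
    by (rule Ck_on_has_derivative[of 0 "{-T<..<T} \<times> ball ((0, x), 0) r"])
      (use \<phi>(4) tT[OF that(1)] er[OF that(2)] in \<open>auto simp: smooth_on_def simp del: Ck_on.simps\<close>)
  have yaD: "(ya has_derivative (\<lambda>d. fst d *\<^sub>R F (ya (t, \<zeta>)) + \<eta> \<zeta> (snd d) t)) (at (t, \<zeta>))"
    if t: "t \<in> {-\<epsilon><..<\<epsilon>}" and \<zeta>: "\<zeta> \<in> ball (0, x) \<epsilon>" for t \<zeta>
  proof -
    let ?D = "fderiv \<phi> (t, e \<zeta>)"
    have 1: "((\<lambda>z. (fst z, e (snd z))) has_derivative (\<lambda>d. (fst d, De \<zeta> (snd d)))) (at (t, \<zeta>))"
      using diff_chain_at[OF has_derivative_snd[OF has_derivative_ident], of e "De \<zeta>" "(t, \<zeta>)"] e[of \<zeta>]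
      by (intro has_derivative_Pair has_derivative_fst has_derivative_ident) (simp add: o_def)
    have ya1: "(ya has_derivative (\<lambda>d. ?D (fst d, De \<zeta> (snd d)))) (at (t, \<zeta>))"
      using diff_chain_at[OF 1, of \<phi> ?D] \<phi>d[OF t \<zeta>] by (simp add: ya_def o_def)
    have lin: "linear ?D" by (rule has_derivative_linear[OF \<phi>d[OF t \<zeta>]])
    \<comment> \<open>In the time direction the derivative of the flow is the vector field itself;
      together with the variational part \<eta> this gives the full differential of
      \<open>ya\<close>.\<close>
    have "((\<lambda>s. \<phi> ((t, e \<zeta>) + s *\<^sub>R (1, 0))) has_vector_derivative ?D (1, 0)) (at 0)"
      by (rule has_vector_derivative_along_line) (use \<phi>d[OF t \<zeta>] in \<open>auto simp: differentiable_def\<close>)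
    moreover have "((\<lambda>s. t + s) has_vector_derivative 1) (at 0)"
      by (auto intro!: derivative_eq_intros simp: has_real_derivative_iff_has_vector_derivative[symmetric])
    then have "((\<lambda>s. \<phi> ((t, e \<zeta>) + s *\<^sub>R (1, 0))) has_vector_derivative 1 *\<^sub>R F (ya (t, \<zeta>))) (at 0)"
      using vector_diff_chain_at[of "\<lambda>s. t + s" 1 0 "\<lambda>s. \<phi> (s, e \<zeta>)" "F (ya (t, \<zeta>))"] yader[OF t \<zeta>]
      by (simp add: o_def ya_def)
    ultimately have D1: "?D (1, 0) = F (ya (t, \<zeta>))"
      by (simp add: vector_derivative_unique_at)
    have "?D (\<tau>, De \<zeta> w) = \<tau> *\<^sub>R F (ya (t, \<zeta>)) + \<eta> \<zeta> w t" for \<tau> w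
      using linear_add[OF lin, of "\<tau> *\<^sub>R (1, 0)" "(0, De \<zeta> w)"] linear_cmul[OF lin, of \<tau> "(1, 0)"]
      by (simp add: D1 \<eta>_def)
    then show ?thesis using ya1 by simp
  qed
  have \<eta>a: "snd (\<eta> \<zeta> w t) = fst w \<bullet> snd \<zeta> + fst (y (t, \<zeta>)) \<bullet> snd (fst (\<eta> \<zeta> w t))"
    if t: "t \<in> {-\<epsilon><..<\<epsilon>}" and \<zeta>: "\<zeta> \<in> ball (0, x) \<epsilon>" for t \<zeta> w
  proof -
    define c where "c s = snd (\<eta> \<zeta> w s) - fst (y (s, \<zeta>)) \<bullet> snd (fst (\<eta> \<zeta> w s))" for s
    have "(c has_vector_derivative 0) (at s)" if s: "s \<in> {-\<epsilon><..<\<epsilon>}" for s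
    proof -
      let ?z = "y (s, \<zeta>)" and ?v = "fst (\<eta> \<zeta> w s)"
      have zV: "?z \<in> V" by (rule yV[OF s \<zeta>])
      have FD: "(F has_derivative (\<lambda>d. (fderiv ?X ?z (fst d), fderiv h ?z (fst d) +
          (fst ?z \<bullet> snd (fderiv ?X ?z (fst d)) + fst (fst d) \<bullet> snd (?X ?z))))) (at (ya (s, \<zeta>)))"
      proof -
        have X1: "((\<lambda>y :: _ \<times> real. ?X (fst y)) has_derivative (\<lambda>d. fderiv ?X ?z (fst d))) (at (ya (s, \<zeta>)))"
          using diff_chain_at[OF has_derivative_fst[OF has_derivative_ident], of ?X _ "ya (s, \<zeta>)"]
            Ck_on_has_derivative[OF X zV] by (simp add: o_def y_def)
        have h1: "((\<lambda>y :: _ \<times> real. h (fst y)) has_derivative (\<lambda>d. fderiv h ?z (fst d))) (at (ya (s, \<zeta>)))"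
          using diff_chain_at[OF has_derivative_fst[OF has_derivative_ident], of h _ "ya (s, \<zeta>)"]
            Ck_on_has_derivative[OF hk zV] by (simp add: o_def y_def)
        show ?thesis
          unfolding F_def y_def
          by (rule has_derivative_Pair[OF X1 has_derivative_add[OF h1 has_derivative_inner[OF
                has_derivative_fst[OF has_derivative_fst[OF has_derivative_ident]]
                has_derivative_snd[OF X1]]], unfolded y_def])
      qed
      have "((\<lambda>s. \<eta> \<zeta> w s) has_vector_derivative fderiv F (ya (s, \<zeta>)) (\<eta> \<zeta> w s)) (at s)"
        using \<phi>(9)[OF tT[OF s] er[OF \<zeta>], of "De \<zeta> w"] by (simp add: \<eta>_def ya_def)
      then have \<eta>d: "((\<lambda>s. \<eta> \<zeta> w s) has_vector_derivative (fderiv ?X ?z ?v, fderiv h ?z ?v +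
          (fst ?z \<bullet> snd (fderiv ?X ?z ?v) + fst ?v \<bullet> snd (?X ?z)))) (at s)"
        unfolding frechet_derivative_at[OF FD, symmetric] .
      have 1: "((\<lambda>s. snd (\<eta> \<zeta> w s)) has_vector_derivative fderiv h ?z ?v +
          (fst ?z \<bullet> snd (fderiv ?X ?z ?v) + fst ?v \<bullet> snd (?X ?z))) (at s)"
        using bounded_linear.has_vector_derivative[OF bounded_linear_snd \<eta>d] by simp
      have 2: "((\<lambda>s. snd (fst (\<eta> \<zeta> w s))) has_vector_derivative snd (fderiv ?X ?z ?v)) (at s)"
        using bounded_linear.has_vector_derivative[OF bounded_linear_snd
            bounded_linear.has_vector_derivative[OF bounded_linear_fst \<eta>d]] by simp
      have 3: "((\<lambda>s. fst (y (s, \<zeta>))) has_vector_derivative fst (?X ?z)) (at s)"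
        by (rule bounded_linear.has_vector_derivative[OF bounded_linear_fst yder[OF s \<zeta>]])
      \<comment> \<open>The defining equation of the hamiltonian field, evaluated on the variation;
        it cancels the derivative of c.\<close>
      have 4: "fderiv h ?z ?v = fst (?X ?z) \<bullet> snd ?v - fst ?v \<bullet> snd (?X ?z)"
        using canonical_form_hamiltonian_field[of h ?z ?v] hk[of 1] zV by (simp add: canonical_form_def)
      have "(c has_vector_derivative
          (fderiv h ?z ?v + (fst ?z \<bullet> snd (fderiv ?X ?z ?v) + fst ?v \<bullet> snd (?X ?z))) -
          (fst ?z \<bullet> snd (fderiv ?X ?z ?v) + fst (?X ?z) \<bullet> snd ?v)) (at s)"
        unfolding c_def
        by (intro has_vector_derivative_diff 1 bounded_bilinear.has_vector_derivative[OF bounded_bilinear_inner 3 2])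
      then show ?thesis by (simp add: 4)
    qed
    then have "c t = c 0"
      using has_derivative_zero_unique[of "{-\<epsilon><..<\<epsilon>}" c t 0] t \<epsilon>
      by (auto simp: has_vector_derivative_def has_derivative_at_withinI)
    \<comment> \<open>At time 0 the variation of p \<bullet> q, less p paired with the variation of
      q, leaves q paired with the variation of p.\<close>
    also have "\<dots> = fst w \<bullet> snd \<zeta>"
      using \<phi>(8)[OF er[OF \<zeta>], of "De \<zeta> w"] \<phi>(5)[OF er[OF \<zeta>]]
      by (simp add: c_def \<eta>_def y_def ya_def De_def e_def)
    finally show ?thesis by (simp add: c_def)
  qed
  show thesis
  proof (rule that[of \<epsilon> y a])
    show "y (0, \<zeta>) = \<zeta>" "a (0, \<zeta>) = fst \<zeta> \<bullet> snd \<zeta>" if "\<zeta> \<in> ball (0, x) \<epsilon>" for \<zeta>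
      using \<phi>(5)[OF er[OF that]] by (simp_all add: y_def a_def ya_def e_def)
    show "snd (y (t, \<zeta>)) \<in> U" if "t \<in> {-\<epsilon><..<\<epsilon>}" "\<zeta> \<in> ball (0, x) \<epsilon>" for t \<zeta>
      using yV[OF that] by (simp add: V_def mem_Times_iff)
    show "(a has_derivative (\<lambda>d. fst d * h (y (t, \<zeta>)) + fst (snd d) \<bullet> snd \<zeta> +
        fst (y (t, \<zeta>)) \<bullet> snd (fderiv y (t, \<zeta>) d))) (at (t, \<zeta>))"
      if t: "t \<in> {-\<epsilon><..<\<epsilon>}" and \<zeta>: "\<zeta> \<in> ball (0, x) \<epsilon>" for t \<zeta>
    proof -
      have "(y has_derivative (\<lambda>d. fst (fst d *\<^sub>R F (ya (t, \<zeta>)) + \<eta> \<zeta> (snd d) t))) (at (t, \<zeta>))"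
        unfolding y_def by (rule has_derivative_fst[OF yaD[OF t \<zeta>]])
      note yd = frechet_derivative_at[OF this, symmetric]
      have "(a has_derivative (\<lambda>d. snd (fst d *\<^sub>R F (ya (t, \<zeta>)) + \<eta> \<zeta> (snd d) t))) (at (t, \<zeta>))"
        unfolding a_def by (rule has_derivative_snd[OF yaD[OF t \<zeta>]])
      then show ?thesis
        unfolding yd by (rule has_derivative_eq_rhs)
          (simp add: \<eta>a[OF t \<zeta>] fun_eq_iff F_def y_def inner_add_right distrib_left)
    qed
  qed (use \<epsilon> y yder ader in auto)
qed

section \<open>The hamiltonian flow near the zero section\<close>

lemma isCont_real_near:
  fixes f :: "real \<Rightarrow> 'a::metric_space"
  assumes "isCont f t" "0 < R"
  obtains e where "0 < e" "\<And>s. \<bar>s - t\<bar> < e \<Longrightarrow> dist (f s) (f t) < R"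
  using assms by (auto simp: continuous_at_eps_delta dist_real_def)

locale hamiltonian_system = smooth_manifold A
  for A :: "('m::{t2_space, second_countable_topology}, 'n::finite) chart set" +
  fixes H :: "('m, 'n) covector \<Rightarrow> real"
  assumes ham: "smooth_hamiltonian A H"
begin

lemma open_cot_domain: "d \<in> A \<Longrightarrow> open (UNIV \<times> patch_domain d :: ((real^'n) \<times> (real^'n)) set)"
  using chart(2)[of d] by (auto intro: open_Times)

lemma in_chart_Ck: "d \<in> A \<Longrightarrow> Ck_on k (UNIV \<times> patch_domain d) (in_chart A d H)"
  using ham by (simp add: smooth_hamiltonian_def smooth_on_def)

lemma in_chart_differentiable: "d \<in> A \<Longrightarrow> snd \<zeta> \<in> patch_domain d \<Longrightarrow> in_chart A d H differentiable (at \<zeta>)"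
  using in_chart_Ck[of d 1] by (cases \<zeta>) auto

abbreviation field :: "('m, 'n) chart \<Rightarrow> (real^'n) \<times> (real^'n) \<Rightarrow> (real^'n) \<times> (real^'n)" where
  "field d \<equiv> hamiltonian_field (in_chart A d H)"

lemma field_Ck: "d \<in> A \<Longrightarrow> Ck_on k (UNIV \<times> patch_domain d) (field d)"
  by (rule hamiltonian_field_Ck[OF open_cot_domain in_chart_Ck])

section \<open>Integral curves: uniqueness and construction from a chart\<close>

lemma integral_curve_near:
  assumes \<gamma>: "integral_curve A H I \<gamma>" and "t \<in> I" "open W" "fst (\<gamma> t) \<in> W"
  obtains e where "0 < e" "\<And>s. \<bar>s - t\<bar> < e \<Longrightarrow> s \<in> I \<and> \<gamma> s \<in> cotangent_bundle A \<and> fst (\<gamma> s) \<in> W"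
proof -
  have I: "open I" and cm: "continuous_map (top_of_set I) (cotangent_topology A) \<gamma>"
    using \<gamma> by (auto simp: integral_curve_def)
  have "openin (top_of_set I) {s \<in> topspace (top_of_set I). \<gamma> s \<in> {z \<in> cotangent_bundle A. fst z \<in> W}}"
    by (rule openin_continuous_map_preimage[OF cm openin_cot_over_base[OF assms(3)]])
  then have o: "open {s \<in> I. \<gamma> s \<in> {z \<in> cotangent_bundle A. fst z \<in> W}}"
    using I by (simp add: openin_open_eq)
  have "\<gamma> t \<in> cotangent_bundle A"
    using cm assms(2) by (auto simp: continuous_map_def)
  then have "t \<in> {s \<in> I. \<gamma> s \<in> {z \<in> cotangent_bundle A. fst z \<in> W}}"
    using assms by auto
  then obtain e where e: "0 < e" "ball t e \<subseteq> {s \<in> I. \<gamma> s \<in> {z \<in> cotangent_bundle A. fst z \<in> W}}"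
    using o unfolding open_contains_ball by blast
  show thesis
  proof (rule that[OF e(1)])
    fix s assume "\<bar>s - t\<bar> < e"
    then have "s \<in> ball t e" by (simp add: dist_real_def abs_minus_commute)
    then show "s \<in> I \<and> \<gamma> s \<in> cotangent_bundle A \<and> fst (\<gamma> s) \<in> W" using e(2) by blast
  qed
qed

lemma integral_curve_chart:
  assumes "integral_curve A H I \<gamma>" "t \<in> I" "d \<in> A" "fst (\<gamma> t) \<in> fst d"
  shows "((\<lambda>s. cot_chart d (\<gamma> s)) has_vector_derivative field d (cot_chart d (\<gamma> t))) (at t)"
proof -
  obtain v where v: "hamiltonian_vector (in_chart A d H) (cot_chart d (\<gamma> t)) v"
    "((\<lambda>s. cot_chart d (\<gamma> s)) has_vector_derivative v) (at t)"
    using assms unfolding integral_curve_def by blast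
  have "in_chart A d H differentiable (at (cot_chart d (\<gamma> t)))"
    by (rule in_chart_differentiable) (use assms in \<open>auto simp: cot_chart_def\<close>)
  then show ?thesis using v hamiltonian_vector_iff by metis
qed

text \<open>Near a common point both curves run over one chart, where the field is Lipschitz on a
  closed ball; uniqueness is applied to the difference of their coordinates.\<close>

lemma integral_curves_agree_near:
  assumes \<gamma>: "integral_curve A H I \<gamma>" "integral_curve A H I' \<gamma>'" and t: "t \<in> I" "t \<in> I'" "\<gamma> t = \<gamma>' t"
  obtains e where "0 < e" "\<And>s. \<bar>s - t\<bar> < e \<Longrightarrow> \<gamma> s = \<gamma>' s"
proof -
  have "(\<Union>d\<in>A. fst d) = UNIV" using smooth by (simp add: smooth_structure_def)
  then obtain d where d: "d \<in> A" "fst (\<gamma> t) \<in> fst d" by blast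
  obtain e1 where e1: "0 < e1" "\<And>s. \<bar>s - t\<bar> < e1 \<Longrightarrow> s \<in> I \<and> \<gamma> s \<in> cotangent_bundle A \<and> fst (\<gamma> s) \<in> fst d"
    by (rule integral_curve_near[OF \<gamma>(1) t(1) chart(1)[OF d(1)] d(2)]) blast
  have d': "fst (\<gamma>' t) \<in> fst d" using d t by simp
  obtain e2 where e2: "0 < e2" "\<And>s. \<bar>s - t\<bar> < e2 \<Longrightarrow> s \<in> I' \<and> \<gamma>' s \<in> cotangent_bundle A \<and> fst (\<gamma>' s) \<in> fst d"
    by (rule integral_curve_near[OF \<gamma>(2) t(2) chart(1)[OF d(1)] d']) blast
  define y where "y s = cot_chart d (\<gamma> s)" for s
  define y' where "y' s = cot_chart d (\<gamma>' s)" for s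
  have "y t \<in> UNIV \<times> patch_domain d" using d(2) by (simp add: y_def cot_chart_def)
  then obtain R where R: "0 < R" "cball (y t) R \<subseteq> UNIV \<times> patch_domain d"
    using open_cot_domain[OF d(1)] open_contains_cball by metis
  obtain L where L: "0 \<le> L" "\<And>z z'. z \<in> cball (y t) R \<Longrightarrow> z' \<in> cball (y t) R \<Longrightarrow>
      norm (field d z' - field d z) \<le> L * norm (z' - z)"
    using Ck_on_compact_imp_lipschitz[OF field_Ck[OF d(1)] _ _ R(2)] compact_cball convex_cball by metis
  have yd: "(y has_vector_derivative field d (y s)) (at s)" if "\<bar>s - t\<bar> < e1" for s
    unfolding y_def by (rule integral_curve_chart[OF \<gamma>(1) _ d(1)]) (use e1(2)[OF that] in auto)
  have yd': "(y' has_vector_derivative field d (y' s)) (at s)" if "\<bar>s - t\<bar> < e2" for s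
    unfolding y'_def by (rule integral_curve_chart[OF \<gamma>(2) _ d(1)]) (use e2(2)[OF that] in auto)
  have eq: "y' t = y t" by (simp add: y_def y'_def t)
  have "isCont y t" "isCont y' t"
    using has_vector_derivative_continuous[OF yd[of t]] has_vector_derivative_continuous[OF yd'[of t]] e1 e2
    by simp_all
  note cont = this
  obtain e3 where e3: "0 < e3" "\<And>s. \<bar>s - t\<bar> < e3 \<Longrightarrow> dist (y s) (y t) < R"
    using isCont_real_near[OF cont(1) R(1)] by blast
  obtain e4 where e4: "0 < e4" "\<And>s. \<bar>s - t\<bar> < e4 \<Longrightarrow> dist (y' s) (y' t) < R"
    using isCont_real_near[OF cont(2) R(1)] by blast
  define e where "e = min (min e1 e2) (min (min e3 e4) (1 / (2 * (L + 1))))"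
  have e: "0 < e" using e1 e2 e3 e4 L(1) by (simp add: e_def)
  have Le: "L * e \<le> 1/2"
  proof -
    have "L * e \<le> L * (1 / (2 * (L + 1)))" using L(1) by (intro mult_left_mono) (auto simp: e_def)
    also have "\<dots> \<le> 1/2" using L(1) by (auto simp: field_simps)
    finally show ?thesis .
  qed
  show thesis
  proof (rule that[OF e])
    fix s assume s: "\<bar>s - t\<bar> < e"
    have "(\<lambda>s. y' s - y s) s = 0"
    proof (rule ode_zero_solution_unique[where \<delta>' = "\<lambda>s. field d (y' s) - field d (y s)", OF _ _ _ L(1) Le s])
      fix r assume r: "\<bar>r - t\<bar> < e"
      then have r': "\<bar>r - t\<bar> < e1" "\<bar>r - t\<bar> < e2" "\<bar>r - t\<bar> < e3" "\<bar>r - t\<bar> < e4" by (auto simp: e_def)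
      show "((\<lambda>s. y' s - y s) has_vector_derivative field d (y' r) - field d (y r)) (at r)"
        by (intro has_vector_derivative_diff yd yd' r')
      show "norm (field d (y' r) - field d (y r)) \<le> L * norm (y' r - y r)"
        using e3(2)[OF r'(3)] e4(2)[OF r'(4)] by (intro L(2)) (auto simp: eq dist_commute)
    qed (simp add: eq)
    then have "cot_chart d (\<gamma> s) = cot_chart d (\<gamma>' s)" by (simp add: y_def y'_def)
    moreover have "\<gamma> s \<in> cotangent_over A d" "\<gamma>' s \<in> cotangent_over A d"
      using e1(2)[of s] e2(2)[of s] s by (auto simp: e_def cotangent_over_def)
    ultimately show "\<gamma> s = \<gamma>' s"
      using inj_on_cot_chart[OF smooth d(1)] by (auto dest: inj_onD)
  qed
qed

text \<open>Takes the place of a Hausdorff argument in the bundle: different base points are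
  separated in the base, different covectors at one base point in a chart.\<close>

lemma integral_curves_differ_near:
  assumes \<gamma>: "integral_curve A H I \<gamma>" "integral_curve A H I' \<gamma>'" and t: "t \<in> I" "t \<in> I'" "\<gamma> t \<noteq> \<gamma>' t"
  obtains e where "0 < e" "\<And>s. \<bar>s - t\<bar> < e \<Longrightarrow> \<gamma> s \<noteq> \<gamma>' s"
proof (cases "fst (\<gamma> t) = fst (\<gamma>' t)")
  case False
  then obtain V W where VW: "open V" "open W" "fst (\<gamma> t) \<in> V" "fst (\<gamma>' t) \<in> W" "V \<inter> W = {}"
    using hausdorff[OF False] by blast
  obtain e1 where e1: "0 < e1" "\<And>s. \<bar>s - t\<bar> < e1 \<Longrightarrow> fst (\<gamma> s) \<in> V"
    by (rule integral_curve_near[OF \<gamma>(1) t(1) VW(1,3)]) blast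
  obtain e2 where e2: "0 < e2" "\<And>s. \<bar>s - t\<bar> < e2 \<Longrightarrow> fst (\<gamma>' s) \<in> W"
    by (rule integral_curve_near[OF \<gamma>(2) t(2) VW(2,4)]) blast
  show thesis
  proof (rule that[of "min e1 e2"])
    fix s assume "\<bar>s - t\<bar> < min e1 e2"
    then have "fst (\<gamma> s) \<in> V" "fst (\<gamma>' s) \<in> W" using e1(2)[of s] e2(2)[of s] by auto
    then show "\<gamma> s \<noteq> \<gamma>' s" using VW(5) by auto
  qed (use e1 e2 in simp)
next
  case True
  have "(\<Union>d\<in>A. fst d) = UNIV" using smooth by (simp add: smooth_structure_def)
  then obtain d where d: "d \<in> A" "fst (\<gamma> t) \<in> fst d" by blast
  define y where "y s = cot_chart d (\<gamma> s)" for s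
  define y' where "y' s = cot_chart d (\<gamma>' s)" for s
  have over: "\<gamma> t \<in> cotangent_over A d" "\<gamma>' t \<in> cotangent_over A d"
    using \<gamma> t d True by (auto simp: integral_curve_def cotangent_over_def continuous_map_def)
  have ne: "y t \<noteq> y' t"
    using inj_onD[OF inj_on_cot_chart[OF smooth d(1)] _ over] t(3) by (auto simp: y_def y'_def)
  have "isCont y t" "isCont y' t"
    unfolding y_def y'_def
    using has_vector_derivative_continuous[OF integral_curve_chart[OF \<gamma>(1) t(1) d]]
      has_vector_derivative_continuous[OF integral_curve_chart[OF \<gamma>(2) t(2) d(1)]] True d(2) by simp_all
  then have c: "isCont (\<lambda>s. dist (y s) (y' s)) t" by (intro continuous_intros)
  have "0 < dist (y t) (y' t)" using ne by simp
  from isCont_real_near[OF c this]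
  obtain e where e: "0 < e" "\<And>s. \<bar>s - t\<bar> < e \<Longrightarrow> dist (dist (y s) (y' s)) (dist (y t) (y' t)) < dist (y t) (y' t)"
    by blast
  show thesis
  proof (rule that[OF e(1)])
    fix s assume "\<bar>s - t\<bar> < e"
    from e(2)[OF this] have "y s \<noteq> y' s" by (auto simp: dist_real_def)
    then show "\<gamma> s \<noteq> \<gamma>' s" by (auto simp: y_def y'_def)
  qed
qed

text \<open>Agreement and disagreement are both open conditions on the common interval, which is
  connected.\<close>

lemma integral_curve_unique:
  assumes \<gamma>: "integral_curve A H I \<gamma>" "integral_curve A H I' \<gamma>'"
    and "0 \<in> I" "0 \<in> I'" "\<gamma> 0 = \<gamma>' 0" "t \<in> I" "t \<in> I'"
  shows "\<gamma> t = \<gamma>' t"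
proof -
  define J where "J = I \<inter> I'"
  have J: "open J" "connected J"
    using \<gamma> by (auto simp: J_def integral_curve_def intro: is_interval_connected is_interval_Int)
  define E where "E = {s \<in> J. \<gamma> s = \<gamma>' s}"
  define D where "D = {s \<in> J. \<gamma> s \<noteq> \<gamma>' s}"
  have near: "\<exists>e>0. ball s e \<subseteq> {s \<in> J. P s}" if "s \<in> J" "0 < e" "\<And>r. \<bar>r - s\<bar> < e \<Longrightarrow> P r" for s e P
  proof -
    obtain e' where e': "0 < e'" "ball s e' \<subseteq> J" using J(1) \<open>s \<in> J\<close> open_contains_ball by metis
    have "ball s (min e e') \<subseteq> {s \<in> J. P s}"
      using e' that(3) by (auto simp: dist_real_def abs_minus_commute subset_iff)
    then show ?thesis using e' that(2) by (intro exI[of _ "min e e'"]) simp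
  qed
  have "open E"
    unfolding open_contains_ball
  proof
    fix s assume s: "s \<in> E"
    then have "s \<in> I" "s \<in> I'" "\<gamma> s = \<gamma>' s" and sJ: "s \<in> J" by (auto simp: E_def J_def)
    from integral_curves_agree_near[OF \<gamma> this(1-3)]
    obtain e where "0 < e" "\<And>r. \<bar>r - s\<bar> < e \<Longrightarrow> \<gamma> r = \<gamma>' r" by blast
    from near[where P = "\<lambda>s. \<gamma> s = \<gamma>' s", OF sJ this] show "\<exists>e>0. ball s e \<subseteq> E"
      unfolding E_def .
  qed
  moreover have "open D"
    unfolding open_contains_ball
  proof
    fix s assume s: "s \<in> D"
    then have "s \<in> I" "s \<in> I'" "\<gamma> s \<noteq> \<gamma>' s" and sJ: "s \<in> J" by (auto simp: D_def J_def)
    from integral_curves_differ_near[OF \<gamma> this(1-3)]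
    obtain e where "0 < e" "\<And>r. \<bar>r - s\<bar> < e \<Longrightarrow> \<gamma> r \<noteq> \<gamma>' r" by blast
    from near[where P = "\<lambda>s. \<gamma> s \<noteq> \<gamma>' s", OF sJ this] show "\<exists>e>0. ball s e \<subseteq> D"
      unfolding D_def .
  qed
  moreover have "E \<inter> D \<inter> J = {}" "J \<subseteq> E \<union> D" by (auto simp: E_def D_def)
  ultimately have "E \<inter> J = {} \<or> D \<inter> J = {}" using connectedD[OF J(2)] by blast
  moreover have "0 \<in> E \<inter> J" using assms by (simp add: E_def J_def)
  ultimately have "D \<inter> J = {}" by blast
  then show ?thesis using assms by (auto simp: D_def J_def)
qed

text \<open>Uniqueness makes the definite description denote, so any integral curve computes the
  flow.\<close>

lemma hamiltonian_flow_eq: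
  assumes "integral_curve A H I \<gamma>" "0 \<in> I" "\<gamma> 0 = z" "t \<in> I"
  shows "t \<in> existence_interval A H z" "hamiltonian_flow A H t z = \<gamma> t"
proof -
  show "t \<in> existence_interval A H z"
    using assms unfolding existence_interval_def by blast
  show "hamiltonian_flow A H t z = \<gamma> t"
    unfolding hamiltonian_flow_def
  proof (rule the_equality)
    show "\<exists>I' \<gamma>'. integral_curve A H I' \<gamma>' \<and> 0 \<in> I' \<and> \<gamma>' 0 = z \<and> t \<in> I' \<and> \<gamma>' t = \<gamma> t"
      using assms by blast
    show "z' = \<gamma> t" if "\<exists>I' \<gamma>'. integral_curve A H I' \<gamma>' \<and> 0 \<in> I' \<and> \<gamma>' 0 = z \<and> t \<in> I' \<and> \<gamma>' t = z'" for z'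
      using that assms integral_curve_unique by metis
  qed
qed

text \<open>Hamilton's equations in one chart suffice, since transition maps carry them to all other
  charts around the same points.\<close>

lemma integral_curve_from_chart:
  assumes c: "c \<in> A" and I: "open I" "is_interval I"
    and y: "\<And>t. t \<in> I \<Longrightarrow> snd (y t) \<in> patch_domain c"
      "\<And>t. t \<in> I \<Longrightarrow> (y has_vector_derivative field c (y t)) (at t)"
  shows "integral_curve A H I (\<lambda>t. cot_patch A c (y t))"
  unfolding integral_curve_def
proof (intro conjI I ballI impI)
  have yc: "continuous_on I y"
    by (intro continuous_at_imp_continuous_on ballI has_vector_derivative_continuous[OF y(2)])
  have "continuous_map (top_of_set I) (top_of_set (UNIV \<times> patch_domain c)) y"
    by (rule continuous_map_into_subtopology) (use yc y(1) in \<open>auto simp: mem_Times_iff\<close>)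
  from continuous_map_compose[OF this continuous_map_cot_patch[OF c]]
  show "continuous_map (top_of_set I) (cotangent_topology A) (\<lambda>t. cot_patch A c (y t))"
    by (simp add: o_def)
  fix t d assume t: "t \<in> I" and d: "d \<in> A" "fst (cot_patch A c (y t)) \<in> fst d"
  have ov: "snd (y t) \<in> overlap c d"
    using y(1)[OF t] d c by (simp add: overlap_iff fst_cot_patch)
  let ?v = "fderiv (cot_trans c d) (y t) (field c (y t))"
  have "in_chart A d H differentiable (at (cot_trans c d (y t)))"
    using snd_cot_trans[OF c d(1) ov] transition_in_overlap[OF c d(1) ov] overlap_iff[OF d(1)]
    by (intro in_chart_differentiable d) auto
  then have "hamiltonian_vector (in_chart A d H) (cot_trans c d (y t)) ?v"
    using hamiltonian_vector_iff[OF in_chart_differentiable[OF c y(1)[OF t]]]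
    by (intro hamiltonian_vector_cot_trans[OF c d(1) ov]) auto
  moreover have "((\<lambda>s. cot_trans c d (y s)) has_vector_derivative ?v) (at t)"
  proof -
    have D: "(cot_trans c d has_derivative fderiv (cot_trans c d) (y t)) (at (y t))"
      by (rule Ck_on_has_derivative[OF cot_trans_Ck[OF c d(1)]]) (use ov in \<open>simp add: mem_Times_iff\<close>)
    show ?thesis
      using diff_chain_at[OF y(2)[OF t, unfolded has_vector_derivative_def] D]
        linear_cmul[OF has_derivative_linear[OF D]]
      by (simp add: has_vector_derivative_def o_def)
  qed
  ultimately show "\<exists>v. hamiltonian_vector (in_chart A d H) (cot_chart d (cot_patch A c (y t))) v \<and>
      ((\<lambda>s. cot_chart d (cot_patch A c (y s))) has_vector_derivative v) (at t)"
    unfolding cot_trans_def by blast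
qed

end

section \<open>Inverting the mixed coordinate map\<close>

text \<open>For \<open>\<phi> (t, p, q) = (P, Q)\<close> this is the map \<open>(t, p, q) \<mapsto> (t, p, Q)\<close>.\<close>

definition mixed_coords ::
  "(real \<times> (real^'n) \<times> (real^'n) \<Rightarrow> (real^'n) \<times> (real^'n)) \<Rightarrow> real \<times> (real^'n) \<times> (real^'n) \<Rightarrow>
     real \<times> (real^'n) \<times> (real^'n)" where
  "mixed_coords \<phi> z = (fst z, fst (snd z), snd (\<phi> z))"

definition coord_box :: "real \<Rightarrow> real^'n \<Rightarrow> (real \<times> (real^'n) \<times> (real^'n)) set" where
  "coord_box e x = {-e<..<e} \<times> ball 0 e \<times> ball x e"

lemma open_coord_box: "open (coord_box e x)"
  unfolding coord_box_def by (intro open_Times) auto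

lemma coord_box_iff: "z \<in> coord_box e x \<longleftrightarrow> \<bar>fst z\<bar> < e \<and> norm (fst (snd z)) < e \<and> dist x (snd (snd z)) < e"
  by (cases z) (auto simp: coord_box_def)

lemma convex_coord_box: "convex (coord_box e x)"
  unfolding coord_box_def by (intro convex_Times) auto

lemma center_in_coord_box: "0 < e \<Longrightarrow> (0, 0, x) \<in> coord_box e x"
  by (simp add: coord_box_iff)

lemma coord_box_mono: "e \<le> e' \<Longrightarrow> coord_box e x \<subseteq> coord_box e' x"
  by (auto simp: coord_box_iff)

lemma coord_box_in_open:
  assumes "open W" "(0, 0, x) \<in> W"
  obtains e where "0 < e" "coord_box e x \<subseteq> W"
proof -
  obtain A B where AB: "open A" "open B" "(0, 0, x) \<in> A \<times> B" "A \<times> B \<subseteq> W"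
    by (rule open_prod_elim[OF assms])
  then have "(0, x) \<in> B" by simp
  then obtain C D where CD: "open C" "open D" "(0, x) \<in> C \<times> D" "C \<times> D \<subseteq> B"
    by (rule open_prod_elim[OF AB(2)])
  have mem: "0 \<in> A" "0 \<in> C" "x \<in> D" using AB(3) CD(3) by auto
  obtain e1 where e1: "0 < e1" "ball 0 e1 \<subseteq> A" using AB(1) mem(1) unfolding open_contains_ball by blast
  obtain e2 where e2: "0 < e2" "ball 0 e2 \<subseteq> C" using CD(1) mem(2) unfolding open_contains_ball by blast
  obtain e3 where e3: "0 < e3" "ball x e3 \<subseteq> D" using CD(2) mem(3) unfolding open_contains_ball by blast
  note e = e1 e2 e3
  define e0 where "e0 = min e1 (min e2 e3)"
  have "z \<in> W" if z: "z \<in> coord_box e0 x" for z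
  proof -
    have "fst z \<in> ball 0 e1" "fst (snd z) \<in> ball 0 e2" "snd (snd z) \<in> ball x e3"
      using z by (auto simp: coord_box_iff e0_def)
    then have "fst z \<in> A" "fst (snd z) \<in> C" "snd (snd z) \<in> D" using e by auto
    then have "snd z \<in> B" using CD(4) by (metis mem_Times_iff subsetD)
    then show "z \<in> W" using AB(4) \<open>fst z \<in> A\<close> by (metis mem_Times_iff subsetD)
  qed
  then have "coord_box e0 x \<subseteq> W" by (rule subsetI)
  moreover have "0 < e0" using e by (simp add: e0_def)
  ultimately show thesis using that by blast
qed

text \<open>A local homeomorphism near the points \<open>(0, 0, x)\<close> that moves the last coordinate by less than
  \<open>\<epsilon>\<^sub>x\<close> on \<open>\<delta>\<^sub>x\<close>-boxes: if two points have the same image, then both lie in the larger of the two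
  \<open>4 \<epsilon>\<^sub>x\<close>-boxes, where the map is injective.\<close>

lemma inj_on_union_of_boxes:
  fixes Q :: "real \<times> (real^'n) \<times> (real^'n) \<Rightarrow> real^'n"
  assumes inj: "\<And>x. x \<in> U \<Longrightarrow> inj_on (\<lambda>z. (fst z, fst (snd z), Q z)) (coord_box (4 * \<epsilon> x) x)"
    and \<delta>: "\<And>x. x \<in> U \<Longrightarrow> \<delta> x \<le> \<epsilon> x"
    and Q: "\<And>x z. x \<in> U \<Longrightarrow> z \<in> coord_box (\<delta> x) x \<Longrightarrow> dist (snd (snd z)) (Q z) < \<epsilon> x"
  shows "inj_on (\<lambda>z. (fst z, fst (snd z), Q z)) (\<Union>x\<in>U. coord_box (\<delta> x) x)"
proof -
  have main: "z = z'"
    if x: "x \<in> U" "z \<in> coord_box (\<delta> x) x" and x': "x' \<in> U" "z' \<in> coord_box (\<delta> x') x'"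
      and le: "\<epsilon> x' \<le> \<epsilon> x" and eq: "(fst z, fst (snd z), Q z) = (fst z', fst (snd z'), Q z')" for x x' z z'
  proof -
    have 1: "dist x (snd (snd z)) < \<epsilon> x" "\<bar>fst z\<bar> < \<epsilon> x" "norm (fst (snd z)) < \<epsilon> x"
      using x(2) \<delta>[OF x(1)] by (auto simp: coord_box_iff)
    \<comment> \<open>z and z' have a common image Q z, so the last coordinate of z' is reached from
      x in three steps, each shorter than \<epsilon> x.\<close>
    have "dist x (snd (snd z')) \<le> dist x (snd (snd z)) + dist (snd (snd z)) (Q z) + dist (snd (snd z')) (Q z')"
      using eq dist_triangle[of x "snd (snd z')" "Q z"] dist_triangle[of x "Q z" "snd (snd z)"]
      by (simp add: dist_commute)
    also have "\<dots> < 4 * \<epsilon> x"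
      using 1 Q[OF x] Q[OF x'] le zero_le_dist[of x "snd (snd z)"] by linarith
    finally have "z' \<in> coord_box (4 * \<epsilon> x) x" "z \<in> coord_box (4 * \<epsilon> x) x"
      using 1 eq by (auto simp: coord_box_iff)
    then show "z = z'" using inj_onD[OF inj[OF x(1)] eq] by simp
  qed
  show ?thesis
  proof (rule inj_onI)
    fix z z' assume z: "z \<in> (\<Union>x\<in>U. coord_box (\<delta> x) x)" "z' \<in> (\<Union>x\<in>U. coord_box (\<delta> x) x)"
      and eq: "(fst z, fst (snd z), Q z) = (fst z', fst (snd z'), Q z')"
    obtain x where x: "x \<in> U" "z \<in> coord_box (\<delta> x) x" using z(1) by blast
    obtain x' where x': "x' \<in> U" "z' \<in> coord_box (\<delta> x') x'" using z(2) by blast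
    show "z = z'"
    proof (cases "\<epsilon> x' \<le> \<epsilon> x")
      case True
      show ?thesis by (rule main[OF x x' True eq])
    next
      case False
      then have le: "\<epsilon> x \<le> \<epsilon> x'" by simp
      show ?thesis by (rule main[OF x' x le eq[symmetric], symmetric])
    qed
  qed
qed

lemma mixed_coords_has_derivative:
  assumes "\<phi> differentiable (at z)"
  shows "(mixed_coords \<phi> has_derivative
    (\<lambda>d. (fst d, fst (snd d), snd (fderiv \<phi> z d)))) (at z)"
proof -
  have *: "(\<phi> has_derivative fderiv \<phi> z) (at z)"
    using assms by (simp add: frechet_derivative_works)
  show ?thesis
    unfolding mixed_coords_def
    by (intro has_derivative_Pair has_derivative_fst has_derivative_snd * has_derivative_ident)
qed

text \<open>At t = 0 the map \<phi> is the identity, so the derivative of the mixed coordinate map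
  at (0, 0, x) is the identity up to a shear in the time direction, hence invertible.\<close>

lemma mixed_coords_local_inverse:
  fixes \<phi> :: "real \<times> (real^'n) \<times> (real^'n) \<Rightarrow> (real^'n) \<times> (real^'n)"
  assumes D: "open D" "Ck_on (Suc 0) D \<phi>" "(0, 0, x) \<in> D"
    and \<phi>0: "\<And>\<zeta>. (0, \<zeta>) \<in> D \<Longrightarrow> \<phi> (0, \<zeta>) = \<zeta>"
  obtains W G where "open W" "W \<subseteq> D" "(0, 0, x) \<in> W" "homeomorphism W (mixed_coords \<phi> ` W) (mixed_coords \<phi>) G"
    "open (mixed_coords \<phi> ` W)"
    "\<And>z. z \<in> W \<Longrightarrow> bij (fderiv (mixed_coords \<phi>) z)"
    "\<And>z. z \<in> W \<Longrightarrow> (G has_derivative inv (fderiv (mixed_coords \<phi>) z)) (at (mixed_coords \<phi> z))"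
proof -
  let ?\<Psi> = "mixed_coords \<phi>" and ?P = "(0, 0, x) :: real \<times> (real^'n) \<times> (real^'n)"
  have \<Psi>: "Ck_on (Suc 0) D ?\<Psi>"
    unfolding mixed_coords_def by (intro Ck_on_Pair Ck_on_fst Ck_on_snd Ck_on_ident D)
  have d\<phi>: "\<phi> differentiable (at z)" if "z \<in> D" for z using D(2) that by auto
  define \<Psi>' where "\<Psi>' z = Blinfun (fderiv ?\<Psi> z)" for z
  have \<Psi>'c: "continuous_on D \<Psi>'" unfolding \<Psi>'_def by (rule continuous_on_Blinfun_frechet_derivative[OF \<Psi>])
  have \<Psi>'a: "blinfun_apply (\<Psi>' z) = fderiv ?\<Psi> z" if "z \<in> D" for z
    unfolding \<Psi>'_def by (rule continuous_on_Blinfun_frechet_derivative(2)[OF \<Psi> that])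
  define L where "L = fderiv \<phi> ?P"
  have L: "linear L" unfolding L_def by (rule linear_frechet_derivative[OF d\<phi>[OF D(3)]])
  have L0: "L (0, w) = w" for w
  proof -
    have 1: "((\<lambda>s. \<phi> (?P + s *\<^sub>R (0, w))) has_vector_derivative L (0, w)) (at 0)"
      unfolding L_def by (rule has_vector_derivative_along_line[OF d\<phi>[OF D(3)]])
    have "open ((\<lambda>s::real. ?P + s *\<^sub>R (0, w)) -` D)"
      by (rule open_vimage[OF D(1)]) (intro continuous_intros)
    moreover have "0 \<in> (\<lambda>s::real. ?P + s *\<^sub>R (0, w)) -` D" using D(3) by simp
    ultimately have "((\<lambda>s::real. (0, x) + s *\<^sub>R w) has_vector_derivative L (0, w)) (at 0)"
      by (rule has_vector_derivative_transform_within_open[OF 1]) (simp add: \<phi>0)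
    moreover have "((\<lambda>s::real. (0, x) + s *\<^sub>R w) has_vector_derivative w) (at 0)"
      by (auto intro!: derivative_eq_intros)
    ultimately show ?thesis by (rule vector_derivative_unique_at)
  qed
  define v where "v = snd (L (1, 0))"
  have L\<tau>: "snd (L (\<tau>, w)) = \<tau> *\<^sub>R v + snd w" for \<tau> w
    using linear_add[OF L, of "\<tau> *\<^sub>R (1, 0)" "(0, w)"] linear_cmul[OF L, of \<tau> "(1, 0)"]
    by (simp add: L0 v_def)
  have \<Psi>'P: "\<Psi>' ?P d = (fst d, fst (snd d), fst d *\<^sub>R v + snd (snd d))" for d
    using frechet_derivative_at[OF mixed_coords_has_derivative[OF d\<phi>[OF D(3)]], symmetric] L\<tau>[of "fst d" "snd d"]
    by (simp add: \<Psi>'a[OF D(3)] L_def)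
  \<comment> \<open>K undoes the shear; v is the velocity of the last coordinate at t = 0.\<close>
  define K where "K = Blinfun (\<lambda>d :: real \<times> (real^'n) \<times> (real^'n). (fst d, fst (snd d), snd (snd d) - fst d *\<^sub>R v))"
  have K: "K d = (fst d, fst (snd d), snd (snd d) - fst d *\<^sub>R v)" for d
    unfolding K_def
    by (rule bounded_linear_Blinfun_apply[THEN fun_cong])
      (auto simp: linear_conv_bounded_linear[symmetric] linear_iff algebra_simps)
  have "K o\<^sub>L \<Psi>' ?P = id_blinfun"
    by (rule blinfun_eqI) (simp add: K \<Psi>'P)
  then obtain W V G G' where W: "open W" "W \<subseteq> D" "?P \<in> W" "open V" "?\<Psi> ?P \<in> V" "homeomorphism W V ?\<Psi> G"
    "\<And>y. y \<in> V \<Longrightarrow> (G has_derivative (G' y)) (at y)"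
    "\<And>y. y \<in> V \<Longrightarrow> G' y = inv (blinfun_apply (\<Psi>' (G y)))"
    "\<And>y. y \<in> V \<Longrightarrow> bij (blinfun_apply (\<Psi>' (G y)))"
    using inverse_function_theorem[OF D(1) _ \<Psi>'c D(3), of ?\<Psi> K] Ck_on_has_derivative[OF \<Psi>] \<Psi>'a
    by (metis (no_types, lifting))
  have V: "V = ?\<Psi> ` W" using W(6) by (simp add: homeomorphism_image1)
  have G: "G (?\<Psi> z) = z" if "z \<in> W" for z using W(6) that by (simp add: homeomorphism_apply1)
  show thesis
  proof (rule that[of W G])
    fix z assume z: "z \<in> W"
    then have zV: "?\<Psi> z \<in> V" and zD: "z \<in> D" using V W(2) by auto
    show "bij (fderiv ?\<Psi> z)" using W(9)[OF zV] by (simp add: G z \<Psi>'a zD)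
    show "(G has_derivative inv (fderiv ?\<Psi> z)) (at (?\<Psi> z))"
      using W(7)[OF zV] W(8)[OF zV] by (simp add: G z \<Psi>'a zD)
  qed (use W V in auto)
qed

text \<open>The inverse function theorem works near each (0, 0, x) separately. One inverse near the
  whole zero locus requires injectivity on a union of boxes, whose sizes are chosen here.\<close>

lemma mixed_coords_inverse:
  fixes \<phi> :: "real \<times> (real^'n) \<times> (real^'n) \<Rightarrow> (real^'n) \<times> (real^'n)"
  assumes D: "open D" "zero_locus U \<subseteq> D" "Ck_on (Suc 0) D \<phi>"
    and \<phi>0: "\<And>\<zeta>. (0, \<zeta>) \<in> D \<Longrightarrow> \<phi> (0, \<zeta>) = \<zeta>"
  obtains V g where "open V" "zero_locus U \<subseteq> V" "V \<subseteq> D" "open (mixed_coords \<phi> ` V)"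
    "\<And>z. z \<in> V \<Longrightarrow> g (mixed_coords \<phi> z) = z"
    "\<And>z. z \<in> V \<Longrightarrow> bij (fderiv (mixed_coords \<phi>) z)"
    "\<And>z. z \<in> V \<Longrightarrow> (g has_derivative inv (fderiv (mixed_coords \<phi>) z)) (at (mixed_coords \<phi> z))"
proof -
  let ?\<Psi> = "mixed_coords \<phi>"
  have \<phi>c: "continuous_on D \<phi>" by (rule Ck_on_imp_continuous_on[OF D(3)])
  define good where "good x \<epsilon> \<delta> W G \<longleftrightarrow> 0 < \<delta> \<and> \<delta> \<le> \<epsilon> \<and> coord_box (4 * \<epsilon>) x \<subseteq> W \<and> open W \<and> W \<subseteq> D \<and>
      homeomorphism W (?\<Psi> ` W) ?\<Psi> G \<and> open (?\<Psi> ` W) \<and>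
      (\<forall>z\<in>W. bij (fderiv ?\<Psi> z) \<and>
        (G has_derivative inv (fderiv ?\<Psi> z)) (at (?\<Psi> z))) \<and>
      (\<forall>z\<in>coord_box \<delta> x. dist (snd (snd z)) (snd (\<phi> z)) < \<epsilon>)" for x \<epsilon> \<delta> W G
  have "\<exists>\<epsilon> \<delta> W G. good x \<epsilon> \<delta> W G" if "x \<in> U" for x
  proof -
    have P: "(0, 0, x) \<in> D" using D(2) that by (auto simp: zero_locus_def)
    obtain W G where W: "open W" "W \<subseteq> D" "(0, 0, x) \<in> W" "homeomorphism W (?\<Psi> ` W) ?\<Psi> G" "open (?\<Psi> ` W)"
      "\<And>z. z \<in> W \<Longrightarrow> bij (fderiv ?\<Psi> z)"
      "\<And>z. z \<in> W \<Longrightarrow> (G has_derivative inv (fderiv ?\<Psi> z)) (at (?\<Psi> z))"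
      by (rule mixed_coords_local_inverse[OF D(1,3) P \<phi>0]) (assumption, rule that)
    obtain e where e: "0 < e" "coord_box e x \<subseteq> W" by (rule coord_box_in_open[OF W(1,3)])
    \<comment> \<open>The map is injective on the box of size 4 \<epsilon>; a smaller box is then
      taken on which the last coordinate moves by less than \<epsilon>.\<close>
    define \<epsilon> where "\<epsilon> = e / 4"
    have "continuous_on D (\<lambda>z. dist (snd (snd z)) (snd (\<phi> z)))"
      by (intro continuous_intros \<phi>c)
    then have "open (D \<inter> (\<lambda>z. dist (snd (snd z)) (snd (\<phi> z))) -` {..<\<epsilon>})"
      by (rule continuous_open_preimage[OF _ D(1)]) auto
    moreover have "(0, 0, x) \<in> D \<inter> (\<lambda>z. dist (snd (snd z)) (snd (\<phi> z))) -` {..<\<epsilon>}"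
      using P e \<phi>0[OF P] by (simp add: \<epsilon>_def)
    ultimately obtain d where d: "0 < d" "coord_box d x \<subseteq> D \<inter> (\<lambda>z. dist (snd (snd z)) (snd (\<phi> z))) -` {..<\<epsilon>}"
      by (rule coord_box_in_open)
    have "coord_box (min d \<epsilon>) x \<subseteq> coord_box d x" by (rule coord_box_mono) simp
    then have "\<forall>z\<in>coord_box (min d \<epsilon>) x. dist (snd (snd z)) (snd (\<phi> z)) < \<epsilon>" using d(2) by auto
    then show ?thesis
      using d e W by (intro exI[of _ \<epsilon>] exI[of _ "min d \<epsilon>"] exI[of _ W] exI[of _ G]) (auto simp: good_def \<epsilon>_def)
  qed
  then obtain \<epsilon> \<delta> W G where "\<And>x. x \<in> U \<Longrightarrow> good x (\<epsilon> x) (\<delta> x) (W x) (G x)" by metis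
  note all = this[unfolded good_def]
  define V where "V = (\<Union>x\<in>U. coord_box (\<delta> x) x)"
  have sub: "coord_box (\<delta> x) x \<subseteq> W x" if "x \<in> U" for x
  proof -
    have "\<delta> x \<le> 4 * \<epsilon> x" using all[OF that] by linarith
    then show ?thesis using coord_box_mono[of "\<delta> x" "4 * \<epsilon> x" x] all[OF that] by blast
  qed
  have inj: "inj_on ?\<Psi> V"
    unfolding V_def mixed_coords_def
  proof (rule inj_on_union_of_boxes)
    fix x assume x: "x \<in> U"
    have "inj_on ?\<Psi> (W x)"
      using all[OF x] by (intro inj_on_inverseI[of _ "G x"]) (auto dest: homeomorphism_apply1)
    then show "inj_on (\<lambda>z. (fst z, fst (snd z), snd (\<phi> z))) (coord_box (4 * \<epsilon> x) x)"
      unfolding mixed_coords_def[abs_def] using all[OF x] by (blast intro: inj_on_subset)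
  qed (use all in auto)
  define g where "g = inv_into V ?\<Psi>"
  have g: "g (?\<Psi> z) = z" if "z \<in> V" for z unfolding g_def by (rule inv_into_f_f[OF inj that])
  have op: "open (?\<Psi> ` coord_box (\<delta> x) x)" if x: "x \<in> U" for x
  proof -
    have "openin (top_of_set (?\<Psi> ` W x)) (?\<Psi> ` coord_box (\<delta> x) x)"
      using all[OF x] sub[OF x] open_coord_box[of "\<delta> x" x]
      by (intro homeomorphism_imp_open_map[of "W x" _ _ "G x"]) (auto simp: openin_open_eq)
    then show ?thesis using all[OF x] by (simp add: openin_open_eq)
  qed
  show thesis
  proof (rule that[of V g])
    show "open V" unfolding V_def by (intro open_UN ballI open_coord_box)
    show "zero_locus U \<subseteq> V" using all by (auto simp: V_def zero_locus_def intro!: center_in_coord_box)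
    show "V \<subseteq> D" unfolding V_def using all sub by (intro UN_least) (meson subset_trans)
    show "open (?\<Psi> ` V)" unfolding V_def image_UN by (intro open_UN ballI op)
    fix z assume z: "z \<in> V"
    then obtain x where x: "x \<in> U" "z \<in> coord_box (\<delta> x) x" by (auto simp: V_def)
    have zW: "z \<in> W x" using sub x by auto
    show "bij (fderiv ?\<Psi> z)" using all[OF x(1)] zW by blast
    \<comment> \<open>On the image of one box the global inverse equals the local one, whose
      derivative is known.\<close>
    show "(g has_derivative inv (fderiv ?\<Psi> z)) (at (?\<Psi> z))"
    proof (rule has_derivative_transform_within_open[OF _ op[OF x(1)]])
      show "(G x has_derivative inv (fderiv ?\<Psi> z)) (at (?\<Psi> z))" using all[OF x(1)] zW by blast
      show "?\<Psi> z \<in> ?\<Psi> ` coord_box (\<delta> x) x" using x by blast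
      fix y assume "y \<in> ?\<Psi> ` coord_box (\<delta> x) x"
      then obtain z' where z': "z' \<in> coord_box (\<delta> x) x" "y = ?\<Psi> z'" by blast
      have "G x y = z'"
        using all[OF x(1)] z' sub[OF x(1)] by (metis homeomorphism_apply1 subsetD)
      moreover have "z' \<in> V" using z'(1) x(1) by (auto simp: V_def)
      ultimately show "G x y = g y" using g z'(2) by simp
    qed
  qed (use g in auto)
qed

text \<open>The derivative of g solves a linear system whose coefficients come from the derivative
  of \<phi> along g. If g is of class k, so are the coefficients and, by Cramer's rule, the
  derivative of g, which gains one order.\<close>

lemma Ck_on_mixed_coords_inverse:
  fixes \<phi> :: "real \<times> (real^'n) \<times> (real^'n) \<Rightarrow> (real^'n) \<times> (real^'n)"
  assumes V: "open (mixed_coords \<phi> ` V)" "V \<subseteq> D" and \<phi>: "\<And>k. Ck_on k D \<phi>"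
    and g: "\<And>z. z \<in> V \<Longrightarrow> g (mixed_coords \<phi> z) = z"
    and bij: "\<And>z. z \<in> V \<Longrightarrow> bij (fderiv (mixed_coords \<phi>) z)"
    and g': "\<And>z. z \<in> V \<Longrightarrow> (g has_derivative inv (fderiv (mixed_coords \<phi>) z)) (at (mixed_coords \<phi> z))"
  shows "Ck_on k (mixed_coords \<phi> ` V) g"
    and "n \<in> mixed_coords \<phi> ` V \<Longrightarrow> (g has_derivative fderiv g n) (at n)"
    and "n \<in> mixed_coords \<phi> ` V \<Longrightarrow> fst (fderiv g n d) = fst d"
    and "n \<in> mixed_coords \<phi> ` V \<Longrightarrow> fst (snd (fderiv g n d)) = fst (snd d)"
    and "n \<in> mixed_coords \<phi> ` V \<Longrightarrow> snd (fderiv \<phi> (g n) (fderiv g n d)) = snd (snd d)"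
proof -
  let ?\<Psi> = "mixed_coords \<phi>"
  let ?N = "?\<Psi> ` V"
  define w where "w n = fderiv g n" for n
  have gV: "g n \<in> V" "?\<Psi> (g n) = n" if "n \<in> ?N" for n using that g by auto
  have d\<phi>: "\<phi> differentiable (at (g n))" if "n \<in> ?N" for n
    using \<phi>[of "Suc 0"] gV(1)[OF that] V(2) by auto
  have gw: "(g has_derivative w n) (at n)" and wi: "w n = inv (fderiv ?\<Psi> (g n))" if "n \<in> ?N" for n
  proof -
    have *: "(g has_derivative inv (fderiv ?\<Psi> (g n))) (at n)"
      using g'[OF gV(1)[OF that]] gV(2)[OF that] by simp
    show "w n = inv (fderiv ?\<Psi> (g n))" unfolding w_def by (rule frechet_derivative_at[OF *, symmetric])
    then show "(g has_derivative w n) (at n)" using * by simp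
  qed
  have \<Psi>w: "(fst (w n d), fst (snd (w n d)), snd (fderiv \<phi> (g n) (w n d))) = d" if "n \<in> ?N" for n d
  proof -
    have "fderiv ?\<Psi> (g n) (w n d) = d"
      unfolding wi[OF that] by (rule surj_f_inv_f[OF bij_is_surj[OF bij[OF gV(1)[OF that]]]])
    then show ?thesis
      unfolding frechet_derivative_at[OF mixed_coords_has_derivative[OF d\<phi>[OF that]], symmetric] .
  qed
  have w1: "fst (w n d) = fst d" and w2: "fst (snd (w n d)) = fst (snd d)"
    and w3: "snd (fderiv \<phi> (g n) (w n d)) = snd (snd d)" if "n \<in> ?N" for n d
    by (subst (2) \<Psi>w[OF that, of d, symmetric], simp)+
  \<comment> \<open>The matrix of \<partial>Q/\<partial>q along g.\<close>
  define M where "M n = matrix (\<lambda>b. snd (fderiv \<phi> (g n) (0, 0, b)))" for n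
  have lin: "linear (\<lambda>b. snd (fderiv \<phi> (g n) (0, 0, b)))" if "n \<in> ?N" for n
    using linear_add[OF linear_frechet_derivative[OF d\<phi>[OF that]]] linear_cmul[OF linear_frechet_derivative[OF d\<phi>[OF that]]]
    by (intro linearI) (metis (no_types) add_Pair add.right_neutral snd_add, metis (no_types) scaleR_Pair scaleR_zero_right snd_scaleR)
  have Mv: "M n *v b = snd (fderiv \<phi> (g n) (0, 0, b))" if "n \<in> ?N" for n b
    using fun_cong[OF matrix_vector_mul(2)[OF lin[OF that]]] by (simp add: M_def)
  have det: "det (M n) \<noteq> 0" if n: "n \<in> ?N" for n
  proof -
    have "inj (\<lambda>b. snd (fderiv \<phi> (g n) (0, 0, b)))"
    proof (rule injI)
      fix b b' assume eq: "snd (fderiv \<phi> (g n) (0, 0, b)) = snd (fderiv \<phi> (g n) (0, 0, b'))"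
      have "fderiv ?\<Psi> (g n) (0, 0, b) = fderiv ?\<Psi> (g n) (0, 0, b')"
        unfolding frechet_derivative_at[OF mixed_coords_has_derivative[OF d\<phi>[OF n]], symmetric] using eq by simp
      then show "b = b'"
        using bij_is_inj[OF bij[OF gV(1)[OF n]]] by (auto dest: injD)
    qed
    then show ?thesis
      using det_nz_iff_inj[OF lin[OF n]] by (simp add: M_def)
  qed
  show main: "Ck_on k ?N g" for k
  proof (induction k)
    case 0
    show ?case
      by (auto intro!: continuous_at_imp_continuous_on has_derivative_continuous gw)
  next
    case (Suc k)
    have D: "Ck_on k ?N (\<lambda>n. fderiv \<phi> (g n) d)" for d
      by (rule Ck_on_frechet_derivative_apply[OF V(1) \<phi> Suc.IH subsetD[OF V(2) gV(1)] Ck_on_const])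
    show ?case
    proof (rule Ck_on_SucI[OF V(1) gw])
      fix d
      \<comment> \<open>t and p are left unchanged by g, so the last component is the only
        unknown.\<close>
      have "Ck_on k ?N (\<lambda>n. snd (snd (w n d)))"
      proof (rule Ck_on_linear_solve[OF V(1) _ _ det])
        show "Ck_on k ?N (\<lambda>n. M n $ i $ j)" for i j
          unfolding M_def matrix_def by (simp, intro Ck_on_nth Ck_on_snd V(1) D)
        show "Ck_on k ?N (\<lambda>n. snd (snd d) - snd (fderiv \<phi> (g n) (fst d, fst (snd d), 0)))"
          by (intro Ck_on_diff Ck_on_const Ck_on_snd V(1) D)
        show "M n *v snd (snd (w n d)) = snd (snd d) - snd (fderiv \<phi> (g n) (fst d, fst (snd d), 0))"
          if n: "n \<in> ?N" for n
        proof -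
          have "w n d = (fst d, fst (snd d), 0) + (0, 0, snd (snd (w n d)))"
            using w1[OF n, of d] w2[OF n, of d] by (simp add: prod_eq_iff)
          then have "snd (fderiv \<phi> (g n) (w n d)) =
              snd (fderiv \<phi> (g n) (fst d, fst (snd d), 0)) + M n *v snd (snd (w n d))"
            using linear_add[OF linear_frechet_derivative[OF d\<phi>[OF n]], of "(fst d, fst (snd d), 0)" "(0, 0, snd (snd (w n d)))"]
            by (simp add: Mv[OF n])
          then show ?thesis using w3[OF n, of d] by simp
        qed
      qed
      then have "Ck_on k ?N (\<lambda>n. (fst d, fst (snd d), snd (snd (w n d))))"
        by (intro Ck_on_Pair Ck_on_const V(1))
      moreover have "(fst d, fst (snd d), snd (snd (w n d))) = w n d" if "n \<in> ?N" for n
        using w1[OF that, of d] w2[OF that, of d] by (simp add: prod_eq_iff)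
      ultimately show "Ck_on k ?N (\<lambda>n. w n d)"
        using Ck_on_cong[OF V(1), of "\<lambda>n. (fst d, fst (snd d), snd (snd (w n d)))" "\<lambda>n. w n d" k] by simp
    qed
  qed
  assume n: "n \<in> ?N"
  show "(g has_derivative fderiv g n) (at n)" using gw[OF n] by (simp add: w_def)
  show "fst (fderiv g n d) = fst d" "fst (snd (fderiv g n d)) = fst (snd d)"
    "snd (fderiv \<phi> (g n) (fderiv g n d)) = snd (snd d)"
    using w1[OF n] w2[OF n] w3[OF n] unfolding w_def by auto
qed

text \<open>Along g the variation of Q becomes the coordinate differential dQ, so the differential
  of the action takes the form H dt + q dp + P dQ in the coordinates (t, p, Q).\<close>

lemma generating_function_of_characteristics:
  fixes h :: "(real^'n) \<times> (real^'n::finite) \<Rightarrow> real"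
  assumes U: "open U" and h: "\<And>k. Ck_on k (UNIV \<times> U) h"
    and D: "open D" "zero_locus U \<subseteq> D" "\<And>k. Ck_on k D \<phi>"
    and \<phi>: "\<And>\<zeta>. (0, \<zeta>) \<in> D \<Longrightarrow> \<phi> (0, \<zeta>) = \<zeta>" "\<And>z. z \<in> D \<Longrightarrow> snd (\<phi> z) \<in> U"
    and a: "\<And>z. z \<in> D \<Longrightarrow> (a has_derivative (\<lambda>d. fst d * h (\<phi> z) + fst (snd d) \<bullet> snd (snd z) +
      fst (\<phi> z) \<bullet> snd (fderiv \<phi> z d))) (at z)"
  obtains V g where "open V" "zero_locus U \<subseteq> V" "V \<subseteq> D" "open (mixed_coords \<phi> ` V)"
    "\<And>z. z \<in> V \<Longrightarrow> g (mixed_coords \<phi> z) = z" "smooth_on (mixed_coords \<phi> ` V) (\<lambda>n. a (g n))"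
    "\<And>n. n \<in> mixed_coords \<phi> ` V \<Longrightarrow> ((\<lambda>n. a (g n)) has_derivative (\<lambda>d. fst d * h (\<phi> (g n)) +
      fst (snd d) \<bullet> snd (snd (g n)) + fst (\<phi> (g n)) \<bullet> snd (snd d))) (at n)"
proof -
  let ?\<Psi> = "mixed_coords \<phi>"
  obtain V g where V: "open V" "zero_locus U \<subseteq> V" "V \<subseteq> D" "open (?\<Psi> ` V)"
    "\<And>z. z \<in> V \<Longrightarrow> g (?\<Psi> z) = z"
    "\<And>z. z \<in> V \<Longrightarrow> bij (fderiv ?\<Psi> z)"
    "\<And>z. z \<in> V \<Longrightarrow> (g has_derivative inv (fderiv ?\<Psi> z)) (at (?\<Psi> z))"
    by (rule mixed_coords_inverse[OF D(1,2,3) \<phi>(1)]) (assumption, rule that)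
  let ?N = "?\<Psi> ` V"
  have g: "Ck_on k ?N g" "n \<in> ?N \<Longrightarrow> (g has_derivative fderiv g n) (at n)"
    "n \<in> ?N \<Longrightarrow> fst (fderiv g n d) = fst d"
    "n \<in> ?N \<Longrightarrow> fst (snd (fderiv g n d)) = fst (snd d)"
    "n \<in> ?N \<Longrightarrow> snd (fderiv \<phi> (g n) (fderiv g n d)) = snd (snd d)" for k n d
    using Ck_on_mixed_coords_inverse[where g = g, OF V(4,3) D(3)] V(5-7) by blast+
  have gD: "g n \<in> D" if "n \<in> ?N" for n using that V(3,5) by auto
  have der: "((\<lambda>n. a (g n)) has_derivative (\<lambda>d. fst d * h (\<phi> (g n)) +
      fst (snd d) \<bullet> snd (snd (g n)) + fst (\<phi> (g n)) \<bullet> snd (snd d))) (at n)" if n: "n \<in> ?N" for n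
    using diff_chain_at[OF g(2)[OF n] a[OF gD[OF n]]]
    unfolding o_def g(3)[OF n] g(4)[OF n] g(5)[OF n] .
  have \<phi>g: "Ck_on k ?N (\<lambda>n. \<phi> (g n))" for k
    by (rule Ck_on_compose[OF V(4) D(3) g(1) gD])
  have "Ck_on k ?N (\<lambda>n. h (\<phi> (g n)))" for k
    by (rule Ck_on_compose[OF V(4) h \<phi>g]) (use \<phi>(2) gD in \<open>simp add: mem_Times_iff\<close>)
  \<comment> \<open>The action is known only to be differentiable; its smoothness is read off from
    the differential, whose coefficients are smooth.\<close>
  then have "Ck_on (Suc k) ?N (\<lambda>n. a (g n))" for k
    by (intro Ck_on_SucI[OF V(4) der] Ck_on_add Ck_on_mult Ck_on_inner Ck_on_const Ck_on_fst Ck_on_snd g(1) \<phi>g V(4))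
  then have sm: "smooth_on ?N (\<lambda>n. a (g n))"
    unfolding smooth_on_def using Ck_on_SucD by blast
  show thesis by (rule that[of V g]) (use V(1-5) sm der in blast)+
qed

section \<open>Partial derivatives of generating functions\<close>

text \<open>Generating functions are described by three partial derivatives, while the proof works
  with one differential; this and the next lemma translate between them.\<close>

lemma partials_of_has_derivative:
  fixes S :: "real \<times> (real^'n) \<times> (real^'n::finite) \<Rightarrow> real"
  assumes S: "(S has_derivative (\<lambda>d. fst d * e + fst (snd d) \<bullet> q + p' \<bullet> snd (snd d))) (at (t, p, Q))"
  shows "((\<lambda>s. S (s, p, Q)) has_real_derivative e) (at t)" "((\<lambda>p. S (t, p, Q)) has_derivative (\<lambda>v. q \<bullet> v)) (at p)"
    "d_t S t p Q = e" "d_p S t p Q = q" "d_Q S t p Q = p'"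
proof -
  have "((\<lambda>s. (s, p, Q)) has_derivative (\<lambda>\<tau>. (\<tau>, 0, 0))) (at t)"
    by (auto intro!: derivative_eq_intros simp: zero_prod_def)
  from diff_chain_at[OF this S] show 1: "((\<lambda>s. S (s, p, Q)) has_real_derivative e) (at t)"
    unfolding has_field_derivative_def o_def
    by (rule has_derivative_eq_rhs) (simp add: fun_eq_iff)
  have "((\<lambda>p. (t, p, Q)) has_derivative (\<lambda>v. (0, v, 0))) (at p)"
    by (auto intro!: derivative_eq_intros)
  from diff_chain_at[OF this S] show 2: "((\<lambda>p. S (t, p, Q)) has_derivative (\<lambda>v. q \<bullet> v)) (at p)"
    by (simp add: o_def inner_commute)
  have "((\<lambda>Q. (t, p, Q)) has_derivative (\<lambda>v. (0, 0, v))) (at Q)"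
    by (auto intro!: derivative_eq_intros)
  from diff_chain_at[OF this S] have 3: "((\<lambda>Q. S (t, p, Q)) has_derivative (\<lambda>v. p' \<bullet> v)) (at Q)"
    by (simp add: o_def)
  show "d_t S t p Q = e" unfolding d_t_def by (rule DERIV_imp_deriv[OF 1])
  show "d_p S t p Q = q" unfolding d_p_def by (rule gradient_unique[OF 2])
  show "d_Q S t p Q = p'" unfolding d_Q_def by (rule gradient_unique[OF 3])
qed

lemma partials_eq_frechet_derivative:
  fixes S :: "real \<times> (real^'n) \<times> (real^'n::finite) \<Rightarrow> real"
  assumes S: "S differentiable (at (t, p, Q))"
  shows "(S has_derivative (\<lambda>d. fst d * d_t S t p Q + fst (snd d) \<bullet> d_p S t p Q + d_Q S t p Q \<bullet> snd (snd d))) (at (t, p, Q))"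
    and "d_t S t p Q = fderiv S (t, p, Q) (1, 0, 0)"
    and "d_p S t p Q = (\<chi> i. fderiv S (t, p, Q) (0, axis i 1, 0))"
    and "d_Q S t p Q = (\<chi> i. fderiv S (t, p, Q) (0, 0, axis i 1))"
proof -
  define L where "L = fderiv S (t, p, Q)"
  have lin: "linear L" unfolding L_def by (rule linear_frechet_derivative[OF S])
  have 1: "linear (\<lambda>v. L (0, v, 0))" "linear (\<lambda>v. L (0, 0, v))"
    using linear_compose[OF _ lin, of "\<lambda>v. (0, v, 0)"] linear_compose[OF _ lin, of "\<lambda>v. (0, 0, v)"]
    by (auto simp: o_def linear_iff)
  have "L d = fst d * L (1, 0, 0) + fst (snd d) \<bullet> (\<chi> i. L (0, axis i 1, 0)) + (\<chi> i. L (0, 0, axis i 1)) \<bullet> snd (snd d)" for d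
  proof -
    have "d = fst d *\<^sub>R (1, 0, 0) + ((0, fst (snd d), 0) + (0, 0, snd (snd d)))"
      by (simp add: prod_eq_iff)
    then have "L d = L (fst d *\<^sub>R (1, 0, 0) + ((0, fst (snd d), 0) + (0, 0, snd (snd d))))"
      by (rule arg_cong)
    also have "\<dots> = fst d * L (1, 0, 0) + (L (0, fst (snd d), 0) + L (0, 0, snd (snd d)))"
      unfolding linear_add[OF lin] linear_cmul[OF lin] by simp
    finally show ?thesis
      using linear_eq_inner_axis[OF 1(1), of "fst (snd d)"] linear_eq_inner_axis[OF 1(2), of "snd (snd d)"]
      by (simp add: inner_commute)
  qed
  then have "L = (\<lambda>d. fst d * L (1, 0, 0) + fst (snd d) \<bullet> (\<chi> i. L (0, axis i 1, 0)) + (\<chi> i. L (0, 0, axis i 1)) \<bullet> snd (snd d))"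
    by (rule ext)
  then have S': "(S has_derivative (\<lambda>d. fst d * L (1, 0, 0) + fst (snd d) \<bullet> (\<chi> i. L (0, axis i 1, 0)) +
      (\<chi> i. L (0, 0, axis i 1)) \<bullet> snd (snd d))) (at (t, p, Q))"
    using S by (simp add: frechet_derivative_works L_def)
  note d = partials_of_has_derivative[OF S']
  show "d_t S t p Q = fderiv S (t, p, Q) (1, 0, 0)"
    "d_p S t p Q = (\<chi> i. fderiv S (t, p, Q) (0, axis i 1, 0))"
    "d_Q S t p Q = (\<chi> i. fderiv S (t, p, Q) (0, 0, axis i 1))"
    using d(3-5) by (simp_all add: L_def)
  show "(S has_derivative (\<lambda>d. fst d * d_t S t p Q + fst (snd d) \<bullet> d_p S t p Q + d_Q S t p Q \<bullet> snd (snd d))) (at (t, p, Q))"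
    unfolding d(3-5) by (rule S')
qed

section \<open>Flow and action read in a chart\<close>

context hamiltonian_system
begin

text \<open>Total as a function, but meaningful only while the trajectory exists and ends over the
  chart; \<open>flow_domain\<close> records where this is known.\<close>

definition chart_flow :: "('m, 'n) chart \<Rightarrow> real \<times> (real^'n) \<times> (real^'n) \<Rightarrow> (real^'n) \<times> (real^'n)" where
  "chart_flow c z = cot_chart c (hamiltonian_flow A H (fst z) (cot_patch A c (snd z)))"

text \<open>A formula rather than a chosen primitive, so that actions found near different points
  agree automatically. The integral over times from 0 to t is rescaled to the unit interval.\<close>

definition chart_action :: "('m, 'n) chart \<Rightarrow> real \<times> (real^'n) \<times> (real^'n) \<Rightarrow> real" where
  "chart_action c z = fst (snd z) \<bullet> snd (snd z) + fst z *\<^sub>R integral {0..1} (\<lambda>\<theta>.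
     let y = chart_flow c (\<theta> * fst z, snd z) in in_chart A c H y + fst y \<bullet> snd (field c y))"

text \<open>Every clause is local or pointwise, so the property passes to open subsets and to
  arbitrary unions.\<close>

definition flow_domain :: "('m, 'n) chart \<Rightarrow> (real \<times> (real^'n) \<times> (real^'n)) set \<Rightarrow> bool" where
  "flow_domain c B \<longleftrightarrow> open B \<and> B \<subseteq> UNIV \<times> UNIV \<times> patch_domain c \<and> (\<forall>k. Ck_on k B (chart_flow c)) \<and>
    (\<forall>\<zeta>. (0, \<zeta>) \<in> B \<longrightarrow> chart_flow c (0, \<zeta>) = \<zeta> \<and> chart_action c (0, \<zeta>) = fst \<zeta> \<bullet> snd \<zeta>) \<and>
    (\<forall>(t, \<zeta>)\<in>B. t \<in> existence_interval A H (cot_patch A c \<zeta>) \<and>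
      hamiltonian_flow A H t (cot_patch A c \<zeta>) = cot_patch A c (chart_flow c (t, \<zeta>)) \<and>
      snd (chart_flow c (t, \<zeta>)) \<in> patch_domain c) \<and>
    (\<forall>z\<in>B. (chart_action c has_derivative (\<lambda>d. fst d * in_chart A c H (chart_flow c z) +
      fst (snd d) \<bullet> snd (snd z) + fst (chart_flow c z) \<bullet> snd (fderiv (chart_flow c) z d))) (at z))"

lemma flow_domainD:
  assumes "flow_domain c B"
  shows "open B" "B \<subseteq> UNIV \<times> UNIV \<times> patch_domain c" "Ck_on k B (chart_flow c)"
    "(0, \<zeta>) \<in> B \<Longrightarrow> chart_flow c (0, \<zeta>) = \<zeta>" "(0, \<zeta>) \<in> B \<Longrightarrow> chart_action c (0, \<zeta>) = fst \<zeta> \<bullet> snd \<zeta>"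
    "(t, \<zeta>) \<in> B \<Longrightarrow> t \<in> existence_interval A H (cot_patch A c \<zeta>) \<and>
      hamiltonian_flow A H t (cot_patch A c \<zeta>) = cot_patch A c (chart_flow c (t, \<zeta>)) \<and>
      snd (chart_flow c (t, \<zeta>)) \<in> patch_domain c"
    "z \<in> B \<Longrightarrow> (chart_action c has_derivative (\<lambda>d. fst d * in_chart A c H (chart_flow c z) +
      fst (snd d) \<bullet> snd (snd z) + fst (chart_flow c z) \<bullet> snd (fderiv (chart_flow c) z d))) (at z)"
  using assms unfolding flow_domain_def by blast+

lemma flow_domain_subset: "flow_domain c D \<Longrightarrow> open V \<Longrightarrow> V \<subseteq> D \<Longrightarrow> flow_domain c V"
  unfolding flow_domain_def by (blast intro: Ck_on_subset)

lemma chart_flow_near: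
  assumes c: "c \<in> A" and x: "x \<in> patch_domain c"
  obtains B where "flow_domain c B" "(0, 0, x) \<in> B"
proof -
  let ?U = "patch_domain c" and ?h = "in_chart A c H"
  have h: "smooth_on (UNIV \<times> ?U) ?h" using in_chart_Ck[OF c] by (simp add: smooth_on_def)
  obtain \<epsilon> y a where y: "0 < \<epsilon>" "smooth_on ({-\<epsilon><..<\<epsilon>} \<times> ball (0, x) \<epsilon>) y"
    "\<And>\<zeta>. \<zeta> \<in> ball (0, x) \<epsilon> \<Longrightarrow> y (0, \<zeta>) = \<zeta>" "\<And>\<zeta>. \<zeta> \<in> ball (0, x) \<epsilon> \<Longrightarrow> a (0, \<zeta>) = fst \<zeta> \<bullet> snd \<zeta>"
    "\<And>t \<zeta>. t \<in> {-\<epsilon><..<\<epsilon>} \<Longrightarrow> \<zeta> \<in> ball (0, x) \<epsilon> \<Longrightarrow> snd (y (t, \<zeta>)) \<in> ?U"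
    "\<And>t \<zeta>. t \<in> {-\<epsilon><..<\<epsilon>} \<Longrightarrow> \<zeta> \<in> ball (0, x) \<epsilon> \<Longrightarrow>
      ((\<lambda>s. y (s, \<zeta>)) has_vector_derivative field c (y (t, \<zeta>))) (at t)"
    "\<And>t \<zeta>. t \<in> {-\<epsilon><..<\<epsilon>} \<Longrightarrow> \<zeta> \<in> ball (0, x) \<epsilon> \<Longrightarrow> ((\<lambda>s. a (s, \<zeta>)) has_vector_derivative
      ?h (y (t, \<zeta>)) + fst (y (t, \<zeta>)) \<bullet> snd (field c (y (t, \<zeta>)))) (at t)"
    "\<And>t \<zeta>. t \<in> {-\<epsilon><..<\<epsilon>} \<Longrightarrow> \<zeta> \<in> ball (0, x) \<epsilon> \<Longrightarrow> (a has_derivative (\<lambda>d. fst d * ?h (y (t, \<zeta>)) +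
      fst (snd d) \<bullet> snd \<zeta> + fst (y (t, \<zeta>)) \<bullet> snd (fderiv y (t, \<zeta>) d))) (at (t, \<zeta>))"
    by (rule local_characteristics[OF chart(2)[OF c] h x]) (rule that)
  define B where "B = {-\<epsilon><..<\<epsilon>} \<times> ball ((0, x) :: (real^'n) \<times> (real^'n)) \<epsilon>"
  have B: "open B" unfolding B_def by (intro open_Times) auto
  have B0: "\<zeta> \<in> ball (0, x) \<epsilon>" "t \<in> {-\<epsilon><..<\<epsilon>}" if "(t, \<zeta>) \<in> B" for t \<zeta> using that by (auto simp: B_def)
  \<comment> \<open>Along with t the box contains all times between 0 and t, over which the action
    integrates.\<close>
  have Bs: "(s, \<zeta>) \<in> B" if "(t, \<zeta>) \<in> B" "\<bar>s\<bar> \<le> \<bar>t\<bar>" for s t \<zeta> using that by (auto simp: B_def)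
  have flow: "t \<in> existence_interval A H (cot_patch A c \<zeta>)"
    "hamiltonian_flow A H t (cot_patch A c \<zeta>) = cot_patch A c (y (t, \<zeta>))" if "(t, \<zeta>) \<in> B" for t \<zeta>
  proof -
    have curve: "integral_curve A H {-\<epsilon><..<\<epsilon>} (\<lambda>t. cot_patch A c (y (t, \<zeta>)))"
      by (rule integral_curve_from_chart[OF c]) (use y(5,6) B0(1)[OF that] in \<open>auto simp: is_interval_oo\<close>)
    have 0: "0 \<in> {-\<epsilon><..<\<epsilon>}" "cot_patch A c (y (0, \<zeta>)) = cot_patch A c \<zeta>"
      using y(1) y(3)[OF B0(1)[OF that]] by auto
    show "t \<in> existence_interval A H (cot_patch A c \<zeta>)"
      "hamiltonian_flow A H t (cot_patch A c \<zeta>) = cot_patch A c (y (t, \<zeta>))"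
      using hamiltonian_flow_eq[OF curve 0 B0(2)[OF that]] by auto
  qed
  have cf: "chart_flow c z = y z" if "z \<in> B" for z
    using that flow(2)[of "fst z" "snd z"] y(5)[of "fst z" "snd z"] B0[of "fst z" "snd z"] c
    by (simp add: chart_flow_def)
  have ca: "chart_action c z = a z" if z: "z \<in> B" for z
  proof -
    obtain t \<zeta> where tz: "z = (t, \<zeta>)" by (cases z)
    define k where "k s = ?h (y (s, \<zeta>)) + fst (y (s, \<zeta>)) \<bullet> snd (field c (y (s, \<zeta>)))" for s
    have "t *\<^sub>R integral {0..1} (\<lambda>\<theta>. k (\<theta> * t)) = a (t, \<zeta>) - a (0, \<zeta>)"
    proof (rule scaled_integral_eq_diff[where T = "\<bar>t\<bar>"])
      fix s assume "s \<in> {-\<bar>t\<bar>..\<bar>t\<bar>}"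
      then have "(s, \<zeta>) \<in> B" by (intro Bs[OF z[unfolded tz]]) auto
      from y(7)[OF B0(2,1)[OF this]]
      show "((\<lambda>s. a (s, \<zeta>)) has_vector_derivative k s) (at s within {-\<bar>t\<bar>..\<bar>t\<bar>})"
        unfolding k_def by (rule has_vector_derivative_at_within)
    qed simp
    moreover have "integral {0..1} (\<lambda>\<theta>. k (\<theta> * t)) = integral {0..1} (\<lambda>\<theta>.
       let y = chart_flow c (\<theta> * t, \<zeta>) in ?h y + fst y \<bullet> snd (field c y))"
    proof (rule integral_cong)
      fix \<theta> :: real assume "\<theta> \<in> {0..1}"
      then have "\<bar>\<theta> * t\<bar> \<le> \<bar>t\<bar>" by (simp add: abs_mult mult_left_le_one_le)
      then have "(\<theta> * t, \<zeta>) \<in> B" by (rule Bs[OF z[unfolded tz]])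
      then show "k (\<theta> * t) = (let y = chart_flow c (\<theta> * t, \<zeta>) in ?h y + fst y \<bullet> snd (field c y))"
        by (simp add: k_def cf Let_def)
    qed
    ultimately show ?thesis
      using y(4)[OF B0(1)] z by (simp add: chart_action_def tz)
  qed
  have "flow_domain c B"
    unfolding flow_domain_def
  proof (intro conjI allI ballI impI B)
    show "B \<subseteq> UNIV \<times> UNIV \<times> ?U"
    proof
      fix z assume z: "z \<in> B"
      have "snd (y (0, snd z)) \<in> ?U" using y(1) y(5)[of 0 "snd z"] z by (auto simp: B_def)
      then show "z \<in> UNIV \<times> UNIV \<times> ?U" using y(3)[of "snd z"] z by (auto simp: B_def mem_Times_iff)
    qed
    show "Ck_on k B (chart_flow c)" for k
    proof -
      have "Ck_on k B (chart_flow c) \<longleftrightarrow> Ck_on k B y" by (rule Ck_on_cong[OF B cf])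
      then show ?thesis using y(2) by (simp add: smooth_on_def B_def)
    qed
    show "chart_flow c (0, \<zeta>) = \<zeta>" "chart_action c (0, \<zeta>) = fst \<zeta> \<bullet> snd \<zeta>" if "(0, \<zeta>) \<in> B" for \<zeta>
      using y(3,4)[OF B0(1)[OF that]] by (simp_all add: cf ca that)
    show "case z of (t, \<zeta>) \<Rightarrow> t \<in> existence_interval A H (cot_patch A c \<zeta>) \<and>
      hamiltonian_flow A H t (cot_patch A c \<zeta>) = cot_patch A c (chart_flow c (t, \<zeta>)) \<and>
      snd (chart_flow c (t, \<zeta>)) \<in> ?U" if "z \<in> B" for z
      using that flow[of "fst z" "snd z"] cf[OF that] y(5)[of "fst z" "snd z"] B0[of "fst z" "snd z"]
      by (simp add: case_prod_unfold)
    show "(chart_action c has_derivative (\<lambda>d. fst d * ?h (chart_flow c z) +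
      fst (snd d) \<bullet> snd (snd z) + fst (chart_flow c z) \<bullet> snd (fderiv (chart_flow c) z d))) (at z)"
      if z: "z \<in> B" for z
    proof -
      have "y differentiable (at z)"
        using y(2) z by (auto simp: smooth_on_def B_def dest: spec[of _ "Suc 0"])
      then have fd: "fderiv (chart_flow c) z = fderiv y z"
        by (rule frechet_derivative_transform_within_open[OF _ B z, symmetric]) (simp add: cf)
      have "(a has_derivative (\<lambda>d. fst d * ?h (y z) + fst (snd d) \<bullet> snd (snd z) +
          fst (y z) \<bullet> snd (fderiv y z d))) (at z)"
        using y(8)[OF B0(2)[of "fst z" "snd z"] B0(1)[of "fst z" "snd z"]] z by simp
      then show ?thesis
        unfolding fd cf[OF z]
        by (rule has_derivative_transform_within_open[OF _ B z]) (simp add: ca)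
    qed
  qed
  moreover have "(0, 0, x) \<in> B" using y(1) by (simp add: B_def)
  ultimately show thesis by (rule that)
qed

text \<open>The existence time may shrink towards the ends of the patch domain, so no product box
  will do; the union of all flow domains is taken.\<close>

lemma chart_flow_domain:
  assumes c: "c \<in> A"
  obtains D where "flow_domain c D" "zero_locus (patch_domain c) \<subseteq> D"
proof -
  define D where "D = \<Union> (Collect (flow_domain c))"
  have D: "\<exists>B. flow_domain c B \<and> z \<in> B" if "z \<in> D" for z using that by (auto simp: D_def)
  have "flow_domain c D"
    unfolding flow_domain_def
  proof (intro conjI allI)
    show "open D" unfolding D_def by (intro open_Union) (simp add: flow_domainD(1))
    show "D \<subseteq> UNIV \<times> UNIV \<times> patch_domain c" unfolding D_def by (rule Union_least) (simp add: flow_domain_def)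
    show "Ck_on k D (chart_flow c)" for k
    proof (rule Ck_on_localI)
      fix z assume "z \<in> D"
      from D[OF this] obtain B where B: "flow_domain c B" "z \<in> B" by blast
      show "\<exists>Y. open Y \<and> z \<in> Y \<and> Ck_on k Y (chart_flow c)"
        using flow_domainD(1,3)[OF B(1)] B(2) by blast
    qed
  qed (use D in \<open>unfold flow_domain_def, blast\<close>)+
  moreover have "zero_locus (patch_domain c) \<subseteq> D"
  proof
    fix z assume "z \<in> zero_locus (patch_domain c)"
    then obtain x where x: "x \<in> patch_domain c" "z = (0, 0, x)" by (auto simp: zero_locus_def)
    obtain B where "flow_domain c B" "(0, 0, x) \<in> B" by (rule chart_flow_near[OF c x(1)])
    then show "z \<in> D" unfolding D_def x(2) by blast
  qed
  ultimately show thesis by (rule that)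
qed

end

section \<open>The evolution micromorphism in a chart\<close>

definition partials_graph ::
  "(real \<times> (real^'n) \<times> (real^'n::finite) \<Rightarrow> real) \<Rightarrow> real \<times> (real^'n) \<times> (real^'n) \<Rightarrow> 'n evolution_coords" where
  "partials_graph S = (\<lambda>(t, p, Q). ((t, d_t S t p Q), (p, d_p S t p Q), (d_Q S t p Q, Q)))"

lemma generated_set_eq_image: "generated_set N S = partials_graph S ` N"
  by (force simp: generated_set_def partials_graph_def)

text \<open>Preimages of neighbourhoods of the core under the graph map become open, which is how
  germs enter the uniqueness proof.\<close>

lemma continuous_on_partials_graph:
  assumes N: "open N" and S: "smooth_on N S"
  shows "continuous_on N (partials_graph S)"
proof -
  have S1: "Ck_on (Suc 0) N S" using S by (simp add: smooth_on_def)
  let ?D = "\<lambda>z. fderiv S z"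
  have Dc: "continuous_on N (\<lambda>z. ?D z d)" for d using S1 unfolding Ck_on.simps by blast
  have "continuous_on N (\<lambda>z. ((fst z, ?D z (1, 0, 0)), (fst (snd z), (\<chi> i. ?D z (0, axis i 1, 0))),
      ((\<chi> i. ?D z (0, 0, axis i 1)), snd (snd z))))"
    by (intro continuous_intros Dc)
  then show ?thesis
  proof (rule continuous_on_cong[THEN iffD1, rotated -1, OF _ refl])
    fix z assume z: "z \<in> N"
    obtain t p Q where tpQ: "z = (t, p, Q)" by (cases z)
    have "S differentiable (at (t, p, Q))" using S1 z by (simp add: tpQ)
    from partials_eq_frechet_derivative(2-4)[OF this]
    show "((fst z, ?D z (1, 0, 0)), (fst (snd z), (\<chi> i. ?D z (0, axis i 1, 0))),
      ((\<chi> i. ?D z (0, 0, axis i 1)), snd (snd z))) = partials_graph S z"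
      by (simp add: tpQ partials_graph_def)
  qed
qed

text \<open>The conditions on f put the graph of dS through the core over the zero locus. The
  derivative in Q vanishes because S is 0 along the zero locus.\<close>

lemma partials_at_zero_locus:
  fixes S :: "real \<times> (real^'n) \<times> (real^'n::finite) \<Rightarrow> real"
  assumes N: "open N" "zero_locus U \<subseteq> N" and U: "open U" and S: "smooth_on N S"
    and f: "\<forall>(t, p, Q)\<in>N. S (t, p, Q) = p \<bullet> Q + t * h Q + f (t, p, Q)"
      "\<forall>Q\<in>U. f (0, 0, Q) = 0 \<and> d_t f 0 0 Q = 0 \<and> d_p f 0 0 Q = 0"
    and Q: "Q \<in> U"
  shows "S (0, 0, Q) = 0" "d_t S 0 0 Q = h Q" "d_p S 0 0 Q = Q" "d_Q S 0 0 Q = 0"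
proof -
  have zN: "(0, 0, Q) \<in> N" if "Q \<in> U" for Q using N(2) that by (auto simp: zero_locus_def)
  have S0: "S (0, 0, Q) = 0" if "Q \<in> U" for Q using f zN[OF that] that by fastforce
  show "S (0, 0, Q) = 0" by (rule S0[OF Q])
  have "Ck_on (Suc 0) N S" using S by (simp add: smooth_on_def)
  then have "S differentiable (at (0, 0, Q))" using zN[OF Q] by simp
  note d = partials_of_has_derivative(1,2)[OF partials_eq_frechet_derivative(1)[OF this]]
  have o1: "open ((\<lambda>s. (s, 0, Q)) -` N)" by (rule open_vimage[OF N(1)]) (intro continuous_intros)
  have o2: "open ((\<lambda>p. (0, p, Q)) -` N)" by (rule open_vimage[OF N(1)]) (intro continuous_intros)
  have f_eq: "f (t, p, Q) = S (t, p, Q) - p \<bullet> Q - t * h Q" if "(t, p, Q) \<in> N" for t p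
    using f(1) that by force
  have "((\<lambda>s. S (s, 0, Q) - s * h Q) has_real_derivative d_t S 0 0 Q - h Q) (at 0)"
    using d(1) by (auto intro!: derivative_eq_intros)
  then have "((\<lambda>s. f (s, 0, Q)) has_real_derivative d_t S 0 0 Q - h Q) (at 0)"
    by (rule has_field_derivative_transform_within_open[OF _ o1]) (use zN[OF Q] in \<open>simp_all add: f_eq\<close>)
  then have "d_t f 0 0 Q = d_t S 0 0 Q - h Q" unfolding d_t_def by (rule DERIV_imp_deriv)
  then show "d_t S 0 0 Q = h Q" using f(2) Q by simp
  have "((\<lambda>p. S (0, p, Q) - p \<bullet> Q) has_derivative (\<lambda>v. d_p S 0 0 Q \<bullet> v - v \<bullet> Q)) (at 0)"
    by (intro has_derivative_diff d(2) has_derivative_inner_left has_derivative_ident)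
  then have "((\<lambda>p. S (0, p, Q) - p \<bullet> Q) has_derivative (\<lambda>v. (d_p S 0 0 Q - Q) \<bullet> v)) (at 0)"
    by (rule has_derivative_eq_rhs) (simp add: fun_eq_iff inner_diff_left inner_commute[of Q])
  then have "((\<lambda>p. f (0, p, Q)) has_derivative (\<lambda>v. (d_p S 0 0 Q - Q) \<bullet> v)) (at 0)"
    by (rule has_derivative_transform_within_open[OF _ o2]) (use zN[OF Q] in \<open>simp_all add: f_eq\<close>)
  then have "d_p f 0 0 Q = d_p S 0 0 Q - Q" unfolding d_p_def by (rule gradient_unique)
  then show "d_p S 0 0 Q = Q" using f(2) Q by simp
  have "((\<lambda>Q. 0 :: real) has_derivative (\<lambda>v. 0 \<bullet> v)) (at Q)" by simp
  then have "((\<lambda>Q. S (0, 0, Q)) has_derivative (\<lambda>v. 0 \<bullet> v)) (at Q)"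
    by (rule has_derivative_transform_within_open[OF _ U Q]) (simp add: S0)
  then show "d_Q S 0 0 Q = 0" unfolding d_Q_def by (rule gradient_unique)
qed

section \<open>Membership in the restricted germ\<close>

context hamiltonian_system
begin

definition cot_patches ::
  "('m, 'n) chart \<Rightarrow> 'n evolution_coords \<Rightarrow> ('m, 'n) evolution_point" where
  "cot_patches c x = (fst x, cot_patch A c (fst (snd x)), cot_patch A c (snd (snd x)))"

lemma continuous_map_cot_patches:
  assumes c: "c \<in> A"
  shows "continuous_map (top_of_set (UNIV \<times> (UNIV \<times> patch_domain c) \<times> (UNIV \<times> patch_domain c)))
    (prod_topology euclidean (prod_topology (cotangent_topology A) (cotangent_topology A))) (cot_patches c)"
proof -
  let ?U = "UNIV \<times> patch_domain c :: ((real^'n) \<times> (real^'n)) set"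
  let ?T = "UNIV \<times> ?U \<times> ?U :: 'n evolution_coords set"
  have 1: "continuous_map (top_of_set ?T) euclidean fst"
    by (simp add: continuous_on_fst)
  have 2: "continuous_map (top_of_set ?T) (cotangent_topology A) (cot_patch A c \<circ> (\<lambda>x. fst (snd x)))"
    by (rule continuous_map_compose[OF _ continuous_map_cot_patch[OF c]], rule continuous_map_into_subtopology)
      (auto intro!: continuous_intros)
  have 3: "continuous_map (top_of_set ?T) (cotangent_topology A) (cot_patch A c \<circ> (\<lambda>x. snd (snd x)))"
    by (rule continuous_map_compose[OF _ continuous_map_cot_patch[OF c]], rule continuous_map_into_subtopology)
      (auto intro!: continuous_intros)
  show ?thesis
    using 1 2 3 unfolding cot_patches_def[abs_def] by (simp add: continuous_map_paired o_def)
qed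

text \<open>The cotangent chart is a bijection over its domain, so the image defining the
  restriction can be rewritten as a preimage under \<open>cot_patches\<close>.\<close>

lemma restrict_set_eq:
  assumes c: "c \<in> A"
  shows "x \<in> restrict_set A c W \<longleftrightarrow>
    snd (fst (snd x)) \<in> patch_domain c \<and> snd (snd (snd x)) \<in> patch_domain c \<and> cot_patches c x \<in> W"
proof
  assume "x \<in> restrict_set A c W"
  then obtain w where w: "w \<in> W \<inter> UNIV \<times> cotangent_over A c \<times> cotangent_over A c"
    "x = (\<lambda>(te, z, z'). (te, cot_chart c z, cot_chart c z')) w"
    unfolding restrict_set_def by blast
  obtain te z z' where "w = (te, z, z')" by (metis prod.collapse)
  with w have x: "x = (te, cot_chart c z, cot_chart c z')" "(te, z, z') \<in> W"
    and z: "z \<in> cotangent_over A c" "z' \<in> cotangent_over A c"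
    by simp_all
  have "snd (cot_chart c y) \<in> patch_domain c" if "y \<in> cotangent_over A c" for y
    using cotangent_overD(1)[OF that] by (simp add: cot_chart_def)
  then show "snd (fst (snd x)) \<in> patch_domain c \<and> snd (snd (snd x)) \<in> patch_domain c \<and> cot_patches c x \<in> W"
    using x z c by (simp add: cot_patches_def)
next
  assume x: "snd (fst (snd x)) \<in> patch_domain c \<and> snd (snd (snd x)) \<in> patch_domain c \<and> cot_patches c x \<in> W"
  have "x = (\<lambda>(te, z, z'). (te, cot_chart c z, cot_chart c z')) (cot_patches c x)"
    using x c by (simp add: cot_patches_def prod_eq_iff)
  moreover have "cot_patches c x \<in> W \<inter> UNIV \<times> cotangent_over A c \<times> cotangent_over A c"
    using x c by (simp add: cot_patches_def)
  ultimately show "x \<in> restrict_set A c W"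
    unfolding restrict_set_def by (rule image_eqI)
qed

lemma cot_patches_in_evolution_submanifold:
  assumes "cot_patches c ((t, e), \<zeta>, \<zeta>') \<in> evolution_submanifold A H"
  shows "H (hamiltonian_flow A H t (cot_patch A c \<zeta>)) = e" "cot_patch A c \<zeta>' = hamiltonian_flow A H t (cot_patch A c \<zeta>)"
  using assms by (auto simp: cot_patches_def evolution_submanifold_def)

text \<open>Where the trajectory is known to end over the chart, the source data (t, p, q) determine
  the remaining coordinates, and the submanifold is a graph over V.\<close>

lemma restrict_evolution_submanifold:
  assumes c: "c \<in> A" and V: "V \<subseteq> UNIV \<times> UNIV \<times> patch_domain c"
    and flow: "\<And>t \<zeta>. (t, \<zeta>) \<in> V \<Longrightarrow> t \<in> existence_interval A H (cot_patch A c \<zeta>) \<and>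
      hamiltonian_flow A H t (cot_patch A c \<zeta>) = cot_patch A c (chart_flow c (t, \<zeta>)) \<and>
      snd (chart_flow c (t, \<zeta>)) \<in> patch_domain c"
    and x: "(fst (fst x), fst (snd x)) \<in> V"
  shows "x \<in> restrict_set A c (evolution_submanifold A H) \<longleftrightarrow>
    (let y = chart_flow c (fst (fst x), fst (snd x)) in snd (fst x) = in_chart A c H y \<and> snd (snd x) = y)"
proof -
  obtain t e \<zeta> \<zeta>' where tx: "x = ((t, e), \<zeta>, \<zeta>')" by (metis prod.collapse)
  have z: "(t, \<zeta>) \<in> V" using x by (simp add: tx)
  define y where "y = chart_flow c (t, \<zeta>)"
  have \<zeta>: "snd \<zeta> \<in> patch_domain c" using z V by (auto simp: mem_Times_iff)
  have fl: "t \<in> existence_interval A H (cot_patch A c \<zeta>)" "snd y \<in> patch_domain c"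
    "hamiltonian_flow A H t (cot_patch A c \<zeta>) = cot_patch A c y"
    using flow[OF z] by (auto simp: y_def)
  have over: "cot_patch A c \<zeta> \<in> cotangent_bundle A"
    by (rule cotangent_overD(2)[OF cot_patch_in_over[OF c \<zeta>]])
  have "x \<in> restrict_set A c (evolution_submanifold A H) \<longleftrightarrow> e = in_chart A c H y \<and> \<zeta>' = y"
  proof
    assume "x \<in> restrict_set A c (evolution_submanifold A H)"
    then have *: "snd \<zeta>' \<in> patch_domain c" "cot_patches c ((t, e), \<zeta>, \<zeta>') \<in> evolution_submanifold A H"
      unfolding restrict_set_eq[OF c] by (simp_all add: tx)
    note ** = cot_patches_in_evolution_submanifold[OF *(2), unfolded fl(3)]
    have "\<zeta>' = y" using **(2) cot_chart_patch[OF c *(1)] cot_chart_patch[OF c fl(2)] by metis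
    then show "e = in_chart A c H y \<and> \<zeta>' = y" using **(1) by (simp add: in_chart_def)
  next
    assume eq: "e = in_chart A c H y \<and> \<zeta>' = y"
    have "cot_patches c x = ((t, H (hamiltonian_flow A H t (cot_patch A c \<zeta>))), cot_patch A c \<zeta>,
        hamiltonian_flow A H t (cot_patch A c \<zeta>))"
      using eq by (simp add: tx cot_patches_def fl(3) in_chart_def)
    then have "cot_patches c x \<in> evolution_submanifold A H"
      unfolding evolution_submanifold_def using over fl(1) by blast
    then show "x \<in> restrict_set A c (evolution_submanifold A H)"
      unfolding restrict_set_eq[OF c] using \<zeta> fl(2) eq by (simp add: tx)
  qed
  then show ?thesis by (simp add: tx y_def Let_def)
qed

lemma core_graph_in_chart_evolution_core:
  assumes c: "c \<in> A"
  shows "core_graph_in_chart (patch_domain c) (core_in_chart c (evolution_core H)) =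
    {((0, in_chart A c H (0, x)), (0, x), (0, x)) |x. x \<in> patch_domain c}"
  using c by (force simp: core_graph_in_chart_def core_in_chart_def evolution_core_def in_chart_def cot_patch_zero)

abbreviation evolution_topology :: "('m, 'n) evolution_point topology" where
  "evolution_topology \<equiv> prod_topology euclidean (prod_topology (cotangent_topology A) (cotangent_topology A))"

lemma core_graph_subset: "core_graph (evolution_core H) \<subseteq> topspace evolution_topology"
  by (auto simp: core_graph_def zero_covector_def cotangent_bundle_def)

text \<open>The restriction is a union over all representatives in the bundle, so comparison with a
  single one near the core suffices.\<close>

lemma in_restricted_micromorphismI:
  assumes c: "c \<in> A" and N: "open N" "core_graph_in_chart (patch_domain c) (core_in_chart c (evolution_core H)) \<subseteq> N"
    and X: "X \<subseteq> UNIV \<times> (UNIV \<times> patch_domain c) \<times> (UNIV \<times> patch_domain c)"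
    and eq: "X \<inter> N = restrict_set A c (evolution_submanifold A H) \<inter> N"
  shows "X \<in> fst (restrict_micromorphism A c (evolution_micromorphism A H))"
proof -
  let ?T = "UNIV \<times> (UNIV \<times> patch_domain c) \<times> (UNIV \<times> patch_domain c) :: 'n evolution_coords set"
  \<comment> \<open>Germs contain only subsets of the total space; the intersection makes this
    immediate.\<close>
  let ?W = "evolution_submanifold A H \<inter> topspace evolution_topology"
  have Wg: "?W \<in> set_germ evolution_topology (core_graph (evolution_core H)) (evolution_submanifold A H)"
    unfolding set_germ_def using core_graph_subset by blast
  have eq_r: "restrict_set A c ?W = restrict_set A c (evolution_submanifold A H)"
  proof -
    have "cot_patches c x \<in> topspace evolution_topology"
      if "snd (fst (snd x)) \<in> patch_domain c" "snd (snd (snd x)) \<in> patch_domain c" for x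
      using cotangent_overD(2)[OF cot_patch_in_over[OF c that(1)]] cotangent_overD(2)[OF cot_patch_in_over[OF c that(2)]]
      by (simp add: cot_patches_def)
    then show ?thesis unfolding set_eq_iff restrict_set_eq[OF c] by blast
  qed
  have "X \<in> set_germ (top_of_set ?T) (core_graph_in_chart (patch_domain c) (core_in_chart c (evolution_core H)))
      (restrict_set A c (evolution_submanifold A H))"
    unfolding set_germ_def
  proof (intro CollectI conjI exI[of _ "?T \<inter> N"])
    show "openin (top_of_set ?T) (?T \<inter> N)" using N(1) by (simp add: openin_open_Int)
    show "core_graph_in_chart (patch_domain c) (core_in_chart c (evolution_core H)) \<subseteq> ?T \<inter> N"
      using N(2) unfolding core_graph_in_chart_evolution_core[OF c] by auto
  qed (use X eq in auto)
  then show ?thesis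
    unfolding restrict_micromorphism_def evolution_micromorphism_def fst_conv snd_conv
    by (intro UN_I[OF Wg]) (simp only: eq_r)
qed

text \<open>Two neighbourhoods of the core are involved, one in the bundle and one in the chart; the
  first is pulled back by \<open>cot_patches\<close> and intersected with the second.\<close>

lemma in_restricted_micromorphismD:
  assumes c: "c \<in> A" and X: "X \<in> fst (restrict_micromorphism A c (evolution_micromorphism A H))"
  obtains N where "open N" "core_graph_in_chart (patch_domain c) (core_in_chart c (evolution_core H)) \<subseteq> N"
    "X \<inter> N = restrict_set A c (evolution_submanifold A H) \<inter> N"
proof -
  let ?T = "UNIV \<times> (UNIV \<times> patch_domain c) \<times> (UNIV \<times> patch_domain c) :: 'n evolution_coords set"
  let ?K = "core_graph_in_chart (patch_domain c) (core_in_chart c (evolution_core H))"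
  have T: "open ?T" using chart(2)[OF c] by (intro open_Times open_UNIV)
  obtain W where W: "W \<in> set_germ evolution_topology (core_graph (evolution_core H)) (evolution_submanifold A H)"
    and XW: "X \<in> set_germ (top_of_set ?T) ?K (restrict_set A c W)"
    using X by (auto simp: restrict_micromorphism_def evolution_micromorphism_def)
  obtain M where M: "openin evolution_topology M" "core_graph (evolution_core H) \<subseteq> M"
    "W \<inter> M = evolution_submanifold A H \<inter> M"
    using W unfolding set_germ_def by blast
  obtain N where N: "openin (top_of_set ?T) N" "?K \<subseteq> N" "X \<inter> N = restrict_set A c W \<inter> N"
    using XW unfolding set_germ_def by blast
  define N' where "N' = N \<inter> {x \<in> topspace (top_of_set ?T). cot_patches c x \<in> M}"
  have "openin (top_of_set ?T) N'"
    unfolding N'_def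
    by (intro openin_Int N(1) openin_continuous_map_preimage[OF continuous_map_cot_patches[OF c] M(1)])
  then have "open N'" using T by (simp add: openin_open_eq)
  moreover have "?K \<subseteq> N'"
  proof
    fix k assume k: "k \<in> ?K"
    then obtain x where x: "k = ((0, in_chart A c H (0, x)), (0, x), (0, x))" "x \<in> patch_domain c"
      unfolding core_graph_in_chart_evolution_core[OF c] by blast
    have "cot_patches c k \<in> core_graph (evolution_core H)"
      unfolding core_graph_def evolution_core_def
      by (intro CollectI exI[of _ "patch c x"]) (use c x in \<open>simp add: cot_patches_def in_chart_def cot_patch_zero\<close>)
    then show "k \<in> N'" using k N(2) M(2) x by (auto simp: N'_def)
  qed
  moreover have "X \<inter> N' = restrict_set A c (evolution_submanifold A H) \<inter> N'"
  proof -
    have "x \<in> restrict_set A c W \<longleftrightarrow> x \<in> restrict_set A c (evolution_submanifold A H)" if "x \<in> N'" for x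
      unfolding restrict_set_eq[OF c] using that M(3) by (auto simp: N'_def)
    moreover have "N' \<subseteq> N" by (auto simp: N'_def)
    ultimately show ?thesis using N(3) by blast
  qed
  ultimately show thesis by (rule that)
qed

end

lemma mixed_coords_at_zero:
  "\<phi> (0, p, Q) = (p, Q) \<Longrightarrow> mixed_coords \<phi> (0, p, Q) = (0, p, Q)"
  by (simp add: mixed_coords_def)

section \<open>Existence and uniqueness of the generating function\<close>

context hamiltonian_system
begin

context
  fixes c V g
  assumes c: "c \<in> A"
    and dom: "flow_domain c V"
    and V2: "zero_locus (patch_domain c) \<subseteq> V"
    and V4: "open (mixed_coords (chart_flow c) ` V)"
    and g: "\<And>z. z \<in> V \<Longrightarrow> g (mixed_coords (chart_flow c) z) = z"
    and Sg: "smooth_on (mixed_coords (chart_flow c) ` V) (\<lambda>n. chart_action c (g n))"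
      "\<And>n. n \<in> mixed_coords (chart_flow c) ` V \<Longrightarrow> ((\<lambda>n. chart_action c (g n)) has_derivative
        (\<lambda>d. fst d * in_chart A c H (chart_flow c (g n)) + fst (snd d) \<bullet> snd (snd (g n)) +
          fst (chart_flow c (g n)) \<bullet> snd (snd d))) (at n)"
begin

lemmas domain_props = flow_domainD(1)[OF dom] V2 flow_domainD(2)[OF dom] V4
lemmas domain_at_zero = flow_domainD(4,5)[OF dom]
lemmas domain_flow = flow_domainD(6)[OF dom]


text \<open>The flow is the identity at t = 0, so mixed coordinates do not move the zero
  locus.\<close>

lemma zero_locus_subset_mixed: "zero_locus (patch_domain c) \<subseteq> mixed_coords (chart_flow c) ` V"
proof
  fix z assume z: "z \<in> zero_locus (patch_domain c)"
  then have zV: "z \<in> V" using domain_props(2) by blast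
  moreover have "mixed_coords (chart_flow c) z = z"
    using z zV domain_at_zero(1) by (auto simp: zero_locus_def intro!: mixed_coords_at_zero)
  ultimately show "z \<in> mixed_coords (chart_flow c) ` V" by (intro image_eqI[of z _ z]) simp_all
qed

lemma g_at_zero: "(0, p, Q) \<in> V \<Longrightarrow> g (0, p, Q) = (0, p, Q)"
  using g[of "(0, p, Q)"] mixed_coords_at_zero[of "chart_flow c" p Q] domain_at_zero(1)[of "(p, Q)"] by simp

text \<open>Parametrized by mixed coordinates, the graph of dS is the graph of the flow over V,
  energy included; near the core that is the evolution submanifold.\<close>

lemma action_generating_function:
  "local_generating_function A H c (\<lambda>n. chart_action c (g n))"
proof -
  let ?\<phi> = "chart_flow c" and ?h = "in_chart A c H" and ?U = "patch_domain c"
  let ?\<Psi> = "mixed_coords ?\<phi>"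
  let ?N = "?\<Psi> ` V"
  define S where "S n = chart_action c (g n)" for n
  have dS: "d_t S t p Q = ?h (?\<phi> (g (t, p, Q)))" "d_p S t p Q = snd (snd (g (t, p, Q)))"
    "d_Q S t p Q = fst (?\<phi> (g (t, p, Q)))" if "(t, p, Q) \<in> ?N" for t p Q
    using partials_of_has_derivative(3-5)[OF Sg(2)[OF that]] by (simp_all add: S_def[abs_def])
  have graph: "partials_graph S (?\<Psi> z) = ((fst z, ?h (?\<phi> z)), snd z, ?\<phi> z)" if z: "z \<in> V" for z
  proof -
    have n: "(fst z, fst (snd z), snd (?\<phi> z)) \<in> ?N" using z by (force simp: mixed_coords_def)
    have gz: "g (fst z, fst (snd z), snd (?\<phi> z)) = z" using g[OF z] by (simp add: mixed_coords_def)
    show ?thesis using dS[OF n] by (simp add: partials_graph_def mixed_coords_def gz)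
  qed
  define f where "f = (\<lambda>(t, p, Q). S (t, p, Q) - p \<bullet> Q - t * ?h (0, Q))"
  have f: "f (0, 0, Q) = 0 \<and> d_t f 0 0 Q = 0 \<and> d_p f 0 0 Q = 0" if Q: "Q \<in> ?U" for Q
  proof -
    have zV: "(0, 0, Q) \<in> V" and zN: "(0, 0, Q) \<in> ?N"
      using domain_props(2) zero_locus_subset_mixed Q by (auto simp: zero_locus_def)
    have gz: "g (0, 0, Q) = (0, 0, Q)" by (rule g_at_zero[OF zV])
    have "f (0, 0, Q) = 0" using domain_at_zero(2)[OF zV] by (simp add: f_def S_def gz)
    moreover have d: "((\<lambda>s. S (s, 0, Q)) has_real_derivative ?h (0, Q)) (at 0)"
      "((\<lambda>p. S (0, p, Q)) has_derivative (\<lambda>v. Q \<bullet> v)) (at 0)"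
      using partials_of_has_derivative(1,2)[OF Sg(2)[OF zN]] domain_at_zero(1)[OF zV] by (simp_all add: S_def[abs_def] gz)
    have "((\<lambda>s. f (s, 0, Q)) has_real_derivative 0) (at 0)"
      unfolding f_def using d(1) by (auto intro!: derivative_eq_intros)
    then have "d_t f 0 0 Q = 0" unfolding d_t_def by (rule DERIV_imp_deriv)
    moreover have "((\<lambda>p. S (0, p, Q) - p \<bullet> Q) has_derivative (\<lambda>v. Q \<bullet> v - v \<bullet> Q)) (at 0)"
      by (intro has_derivative_diff d(2) has_derivative_inner_left has_derivative_ident)
    then have "((\<lambda>p. f (0, p, Q)) has_derivative (\<lambda>v. 0 \<bullet> v)) (at 0)"
      by (simp add: f_def inner_commute)
    then have "d_p f 0 0 Q = 0" unfolding d_p_def by (rule gradient_unique)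
    ultimately show ?thesis by blast
  qed
  have "generated_set ?N S \<in> fst (restrict_micromorphism A c (evolution_micromorphism A H))"
  \<comment> \<open>This neighbourhood of the core restricts only the source data (t, p, q); over V
    both sets are the same graph.\<close>
  proof (rule in_restricted_micromorphismI[OF c, where N = "{x. (fst (fst x), fst (snd x)) \<in> V}"])
    have "open ((\<lambda>x :: 'n evolution_coords. (fst (fst x), fst (snd x))) -` V)"
      by (rule open_vimage[OF domain_props(1)]) (intro continuous_intros)
    then show "open {x :: 'n evolution_coords. (fst (fst x), fst (snd x)) \<in> V}" by (simp add: vimage_def)
    show "core_graph_in_chart ?U (core_in_chart c (evolution_core H)) \<subseteq> {x. (fst (fst x), fst (snd x)) \<in> V}"
      unfolding core_graph_in_chart_evolution_core[OF c] using domain_props(2) by (auto simp: zero_locus_def)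
    show "generated_set ?N S \<subseteq> UNIV \<times> (UNIV \<times> ?U) \<times> (UNIV \<times> ?U)"
      unfolding generated_set_eq_image
    proof (intro image_subsetI)
      fix n assume "n \<in> ?N"
      then obtain z where z: "z \<in> V" "n = ?\<Psi> z" by blast
      have "snd (snd z) \<in> ?U" using z(1) domain_props(3) by (auto simp: mem_Times_iff)
      moreover have "snd (?\<phi> z) \<in> ?U" using domain_flow[of "fst z" "snd z"] z(1) by simp
      ultimately show "partials_graph S n \<in> UNIV \<times> (UNIV \<times> ?U) \<times> (UNIV \<times> ?U)"
        unfolding z(2) graph[OF z(1)] by (simp add: mem_Times_iff)
    qed
    have "x \<in> generated_set ?N S \<longleftrightarrow> x \<in> restrict_set A c (evolution_submanifold A H)"
      if x: "(fst (fst x), fst (snd x)) \<in> V" for x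
    proof -
      have "x \<in> generated_set ?N S \<longleftrightarrow> (\<exists>z\<in>V. x = ((fst z, ?h (?\<phi> z)), snd z, ?\<phi> z))"
        unfolding generated_set_eq_image image_image using graph by auto
      also have "\<dots> \<longleftrightarrow> (let y = ?\<phi> (fst (fst x), fst (snd x)) in snd (fst x) = ?h y \<and> snd (snd x) = y)"
        using x by (cases x) (force simp: Let_def)
      also have "\<dots> \<longleftrightarrow> x \<in> restrict_set A c (evolution_submanifold A H)"
        by (rule restrict_evolution_submanifold[OF c domain_props(3) domain_flow x, symmetric])
      finally show ?thesis .
    qed
    then show "generated_set ?N S \<inter> {x. (fst (fst x), fst (snd x)) \<in> V} =
        restrict_set A c (evolution_submanifold A H) \<inter> {x. (fst (fst x), fst (snd x)) \<in> V}"
      by blast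
  qed
  moreover have "?N \<subseteq> UNIV \<times> UNIV \<times> ?U"
  proof
    fix n assume "n \<in> ?N"
    then obtain z where z: "z \<in> V" "n = ?\<Psi> z" by blast
    show "n \<in> UNIV \<times> UNIV \<times> ?U"
      using domain_flow[of "fst z" "snd z"] z by (simp add: mixed_coords_def)
  qed
  moreover have "\<forall>(t, p, Q)\<in>?N. S (t, p, Q) = p \<bullet> Q + t * ?h (0, Q) + f (t, p, Q)"
    by (auto simp: f_def)
  ultimately have "local_generating_function A H c S"
    unfolding local_generating_function_def
    using domain_props(4) zero_locus_subset_mixed Sg(1) f by (intro exI[of _ ?N] exI[of _ f]) (simp add: S_def[abs_def])
  then show ?thesis by (simp add: S_def[abs_def])
qed

text \<open>The derivative in p supplies the initial position: lying in the flow graph means that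
  the flow takes (p, \<open>d_p S\<close>) to (\<open>d_Q S\<close>, Q), with energy
  \<open>d_t S\<close>. So S and the transported action have the same differential.\<close>

lemma generating_function_near:
  assumes S: "local_generating_function A H c S" and Q0: "Q0 \<in> patch_domain c"
  obtains B where "open B" "(0, 0, Q0) \<in> B" "B \<subseteq> UNIV \<times> UNIV \<times> patch_domain c" "B \<subseteq> V"
    "\<And>n. n \<in> B \<Longrightarrow> S n = chart_action c (g n)"
    "\<And>t p Q. (t, p, Q) \<in> B \<Longrightarrow> d_t S t p Q = in_chart A c H (d_Q S t p Q, Q)"
proof -
  let ?\<phi> = "chart_flow c" and ?h = "in_chart A c H" and ?U = "patch_domain c"
  let ?\<Psi> = "mixed_coords ?\<phi>"
  obtain N f where N: "open N" "zero_locus ?U \<subseteq> N" "N \<subseteq> UNIV \<times> UNIV \<times> ?U" "smooth_on N S"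
    and f: "\<forall>(t, p, Q)\<in>N. S (t, p, Q) = p \<bullet> Q + t * ?h (0, Q) + f (t, p, Q)"
      "\<forall>Q\<in>?U. f (0, 0, Q) = 0 \<and> d_t f 0 0 Q = 0 \<and> d_p f 0 0 Q = 0"
    and gen: "generated_set N S \<in> fst (restrict_micromorphism A c (evolution_micromorphism A H))"
    using S unfolding local_generating_function_def by blast
  have S0: "S (0, 0, Q0) = 0" "d_t S 0 0 Q0 = ?h (0, Q0)" "d_p S 0 0 Q0 = Q0" "d_Q S 0 0 Q0 = 0"
    using partials_at_zero_locus[OF N(1,2) chart(2)[OF c] N(4) f Q0] by auto
  obtain M where M: "open M" "core_graph_in_chart ?U (core_in_chart c (evolution_core H)) \<subseteq> M"
    "generated_set N S \<inter> M = restrict_set A c (evolution_submanifold A H) \<inter> M"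
    by (rule in_restricted_micromorphismD[OF c gen])
  \<comment> \<open>Besides being close to the core, the source data must lie in V, where the
    submanifold is known to be a graph.\<close>
  define M' where "M' = M \<inter> (\<lambda>x. (fst (fst x), fst (snd x))) -` V"
  have "open ((\<lambda>x :: 'n evolution_coords. (fst (fst x), fst (snd x))) -` V)"
    by (rule open_vimage[OF domain_props(1)]) (intro continuous_intros)
  then have "open M'" unfolding M'_def using M(1) by (intro open_Int)
  then have "open (N \<inter> partials_graph S -` M')"
    by (rule continuous_open_preimage[OF continuous_on_partials_graph[OF N(1,4)] N(1)])
  then have op: "open (N \<inter> partials_graph S -` M' \<inter> V)" using domain_props(1) by (rule open_Int)
  have z0: "(0, 0, Q0) \<in> N" "(0, 0, Q0) \<in> V" using N(2) domain_props(2) Q0 by (auto simp: zero_locus_def)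
  have "partials_graph S (0, 0, Q0) \<in> M"
    using M(2) Q0 unfolding core_graph_in_chart_evolution_core[OF c] by (auto simp: partials_graph_def S0)
  then have "(0, 0, Q0) \<in> N \<inter> partials_graph S -` M' \<inter> V"
    using z0 by (simp add: M'_def partials_graph_def S0)
  then obtain e where e: "0 < e" "coord_box e Q0 \<subseteq> N \<inter> partials_graph S -` M' \<inter> V"
    using coord_box_in_open[OF op] by blast
  let ?B = "coord_box e Q0"
  have key: "(t, p, d_p S t p Q) \<in> V" "?\<phi> (t, p, d_p S t p Q) = (d_Q S t p Q, Q)"
    "d_t S t p Q = ?h (d_Q S t p Q, Q)" if B: "(t, p, Q) \<in> ?B" for t p Q
  proof -
    let ?x = "partials_graph S (t, p, Q)"
    have tN: "(t, p, Q) \<in> N" and x: "?x \<in> M" and xV: "(fst (fst ?x), fst (snd ?x)) \<in> V"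
      using e(2) B by (auto simp: M'_def)
    have "?x \<in> generated_set N S" unfolding generated_set_eq_image using tN by (rule imageI)
    then have "?x \<in> restrict_set A c (evolution_submanifold A H)" using M(3) x by blast
    then have *: "let y = ?\<phi> (fst (fst ?x), fst (snd ?x)) in snd (fst ?x) = ?h y \<and> snd (snd ?x) = y"
      using restrict_evolution_submanifold[OF c domain_props(3) domain_flow xV] by blast
    show "(t, p, d_p S t p Q) \<in> V" using xV by (simp add: partials_graph_def)
    show "?\<phi> (t, p, d_p S t p Q) = (d_Q S t p Q, Q)" "d_t S t p Q = ?h (d_Q S t p Q, Q)"
      using * by (simp_all add: partials_graph_def Let_def)
  qed
  have eq: "S n = chart_action c (g n)" if n: "n \<in> ?B" for n
  proof -
    have "((\<lambda>n. S n - chart_action c (g n)) has_derivative (\<lambda>d. 0)) (at n within ?B)" if nB: "n \<in> ?B" for n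
    proof -
      obtain t p Q where tpQ: "n = (t, p, Q)" by (cases n)
      note k = key[OF nB[unfolded tpQ]]
      \<comment> \<open>The flow ends over Q, so n consists of the mixed coordinates of (t, p,
        \<open>d_p S t p Q\<close>), which is therefore g n.\<close>
      have \<Psi>: "?\<Psi> (t, p, d_p S t p Q) = n" using k(2) by (simp add: mixed_coords_def tpQ)
      have nN: "n \<in> ?\<Psi> ` V" by (rule image_eqI[of n ?\<Psi>, OF \<Psi>[symmetric] k(1)])
      have gn: "g n = (t, p, d_p S t p Q)" using g[OF k(1)] \<Psi> by simp
      have "n \<in> N" using nB e(2) by blast
      then have "S differentiable (at n)"
        using N(4) by (auto simp: smooth_on_def dest: spec[of _ "Suc 0"])
      then have 1: "(S has_derivative (\<lambda>d. fst d * d_t S t p Q + fst (snd d) \<bullet> d_p S t p Q + d_Q S t p Q \<bullet> snd (snd d))) (at n)"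
        unfolding tpQ by (rule partials_eq_frechet_derivative(1))
      have 2: "((\<lambda>n. chart_action c (g n)) has_derivative
          (\<lambda>d. fst d * d_t S t p Q + fst (snd d) \<bullet> d_p S t p Q + d_Q S t p Q \<bullet> snd (snd d))) (at n)"
        using Sg(2)[OF nN] by (simp add: gn k(2) k(3)[symmetric])
      show ?thesis
        using has_derivative_at_withinI[OF has_derivative_diff[OF 1 2]] by simp
    qed
    \<comment> \<open>Two functions with equal differentials on a convex box coincide once they
      agree at its centre; both are 0 there.\<close>
    moreover have "(0, 0, Q0) \<in> ?B" by (rule center_in_coord_box[OF e(1)])
    moreover have "S (0, 0, Q0) - chart_action c (g (0, 0, Q0)) = 0"
      using S0(1) domain_at_zero(2)[OF z0(2)] g_at_zero[OF z0(2)] by simp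
    ultimately have "S n - chart_action c (g n) = 0"
      using has_derivative_zero_unique[OF convex_coord_box _ n, of "\<lambda>n. S n - chart_action c (g n)" "(0, 0, Q0)"]
      by simp
    then show ?thesis by simp
  qed
  show thesis
  proof (rule that[of ?B])
    show "?B \<subseteq> UNIV \<times> UNIV \<times> ?U" using e(2) N(3) by blast
    show "?B \<subseteq> V" using e(2) by blast
  qed (use e open_coord_box center_in_coord_box eq key(3) in auto)
qed

text \<open>The boxes vary with Q. On their union, an open neighbourhood of the whole zero locus, S
  equals the transported action, and both claims are checked there pointwise.\<close>

lemma generating_function_unique:
  assumes S: "local_generating_function A H c S"
  shows "function_germ (zero_locus (patch_domain c)) S =
      function_germ (zero_locus (patch_domain c)) (\<lambda>n. chart_action c (g n))"
    and "solves_hamilton_jacobi (patch_domain c) (in_chart A c H) S"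
proof -
  let ?U = "patch_domain c"
  define good where "good B \<longleftrightarrow> open B \<and> B \<subseteq> UNIV \<times> UNIV \<times> ?U \<and> B \<subseteq> V \<and>
    (\<forall>n\<in>B. S n = chart_action c (g n)) \<and>
    (\<forall>t p Q. (t, p, Q) \<in> B \<longrightarrow> d_t S t p Q = in_chart A c H (d_Q S t p Q, Q))" for B
  define N where "N = \<Union> (Collect good)"
  have "\<exists>B. good B \<and> (0, 0, Q) \<in> B" if Q: "Q \<in> ?U" for Q
    by (rule generating_function_near[OF S Q]) (auto simp: good_def)
  then have N: "zero_locus ?U \<subseteq> N" by (fastforce simp: N_def zero_locus_def)
  have oN: "open N" unfolding N_def by (intro open_Union) (simp add: good_def)
  have eq: "S n = chart_action c (g n)" if "n \<in> N" for n using that by (auto simp: N_def good_def)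
  show "function_germ (zero_locus ?U) S = function_germ (zero_locus ?U) (\<lambda>n. chart_action c (g n))"
    unfolding function_germ_def
  proof (intro Collect_cong iffI; elim exE conjE)
    fix S' W assume W: "open W" "zero_locus ?U \<subseteq> W" "\<forall>n\<in>W. S' n = S n"
    then show "\<exists>W. open W \<and> zero_locus ?U \<subseteq> W \<and> (\<forall>n\<in>W. S' n = chart_action c (g n))"
      using N oN eq by (intro exI[of _ "W \<inter> N"]) auto
  next
    fix S' W assume W: "open W" "zero_locus ?U \<subseteq> W" "\<forall>n\<in>W. S' n = chart_action c (g n)"
    then show "\<exists>W. open W \<and> zero_locus ?U \<subseteq> W \<and> (\<forall>n\<in>W. S' n = S n)"
      using N oN eq by (intro exI[of _ "W \<inter> N"]) auto
  qed
  \<comment> \<open>At t = 0 the inverse g is the identity and the action has its initial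
    value.\<close>
  have "S (0, p, Q) = p \<bullet> Q" if "(0, p, Q) \<in> N" for p Q
  proof -
    have "(0, p, Q) \<in> V" using that by (auto simp: N_def good_def)
    then show ?thesis using eq[OF that] domain_at_zero(2) g_at_zero by simp
  qed
  moreover have "N \<subseteq> UNIV \<times> UNIV \<times> ?U" unfolding N_def by (rule Union_least) (simp add: good_def)
  moreover have "\<forall>(t, p, Q)\<in>N. d_t S t p Q = in_chart A c H (d_Q S t p Q, Q)"
    by (auto simp: N_def good_def)
  ultimately show "solves_hamilton_jacobi ?U (in_chart A c H) S"
    unfolding solves_hamilton_jacobi_def using N oN by (intro exI[of _ N]) simp
qed

end

text \<open>The transported action supplies existence, and every other generating function is
  compared with it, so uniqueness concerns the germ and not the function.\<close>

theorem local_generating_function_exists_unique: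
  assumes c: "c \<in> A"
  shows "(\<exists>!g. \<exists>S. g = function_germ (zero_locus (patch_domain c)) S \<and>
            local_generating_function A H c S) \<and>
         (\<forall>S. local_generating_function A H c S \<longrightarrow>
            solves_hamilton_jacobi (patch_domain c) (in_chart A c H) S)"
proof -
  obtain D where D: "flow_domain c D" "zero_locus (patch_domain c) \<subseteq> D"
    by (rule chart_flow_domain[OF c])
  note dom = flow_domainD[OF D(1)]
  obtain V g where V: "open V" "zero_locus (patch_domain c) \<subseteq> V" "V \<subseteq> D" "open (mixed_coords (chart_flow c) ` V)"
    "\<And>z. z \<in> V \<Longrightarrow> g (mixed_coords (chart_flow c) z) = z"
    "smooth_on (mixed_coords (chart_flow c) ` V) (\<lambda>n. chart_action c (g n))"
    "\<And>n. n \<in> mixed_coords (chart_flow c) ` V \<Longrightarrow> ((\<lambda>n. chart_action c (g n)) has_derivative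
      (\<lambda>d. fst d * in_chart A c H (chart_flow c (g n)) + fst (snd d) \<bullet> snd (snd (g n)) +
        fst (chart_flow c (g n)) \<bullet> snd (snd d))) (at n)"
    by (rule generating_function_of_characteristics[OF chart(2)[OF c] in_chart_Ck[OF c] dom(1) D(2) dom(3,4) _ dom(7)])
      (assumption | rule that | use dom(6) in force)+
  note hyps = c flow_domain_subset[OF D(1) V(1,3)] V(2,4-7)
  have lgf: "local_generating_function A H c (\<lambda>n. chart_action c (g n))"
    by (rule action_generating_function[OF hyps])
  have uniq: "function_germ (zero_locus (patch_domain c)) S =
      function_germ (zero_locus (patch_domain c)) (\<lambda>n. chart_action c (g n))"
    and HJ: "solves_hamilton_jacobi (patch_domain c) (in_chart A c H) S"
    if "local_generating_function A H c S" for S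
    by (rule generating_function_unique[OF hyps that], assumption+)+
  show ?thesis
  proof (intro conjI ex1I allI impI)
    show "\<exists>S. function_germ (zero_locus (patch_domain c)) (\<lambda>n. chart_action c (g n)) =
        function_germ (zero_locus (patch_domain c)) S \<and> local_generating_function A H c S"
      using lgf by blast
    show "G = function_germ (zero_locus (patch_domain c)) (\<lambda>n. chart_action c (g n))"
      if "\<exists>S. G = function_germ (zero_locus (patch_domain c)) S \<and> local_generating_function A H c S" for G
      using that uniq by blast
  qed (rule HJ)
qed

end

theorem mainTheorem7:
  fixes A :: "('m::{t2_space, second_countable_topology}, 'n::finite) chart set"
    and H :: "('m, 'n) covector \<Rightarrow> real"
    and c :: "('m, 'n) chart"
  assumes "smooth_structure A"
    and "smooth_hamiltonian A H"
    and "c \<in> A"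
  shows "(\<exists>!g. \<exists>S. g = function_germ (zero_locus (patch_domain c)) S \<and>
            local_generating_function A H c S) \<and>
         (\<forall>S. local_generating_function A H c S \<longrightarrow>
            solves_hamilton_jacobi (patch_domain c) (in_chart A c H) S)"
proof -
  interpret hamiltonian_system A H
    by unfold_locales (rule assms)+
  show ?thesis by (rule local_generating_function_exists_unique[OF assms(3)])
qed

end
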